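(* Let $q$ be a prime power and $n\ge 5$ an integer, and let $\mathcal L$ be a non-trivial intriguing set in the Grassmann graph of planes of ${\rm PG}(n,q)$ which is not tight. Then the following hold. (a) If $n\ge 9$ is odd, then $$|\mathcal L|\ge \frac{(q^{n+1}-1)(q^{n-1}-1)}{(q-1)(q^2-1)},$$ with equality if and only if $\mathcal L$ consists of all planes of ${\rm PG}(n,q)$ that contain a line of a given line spread of ${\rm PG}(n,q)$. The same result holds for $n=7$ if $q\ge 13$. (b) If $n=5$ and $q\ge 25$, then $|\mathcal L|\ge (q+1)(q^2+1)(q^3+1)$, and equality can be achieved by the set of planes of a symplectic polar space $W(5,q)$ embedded in ${\rm PG}(5,q)$.
   Context: The Grassmann graph of planes of ${\rm PG}(n,q)$ has as vertices the planes (2-dimensional projective subspaces) of ${\rm PG}(n,q)$, two planes being adjacent if they meet in a line. For a connected regular graph with vertex set $X$, a set $Y$ of vertices is intriguing if there are integers $x,x'$ such that every vertex of $Y$ is adjacent to exactly $x'$ vertices of $Y$ and every vertex of $X\setminus Y$ is adjacent to exactly $x$ vertices of $Y$; it is non-trivial if $Y\neq\emptyset, X$. For a non-trivial intriguing set, $x'-x$ is a non-trivial eigenvalue (an eigenvalue other than the valency) of the graph, and $Y$ is called tight if $x'-x$ is the largest or the smallest non-trivial eigenvalue. The non-trivial eigenvalues of this Grassmann graph are $\frac{q^2(q+1)(q^{n-3}-1)}{q-1}$, $\frac{q^{n-1}-q^3}{q-1}-q-1$ and $-(q^2+q+1)$. A line spread of ${\rm PG}(n,q)$ is a set of lines partitioning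 the point set. $W(5,q)$ denotes the set of totally isotropic subspaces of a symplectic polarity of ${\rm PG}(5,q)$; its planes are the totally isotropic planes. *)

theory Defs
  imports "HOL-Analysis.Analysis"
begin

section \<open>Intriguing and tight sets in graphs\<close>

text \<open>A graph is given by a finite vertex set \<open>X\<close> together with an adjacency relation \<open>adj\<close>.\<close>

definition nbrs :: "'v set \<Rightarrow> ('v \<Rightarrow> 'v \<Rightarrow> bool) \<Rightarrow> 'v \<Rightarrow> 'v set" where
  "nbrs X adj v = {w \<in> X. adj v w}"

definition has_valency :: "'v set \<Rightarrow> ('v \<Rightarrow> 'v \<Rightarrow> bool) \<Rightarrow> nat \<Rightarrow> bool" where
  "has_valency X adj k \<longleftrightarrow> (\<forall>v\<in>X. card (nbrs X adj v) = k)"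

text \<open>Eigenvalues of the adjacency matrix, whose rows and columns are indexed by \<open>X\<close>. The values
  of \<open>f\<close> outside \<open>X\<close> are irrelevant. As the matrix is real symmetric, all of its eigenvalues
  are real.\<close>

definition graph_eigenvalue :: "'v set \<Rightarrow> ('v \<Rightarrow> 'v \<Rightarrow> bool) \<Rightarrow> real \<Rightarrow> bool" where
  "graph_eigenvalue X adj \<theta> \<longleftrightarrow>
     (\<exists>f :: 'v \<Rightarrow> real. (\<exists>v\<in>X. f v \<noteq> 0) \<and>
        (\<forall>v\<in>X. (\<Sum>w\<in>nbrs X adj v. f w) = \<theta> * f v))"

definition nontrivial_eigenvalue :: "'v set \<Rightarrow> ('v \<Rightarrow> 'v \<Rightarrow> bool) \<Rightarrow> real \<Rightarrow> bool" where
  "nontrivial_eigenvalue X adj \<theta> \<longleftrightarrow>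
     graph_eigenvalue X adj \<theta> \<and> (\<forall>k. has_valency X adj k \<longrightarrow> \<theta> \<noteq> real k)"

definition intriguing_params ::
  "'v set \<Rightarrow> ('v \<Rightarrow> 'v \<Rightarrow> bool) \<Rightarrow> 'v set \<Rightarrow> int \<Rightarrow> int \<Rightarrow> bool" where
  "intriguing_params X adj Y x x' \<longleftrightarrow>
     (\<forall>v\<in>Y. int (card (nbrs X adj v \<inter> Y)) = x') \<and>
     (\<forall>v\<in>X - Y. int (card (nbrs X adj v \<inter> Y)) = x)"

definition intriguing :: "'v set \<Rightarrow> ('v \<Rightarrow> 'v \<Rightarrow> bool) \<Rightarrow> 'v set \<Rightarrow> bool" where
  "intriguing X adj Y \<longleftrightarrow> Y \<subseteq> X \<and> (\<exists>x x'. intriguing_params X adj Y x x')"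

definition nontrivial_intriguing :: "'v set \<Rightarrow> ('v \<Rightarrow> 'v \<Rightarrow> bool) \<Rightarrow> 'v set \<Rightarrow> bool" where
  "nontrivial_intriguing X adj Y \<longleftrightarrow> intriguing X adj Y \<and> Y \<noteq> {} \<and> Y \<noteq> X"

text \<open>For a non-trivial intriguing set the integers \<open>x\<close> and \<open>x'\<close> are uniquely determined.\<close>

definition tight :: "'v set \<Rightarrow> ('v \<Rightarrow> 'v \<Rightarrow> bool) \<Rightarrow> 'v set \<Rightarrow> bool" where
  "tight X adj Y \<longleftrightarrow> nontrivial_intriguing X adj Y \<and>
     (\<exists>x x'. intriguing_params X adj Y x x' \<and>
        nontrivial_eigenvalue X adj (real_of_int (x' - x)) \<and>
        ((\<forall>\<theta>. nontrivial_eigenvalue X adj \<theta> \<longrightarrow> \<theta> \<le> real_of_int (x' - x)) \<or>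
         (\<forall>\<theta>. nontrivial_eigenvalue X adj \<theta> \<longrightarrow> real_of_int (x' - x) \<le> \<theta>)))"


section \<open>The projective space \<open>PG(n,q)\<close>\<close>

text \<open>With \<open>CARD('k) = q\<close> and \<open>CARD('m) = n + 1\<close>, the subspaces of \<open>PG(n,q)\<close> are the linear
  subspaces of \<open>'k ^ 'm\<close>; projective dimension is linear dimension minus one.\<close>

definition proj_subspaces :: "nat \<Rightarrow> ('k::field ^ 'm::finite) set set" where
  "proj_subspaces d = {U. vec.subspace U \<and> vec.dim U = d + 1}"

abbreviation pg_points :: "('k::field ^ 'm::finite) set set" where
  "pg_points \<equiv> proj_subspaces 0"

abbreviation pg_lines :: "('k::field ^ 'm::finite) set set" where
  "pg_lines \<equiv> proj_subspaces 1"

abbreviation pg_planes :: "('k::field ^ 'm::finite) set set" where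
  "pg_planes \<equiv> proj_subspaces 2"

definition meet_in_line :: "('k::field ^ 'm::finite) set \<Rightarrow> ('k ^ 'm) set \<Rightarrow> bool" where
  "meet_in_line U V \<longleftrightarrow> U \<inter> V \<in> pg_lines"

definition line_spread :: "('k::field ^ 'm::finite) set set \<Rightarrow> bool" where
  "line_spread S \<longleftrightarrow> S \<subseteq> pg_lines \<and> (\<forall>P\<in>pg_points. \<exists>!l. l \<in> S \<and> P \<subseteq> l)"


section \<open>Symplectic polarities\<close>

definition symplectic_form :: "('k::field ^ 'm::finite \<Rightarrow> 'k ^ 'm \<Rightarrow> 'k) \<Rightarrow> bool" where
  "symplectic_form B \<longleftrightarrow>
     (\<forall>u. Vector_Spaces.linear (*s) (*) (B u)) \<and>
     (\<forall>v. Vector_Spaces.linear (*s) (*) (\<lambda>u. B u v)) \<and>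
     (\<forall>v. B v v = 0) \<and>
     (\<forall>u. (\<forall>v. B u v = 0) \<longrightarrow> u = 0)"

text \<open>Only the values of a polarity on linear subspaces matter.\<close>

definition symplectic_polarity :: "(('k::field ^ 'm::finite) set \<Rightarrow> ('k ^ 'm) set) \<Rightarrow> bool" where
  "symplectic_polarity \<pi> \<longleftrightarrow>
     (\<exists>B. symplectic_form B \<and>
        (\<forall>U. vec.subspace U \<longrightarrow> \<pi> U = {v. \<forall>u\<in>U. B u v = 0}))"

definition totally_isotropic_planes ::
  "(('k::field ^ 'm::finite) set \<Rightarrow> ('k ^ 'm) set) \<Rightarrow> ('k ^ 'm) set set" where
  "totally_isotropic_planes \<pi> = {U \<in> pg_planes. U \<subseteq> \<pi> U}"

end

theory Submission
  imports Defs
begin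

text \<open>If an intriguing set \<open>Y\<close> of planes is not tight, then its parameter \<open>x' - x\<close> is the middle
  non-trivial eigenvalue. Then every point lies on the same number of planes of \<open>Y\<close>, so that \<open>|Y|\<close>
  is proportional to \<open>x\<close>, and the number of planes of \<open>Y\<close> on a line, summed over the lines of a
  plane \<open>E\<close>, is \<open>x\<close>, plus a constant \<open>D\<close> if \<open>E \<in> Y\<close>. A line on more than \<open>x\<close> planes of \<open>Y\<close> lies on
  planes of \<open>Y\<close> only. If \<open>x\<close> is at most its value for a line spread and \<open>n \<ge> 9\<close>, this forces every
  plane of \<open>Y\<close> to contain such a full line, and the full lines form a spread. For \<open>n = 7\<close>, the planes
  of \<open>Y\<close> without full line are excluded by double counting in solids: a solid contains at most one or
  almost only such planes, and the solids of the second kind on one of these planes form a subspace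
  of its quotient, which has more than \<open>q + 1\<close> but less than \<open>q\<^sup>2 + q + 1\<close> points. For \<open>n = 5\<close>,
  where lines and solids are dual, one takes a line or a solid incident with the largest number of
  planes of \<open>Y\<close>, up to duality a solid, and bounds the second and third moments of the line weights
  in it.

  For the sharpness in (b), a plane which is not totally isotropic contains exactly \<open>q + 1\<close> totally
  isotropic lines. The set is not tight because the other two non-trivial eigenvalues occur: the
  largest comes from the planes on a point, and the smallest from a function with sum zero on the
  planes of every line, which exists as there are more planes than lines.\<close>

section \<open>Lattices of subspaces\<close>

text \<open>The middle eigenvalue is singled out by one identity. Summing line weights over the
  planes on a line \<open>l\<close> expresses \<open>up l\<close> through the points of
  \<open>l\<close>, with a factor that vanishes for this eigenvalue; what remains says that the
  point weights have the same sum on every line. The obstacle afterwards is a pigeonhole. If no line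
  of a plane of \<open>Y\<close> is full, then \<open>D <= (q^2 + q) * x\<close>. At the spread
  value of \<open>x\<close> the right side is about \<open>q^5\<close>, while \<open>D\<close> is
  about \<open>q^(n-2)\<close>. This is absurd for \<open>n >= 9\<close>, but for
  \<open>n = 7\<close> the leading terms agree and the right side has the larger second term. For
  \<open>n = 5\<close> there are no full lines below the bound, and the pigeonhole only yields a
  line of weight at least \<open>q + 1\<close>. This is why the maximum for \<open>n = 5\<close> is
  taken over lines and solids together: in a solid attaining it, every line has at most as many
  planes of \<open>Y\<close> as the solid, and a line attaining it is such a solid in the dual
  space.\<close>

definition gn :: "nat \<Rightarrow> nat \<Rightarrow> nat" where
  "gn q m = (\<Sum>i<m. q ^ i)"

lemma gn_0 [simp]: "gn q 0 = 0"
  by (simp add: gn_def)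

lemma gn_Suc: "gn q (Suc m) = 1 + q * gn q m"
  unfolding gn_def by (subst sum.lessThan_Suc_shift) (simp add: sum_distrib_left)

lemma gn_1 [simp]: "gn q (Suc 0) = 1"
  by (simp add: gn_Suc)

lemma gn_pos: "0 < m \<Longrightarrow> 0 < gn q m"
  by (cases m) (simp_all add: gn_Suc)

lemma gn_Suc': "gn q (Suc m) = gn q m + q ^ m"
  by (simp add: gn_def)

lemma gn_numerals:
  "gn q 2 = 1 + q" "gn q 3 = 1 + q + q^2" "gn q 4 = 1 + q + q^2 + q^3"
  "gn q 5 = 1 + q + q^2 + q^3 + q^4" "gn q 6 = 1 + q + q^2 + q^3 + q^4 + q^5"
  by (simp_all add: gn_def eval_nat_numeral)

lemma gn_mono: "m \<le> n \<Longrightarrow> gn q m \<le> gn q n"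
  unfolding gn_def by (rule sum_mono2) auto

text \<open>The rank is the vector space dimension: elements of rank 1, 2, 3, 4 are the points, lines,
  planes and solids of a projective space of dimension \<open>N - 1\<close>, which has \<open>gn q N\<close> points. Only
  counts in intervals of the lattice are used, so that every result has a dual.\<close>

locale rank_geom =
  fixes car :: "'a set" and le :: "'a \<Rightarrow> 'a \<Rightarrow> bool" (infix \<open>\<preceq>\<close> 50)
    and meet join :: "'a \<Rightarrow> 'a \<Rightarrow> 'a" and rk :: "'a \<Rightarrow> nat" and q N :: nat
  assumes fin: "finite car"
    and q2: "2 \<le> q"
    and le_refl [simp]: "x \<in> car \<Longrightarrow> x \<preceq> x"
    and le_trans: "\<lbrakk>x \<preceq> y; y \<preceq> z; x \<in> car; y \<in> car; z \<in> car\<rbrakk> \<Longrightarrow> x \<preceq> z"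
    and meet_in: "\<lbrakk>x \<in> car; y \<in> car\<rbrakk> \<Longrightarrow> meet x y \<in> car"
    and meet_le1: "\<lbrakk>x \<in> car; y \<in> car\<rbrakk> \<Longrightarrow> meet x y \<preceq> x"
    and meet_le2: "\<lbrakk>x \<in> car; y \<in> car\<rbrakk> \<Longrightarrow> meet x y \<preceq> y"
    and meet_greatest: "\<lbrakk>z \<preceq> x; z \<preceq> y; x \<in> car; y \<in> car; z \<in> car\<rbrakk> \<Longrightarrow> z \<preceq> meet x y"
    and join_in: "\<lbrakk>x \<in> car; y \<in> car\<rbrakk> \<Longrightarrow> join x y \<in> car"
    and join_ge1: "\<lbrakk>x \<in> car; y \<in> car\<rbrakk> \<Longrightarrow> x \<preceq> join x y"
    and join_ge2: "\<lbrakk>x \<in> car; y \<in> car\<rbrakk> \<Longrightarrow> y \<preceq> join x y"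
    and join_least: "\<lbrakk>x \<preceq> z; y \<preceq> z; x \<in> car; y \<in> car; z \<in> car\<rbrakk> \<Longrightarrow> join x y \<preceq> z"
    and rk_le: "x \<in> car \<Longrightarrow> rk x \<le> N"
    and rk_strict: "\<lbrakk>x \<preceq> y; x \<noteq> y; x \<in> car; y \<in> car\<rbrakk> \<Longrightarrow> rk x < rk y"
    and modular: "\<lbrakk>x \<in> car; y \<in> car\<rbrakk> \<Longrightarrow> rk (meet x y) + rk (join x y) = rk x + rk y"
    and bot_ex: "\<exists>b\<in>car. rk b = 0"
    and top_ex: "\<exists>t\<in>car. rk t = N"
    and count_up: "\<lbrakk>x \<preceq> y; x \<in> car; y \<in> car\<rbrakk> \<Longrightarrow>
      card {u \<in> car. x \<preceq> u \<and> u \<preceq> y \<and> rk u = Suc (rk x)} = gn q (rk y - rk x)"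
begin

lemma rk_mono: "\<lbrakk>x \<preceq> y; x \<in> car; y \<in> car\<rbrakk> \<Longrightarrow> rk x \<le> rk y"
  by (metis rk_strict less_imp_le order_refl)

lemma rk_eqD: "\<lbrakk>x \<preceq> y; x \<in> car; y \<in> car; rk y \<le> rk x\<rbrakk> \<Longrightarrow> x = y"
  using rk_strict by fastforce

text \<open>Induction on the height of the interval. Pairs of an atom below a coatom are counted
  twice: every atom is below \<open>gn q d\<close> coatoms by induction, every coatom above
  \<open>gn q d\<close> atoms by \<open>count_up\<close>. Height one is separate because
  \<open>gn q 0 = 0\<close> cannot be cancelled.\<close>

lemma count_down:
  assumes "x \<preceq> y" "x \<in> car" "y \<in> car"
  shows "card {u \<in> car. x \<preceq> u \<and> u \<preceq> y \<and> Suc (rk u) = rk y} = gn q (rk y - rk x)"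
  using assms
proof (induction "rk y - rk x" arbitrary: x)
  case 0
  have "{u \<in> car. x \<preceq> u \<and> u \<preceq> y \<and> Suc (rk u) = rk y} = {}"
    using 0 rk_mono by fastforce
  then show ?case by (simp only: card.empty gn_0 flip: 0(1))
next
  case (Suc d)
  let ?H = "\<lambda>z. {u \<in> car. z \<preceq> u \<and> u \<preceq> y \<and> Suc (rk u) = rk y}"
  let ?A = "{v \<in> car. x \<preceq> v \<and> v \<preceq> y \<and> rk v = Suc (rk x)}"
  have rks: "rk y = rk x + Suc d" using Suc by linarith
  show ?case
  proof (cases "d = 0")
    case True
    have "?H x = {x}"
    proof -
      have "u = x" if "u \<in> ?H x" for u
        using that rks True Suc.prems rk_eqD[of x u] by auto
      moreover have "x \<in> ?H x" using rks True Suc.prems by auto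
      ultimately show ?thesis by blast
    qed
    then show ?thesis using rks True by simp
  next
    case False
    have cA: "card ?A = gn q (Suc d)" using count_up[OF Suc.prems] rks by simp
    have finA: "finite ?A" and finH: "finite (?H z)" for z using fin by auto
    have "(\<Sum>v\<in>?A. card {u. u \<in> ?H x \<and> v \<preceq> u}) = (\<Sum>u\<in>?H x. card {v. v \<in> ?A \<and> v \<preceq> u})"
      by (rule sum_multicount_gen) (use finA finH in auto)
    moreover have "card {u. u \<in> ?H x \<and> v \<preceq> u} = gn q d" if "v \<in> ?A" for v
    proof -
      have "{u. u \<in> ?H x \<and> v \<preceq> u} = ?H v"
        using that le_trans Suc.prems by blast
      moreover have "card (?H v) = gn q (rk y - rk v)"
        by (rule Suc.hyps(1)) (use that rks Suc.prems in auto)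
      ultimately show ?thesis using that rks by simp
    qed
    moreover have "card {v. v \<in> ?A \<and> v \<preceq> u} = gn q d" if "u \<in> ?H x" for u
    proof -
      have "{v. v \<in> ?A \<and> v \<preceq> u} = {v \<in> car. x \<preceq> v \<and> v \<preceq> u \<and> rk v = Suc (rk x)}"
        using that le_trans Suc.prems by blast
      then show ?thesis using count_up[of x u] that Suc.prems rks by simp
    qed
    ultimately have "card ?A * gn q d = card (?H x) * gn q d" by simp
    then show ?thesis using cA gn_pos[of d q] False rks by simp
  qed
qed

end

text \<open>With the dual count among the axioms the system is self-dual, and
  \<open>count_down\<close> turns every \<open>rank_geom\<close> into a model.\<close>

locale proj_geom = rank_geom +
  assumes count_dn: "\<lbrakk>x \<preceq> y; x \<in> car; y \<in> car\<rbrakk> \<Longrightarrow>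
      card {u \<in> car. x \<preceq> u \<and> u \<preceq> y \<and> Suc (rk u) = rk y} = gn q (rk y - rk x)"

lemma (in rank_geom) proj_geom: "proj_geom car le meet join rk q N"
  using count_down by unfold_locales

text \<open>The rank becomes the corank, and \<open>count_up\<close> and \<open>count_dn\<close>
  exchange their roles. The truncated subtraction is exact because ranks are at most
  \<open>N\<close>.\<close>

lemma (in proj_geom) dual:
  "proj_geom car (\<lambda>x y. y \<preceq> x) join meet (\<lambda>x. N - rk x) q N"
proof unfold_locales
  fix x y assume xy: "y \<preceq> x" "x \<in> car" "y \<in> car"
  note r = rk_le[OF xy(2)] rk_le[OF xy(3)] rk_mono[OF xy(1) xy(3) xy(2)]
  have "{u \<in> car. u \<preceq> x \<and> y \<preceq> u \<and> N - rk u = Suc (N - rk x)}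
      = {u \<in> car. y \<preceq> u \<and> u \<preceq> x \<and> Suc (rk u) = rk x}"
    using r rk_le by fastforce
  then show "card {u \<in> car. u \<preceq> x \<and> y \<preceq> u \<and> N - rk u = Suc (N - rk x)} = gn q (N - rk y - (N - rk x))"
    using count_dn[OF xy(1) xy(3) xy(2)] r by simp
  have "u \<in> car \<Longrightarrow> y \<preceq> u \<Longrightarrow> u \<preceq> x \<Longrightarrow> Suc (N - rk u) = N - rk y \<longleftrightarrow> rk u = Suc (rk y)" for u
    using r rk_le[of u] rk_mono[of y u] xy by (cases "rk u = rk y") (auto; linarith)+
  then have "{u \<in> car. u \<preceq> x \<and> y \<preceq> u \<and> Suc (N - rk u) = N - rk y}
      = {u \<in> car. y \<preceq> u \<and> u \<preceq> x \<and> rk u = Suc (rk y)}"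
    by blast
  then show "card {u \<in> car. u \<preceq> x \<and> y \<preceq> u \<and> Suc (N - rk u) = N - rk y} = gn q (N - rk y - (N - rk x))"
    using count_up[OF xy(1) xy(3) xy(2)] r by simp
  show "N - rk x < N - rk y" if "x \<noteq> y" using rk_strict[of y x] that xy r by auto
next
  fix x y assume xy: "x \<in> car" "y \<in> car"
  show "N - rk (join x y) + (N - rk (meet x y)) = N - rk x + (N - rk y)"
    using modular[OF xy] rk_le[OF xy(1)] rk_le[OF xy(2)] rk_le[OF join_in[OF xy]]
      rk_le[OF meet_in[OF xy]] by linarith
next
  obtain b t where "b \<in> car" "rk b = 0" "t \<in> car" "rk t = N"
    using top_ex bot_ex by blast
  then show "\<exists>b\<in>car. N - rk b = 0" "\<exists>t\<in>car. N - rk t = N"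
    by (metis diff_self_eq_0, metis diff_zero)
qed ((rule fin q2 le_refl join_in meet_in join_ge1 join_ge2 join_least meet_le1 meet_le2
      meet_greatest diff_le_self; assumption) | (rule le_trans, assumption+))+

context proj_geom
begin

definition lv :: "nat \<Rightarrow> 'a set" where
  "lv d = {u \<in> car. rk u = d}"

lemma lv_car: "u \<in> lv d \<Longrightarrow> u \<in> car"
  by (simp add: lv_def)

lemma lv_rk: "u \<in> lv d \<Longrightarrow> rk u = d"
  by (simp add: lv_def)

lemma finite_lv [simp]: "finite (lv d)"
  using fin by (simp add: lv_def)

lemma lv_trans: "\<lbrakk>x \<preceq> y; y \<preceq> z; x \<in> lv i; y \<in> lv j; z \<in> lv k\<rbrakk> \<Longrightarrow> x \<preceq> z"
  using le_trans lv_car by blast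

lemma lv_eqI: "\<lbrakk>x \<preceq> y; x \<in> lv i; y \<in> lv i\<rbrakk> \<Longrightarrow> x = y"
  by (rule rk_eqD) (simp_all add: lv_def)

lemma bot_le:
  assumes "b \<in> lv 0" "x \<in> car"
  shows "b \<preceq> x"
proof -
  have b: "b \<in> car" "rk b = 0" using assms by (simp_all add: lv_def)
  have "meet b x = b"
    by (rule rk_eqD) (use b assms meet_le1 meet_in in auto)
  then show ?thesis using meet_le2[OF b(1) assms(2)] by simp
qed

lemma le_top:
  assumes "t \<in> lv N" "x \<in> car"
  shows "x \<preceq> t"
proof -
  have t: "t \<in> car" "rk t = N" using assms by (simp_all add: lv_def)
  have "t = join t x"
    by (rule rk_eqD) (use t assms join_ge1 join_in rk_le in auto)
  then show ?thesis using join_ge2[OF t(1) assms(2)] by simp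
qed

lemma cnt_up:
  assumes "x \<preceq> y" "x \<in> lv i" "y \<in> lv j"
  shows "card {u \<in> lv (Suc i). x \<preceq> u \<and> u \<preceq> y} = gn q (j - i)"
proof -
  have "{u \<in> lv (Suc i). x \<preceq> u \<and> u \<preceq> y} = {u \<in> car. x \<preceq> u \<and> u \<preceq> y \<and> rk u = Suc (rk x)}"
    using assms by (auto simp: lv_def)
  then show ?thesis using count_up[of x y] assms by (simp add: lv_def)
qed

lemma cnt_dn:
  assumes "x \<preceq> y" "x \<in> lv i" "y \<in> lv (Suc j)"
  shows "card {u \<in> lv j. x \<preceq> u \<and> u \<preceq> y} = gn q (Suc j - i)"
proof -
  have "{u \<in> lv j. x \<preceq> u \<and> u \<preceq> y} = {u \<in> car. x \<preceq> u \<and> u \<preceq> y \<and> Suc (rk u) = rk y}"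
    using assms by (auto simp: lv_def)
  then show ?thesis using count_dn[of x y] assms by (simp add: lv_def)
qed

lemma cnt_up_all:
  assumes "x \<in> lv i"
  shows "card {u \<in> lv (Suc i). x \<preceq> u} = gn q (N - i)"
proof -
  obtain t where t: "t \<in> lv N" using top_ex by (auto simp: lv_def)
  have "{u \<in> lv (Suc i). x \<preceq> u} = {u \<in> lv (Suc i). x \<preceq> u \<and> u \<preceq> t}"
    using le_top[OF t] lv_car by blast
  then show ?thesis using cnt_up[OF le_top[OF t] assms t] assms lv_car by simp
qed

lemma cnt_dn_all:
  assumes "y \<in> lv (Suc j)"
  shows "card {u \<in> lv j. u \<preceq> y} = gn q (Suc j)"
proof -
  obtain b where b: "b \<in> lv 0" using bot_ex by (auto simp: lv_def)
  have "{u \<in> lv j. u \<preceq> y} = {u \<in> lv j. b \<preceq> u \<and> u \<preceq> y}"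
    using bot_le[OF b] lv_car by blast
  then show ?thesis using cnt_dn[OF bot_le[OF b] b assms] assms lv_car by simp
qed

lemma cnt_atoms:
  assumes "y \<in> lv j"
  shows "card {u \<in> lv (Suc 0). u \<preceq> y} = gn q j"
proof -
  obtain b where b: "b \<in> lv 0" using bot_ex by (auto simp: lv_def)
  have "{u \<in> lv (Suc 0). u \<preceq> y} = {u \<in> lv (Suc 0). b \<preceq> u \<and> u \<preceq> y}"
    using bot_le[OF b] lv_car by blast
  then show ?thesis using cnt_up[OF bot_le[OF b] b assms] assms lv_car by simp
qed

lemma card_lv1: "card (lv (Suc 0)) = gn q N"
proof -
  obtain t where t: "t \<in> lv N" using top_ex by (auto simp: lv_def)
  have "lv (Suc 0) = {u \<in> lv (Suc 0). u \<preceq> t}" using le_top[OF t] lv_car by blast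
  then show ?thesis using cnt_atoms[OF t] by simp
qed

lemma lv_meet: "\<lbrakk>x \<in> lv i; y \<in> lv j; rk (meet x y) = d\<rbrakk> \<Longrightarrow> meet x y \<in> lv d"
  by (simp add: lv_def meet_in)

lemma lv_join: "\<lbrakk>x \<in> lv i; y \<in> lv j; rk (join x y) = d\<rbrakk> \<Longrightarrow> join x y \<in> lv d"
  by (simp add: lv_def join_in)

lemma common_meet:
  assumes "x \<in> lv i" "y \<in> lv j" "rk (meet x y) = d"
  shows "{l \<in> lv d. l \<preceq> x \<and> l \<preceq> y} = {meet x y}"
proof -
  have c: "x \<in> car" "y \<in> car" using assms by (simp_all add: lv_def)
  have m: "meet x y \<in> lv d" by (rule lv_meet[OF assms])
  have "l = meet x y" if "l \<in> lv d" "l \<preceq> x" "l \<preceq> y" for l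
    by (rule lv_eqI[OF meet_greatest[OF that(2,3) c lv_car[OF that(1)]] that(1) m])
  moreover have "meet x y \<preceq> x \<and> meet x y \<preceq> y"
    using meet_le1[OF c] meet_le2[OF c] by simp
  ultimately show ?thesis using m by blast
qed

lemma common_join:
  assumes "x \<in> lv i" "y \<in> lv j" "rk (join x y) = d"
  shows "{l \<in> lv d. x \<preceq> l \<and> y \<preceq> l} = {join x y}"
proof -
  have c: "x \<in> car" "y \<in> car" using assms by (simp_all add: lv_def)
  have m: "join x y \<in> lv d" by (rule lv_join[OF assms])
  have "l = join x y" if "l \<in> lv d" "x \<preceq> l" "y \<preceq> l" for l
    by (rule lv_eqI[OF join_least[OF that(2,3) c lv_car[OF that(1)]] m that(1), symmetric])
  moreover have "x \<preceq> join x y \<and> y \<preceq> join x y"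
    using join_ge1[OF c] join_ge2[OF c] by simp
  ultimately show ?thesis using m by blast
qed

lemma common_meet_empty:
  assumes "x \<in> lv i" "y \<in> lv j" "rk (meet x y) < d"
  shows "{l \<in> lv d. l \<preceq> x \<and> l \<preceq> y} = {}"
proof -
  have False if "l \<in> lv d" "l \<preceq> x" "l \<preceq> y" for l
    using meet_greatest[of l x y] that assms lv_car rk_mono[of l "meet x y"] meet_in lv_rk
    by (metis not_le)
  then show ?thesis by blast
qed

lemma cover_join:
  assumes "x \<in> lv i" "y \<in> lv i" "x \<noteq> y" "x \<preceq> z" "y \<preceq> z" "z \<in> lv (Suc i)"
  shows "join x y = z"
proof (rule rk_eqD)
  show "join x y \<preceq> z" using join_least assms lv_car by blast
  show "join x y \<in> car" "z \<in> car" using assms join_in lv_car by blast+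
  have "rk (join x y) \<noteq> i"
    by (metis assms(1,2,3) join_ge1 join_ge2 lv_car lv_eqI lv_join)
  moreover have "i \<le> rk (join x y)"
    using rk_mono[of x "join x y"] assms lv_car join_ge1 join_in lv_rk by metis
  ultimately show "rk z \<le> rk (join x y)" using assms(6) lv_rk by fastforce
qed

lemma cover_meet:
  assumes "x \<in> lv i" "y \<in> lv i" "x \<noteq> y" "z \<preceq> x" "z \<preceq> y" "z \<in> lv j" "i = Suc j"
  shows "meet x y = z"
proof (rule sym, rule rk_eqD)
  show "z \<preceq> meet x y" using meet_greatest assms lv_car by blast
  show "meet x y \<in> car" "z \<in> car" using assms meet_in lv_car by blast+
  have "rk (meet x y) \<noteq> i"
    by (metis assms(1,2,3) meet_le1 meet_le2 lv_car lv_eqI lv_meet)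
  moreover have "rk (meet x y) \<le> i"
    using rk_mono[of "meet x y" x] assms lv_car meet_le1 meet_in lv_rk by metis
  ultimately show "rk (meet x y) \<le> rk z" using assms(6,7) lv_rk by fastforce
qed

lemma rk_meet_join:
  "\<lbrakk>x \<in> lv i; y \<in> lv j\<rbrakk> \<Longrightarrow> rk (meet x y) + rk (join x y) = i + j"
  using modular[of x y] by (simp add: lv_def)

lemma cover_rk_meet:
  assumes "x \<in> lv i" "y \<in> lv i" "x \<noteq> y" "x \<preceq> z" "y \<preceq> z" "z \<in> lv (Suc i)"
  shows "Suc (rk (meet x y)) = i"
  using rk_meet_join[OF assms(1,2)] cover_join[OF assms] assms(6) lv_rk by fastforce

lemma cover_rk_join:
  assumes "x \<in> lv i" "y \<in> lv i" "x \<noteq> y" "z \<preceq> x" "z \<preceq> y" "z \<in> lv j" "i = Suc j"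
  shows "rk (join x y) = Suc i"
  using rk_meet_join[OF assms(1,2)] cover_meet[OF assms] assms(6,7) lv_rk by fastforce

lemma coatom_rk_meet:
  assumes "x \<in> lv i" "y \<in> lv j" "x \<preceq> z" "y \<preceq> z" "z \<in> lv (Suc j)" "\<not> x \<preceq> y"
  shows "Suc (rk (meet x y)) = i"
proof -
  have "join x y = z"
  proof (rule rk_eqD)
    show "join x y \<preceq> z" using join_least assms lv_car by blast
    show "join x y \<in> car" "z \<in> car" using assms join_in lv_car by blast+
    have "y \<noteq> join x y" using assms join_ge1 lv_car by metis
    then have "j < rk (join x y)"
      using rk_strict[of y "join x y"] assms lv_car join_ge2 join_in lv_rk by metis
    then show "rk z \<le> rk (join x y)" using assms(5) lv_rk by fastforce
  qed
  then show ?thesis using rk_meet_join[OF assms(1,2)] assms(5) lv_rk by fastforce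
qed

lemma atom_rk_join:
  assumes "x \<in> lv i" "y \<in> lv j" "z \<preceq> x" "z \<preceq> y" "z \<in> lv k" "i = Suc k" "\<not> x \<preceq> y"
  shows "rk (join x y) = Suc j"
proof -
  have "z = meet x y"
  proof (rule rk_eqD)
    show "z \<preceq> meet x y" using meet_greatest assms lv_car by blast
    show "meet x y \<in> car" "z \<in> car" using assms meet_in lv_car by blast+
    have "meet x y \<noteq> x" using assms meet_le2 lv_car by metis
    then have "rk (meet x y) < i"
      using rk_strict[of "meet x y" x] assms lv_car meet_le1 meet_in lv_rk by metis
    then show "rk (meet x y) \<le> rk z" using assms(5,6) lv_rk by fastforce
  qed
  then show ?thesis using rk_meet_join[OF assms(1,2)] assms(5,6) lv_rk by fastforce
qed

lemma point_join_rk: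
  assumes "P \<in> lv (Suc 0)" "y \<in> lv j" "\<not> P \<preceq> y"
  shows "rk (join P y) = Suc j"
proof -
  obtain b where "b \<in> lv 0" using bot_ex by (auto simp: lv_def)
  then show ?thesis using atom_rk_join[of P "Suc 0" y j b 0] assms bot_le lv_car by blast
qed

end

section \<open>Eigenvalues of the graph of planes\<close>

lemma sum_swap_card:
  fixes f :: "'b \<Rightarrow> real"
  assumes "finite A" "finite B"
  shows "(\<Sum>a\<in>A. \<Sum>b\<in>{b\<in>B. R a b}. f b) = (\<Sum>b\<in>B. real (card {a\<in>A. R a b}) * f b)"
  using sum.swap_restrict[OF assms, of "\<lambda>a b. f b" R] by simp

context proj_geom
begin

text \<open>The incidence map from functions on planes to functions on lines. It is also applied to
  points, where it sums over the planes on a point.\<close>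

definition lsum :: "('a \<Rightarrow> real) \<Rightarrow> 'a \<Rightarrow> real" where
  "lsum f l = (\<Sum>E\<in>{E \<in> lv 3. l \<preceq> E}. f E)"

lemma cnt_lines_plane: "E \<in> lv 3 \<Longrightarrow> card {l \<in> lv 2. l \<preceq> E} = gn q 3"
  using cnt_dn_all[of E 2] by (simp add: eval_nat_numeral)

lemma cnt_points: "y \<in> lv j \<Longrightarrow> card {P \<in> lv 1. P \<preceq> y} = gn q j"
  using cnt_atoms by simp

lemma cnt_planes_line: "l \<in> lv 2 \<Longrightarrow> card {E \<in> lv 3. l \<preceq> E} = gn q (N - 2)"
  using cnt_up_all[of l 2] by (simp add: eval_nat_numeral)

lemma cnt_lines_point: "P \<in> lv 1 \<Longrightarrow> card {l \<in> lv 2. P \<preceq> l} = gn q (N - 1)"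
  using cnt_up_all[of P 1] by (simp add: eval_nat_numeral)

lemma cnt_lines_flag: "\<lbrakk>P \<in> lv 1; E \<in> lv 3; P \<preceq> E\<rbrakk> \<Longrightarrow> card {l \<in> lv 2. P \<preceq> l \<and> l \<preceq> E} = q + 1"
  using cnt_up[of P E 1 3] by (simp add: eval_nat_numeral gn_numerals gn_Suc)

lemma cnt_points_line: "l \<in> lv 2 \<Longrightarrow> card {P \<in> lv 1. P \<preceq> l} = q + 1"
  using cnt_points[of l 2] by (simp add: gn_numerals)

lemma rk_meet_le:
  assumes "x \<in> lv i" "y \<in> lv i" "x \<noteq> y"
  shows "rk (meet x y) < i"
proof -
  have c: "x \<in> car" "y \<in> car" "rk x = i" "rk y = i" using assms by (simp_all add: lv_def)
  have "rk (meet x y) \<le> i" using rk_mono[OF meet_le1[OF c(1,2)]] meet_in c by simp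
  moreover have "rk (meet x y) \<noteq> i"
    using lv_meet[OF assms(1,2)] meet_le1[OF c(1,2)] meet_le2[OF c(1,2)] lv_eqI assms by metis
  ultimately show ?thesis by simp
qed

lemma cnt_common_lines:
  assumes "E \<in> lv 3" "E' \<in> lv 3"
  shows "card {l \<in> lv 2. l \<preceq> E \<and> l \<preceq> E'} =
    (if E' = E then gn q 3 else if rk (meet E E') = 2 then 1 else 0)"
proof -
  consider "E' = E" | "E' \<noteq> E" "rk (meet E E') = 2" | "E' \<noteq> E" "rk (meet E E') < 2"
    using rk_meet_le[OF assms] by fastforce
  then show ?thesis
  proof cases
    case 1 then show ?thesis using cnt_lines_plane[OF assms(1)] by simp
  next
    case 2 then show ?thesis using common_meet[OF assms, of 2] by simp
  next
    case 3
    have "{l \<in> lv 2. l \<preceq> E \<and> l \<preceq> E'} = {}"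
      by (rule common_meet_empty[OF assms 3(2)])
    then show ?thesis using 3 by simp
  qed
qed

text \<open>As a matrix identity, the incidence map followed by its transpose is the adjacency
  matrix plus \<open>gn q 3\<close> times the identity: distinct planes share a line exactly if they
  are adjacent, and then only one.\<close>

lemma sum_lsum_plane:
  fixes f :: "'a \<Rightarrow> real"
  assumes "E \<in> lv 3"
  shows "(\<Sum>l\<in>{l \<in> lv 2. l \<preceq> E}. lsum f l) =
    gn q 3 * f E + (\<Sum>E'\<in>{E' \<in> lv 3. rk (meet E E') = 2}. f E')"
proof -
  have rE: "rk (meet E E) \<noteq> 2"
    using rk_eqD[of "meet E E" E] meet_greatest[of E E E] meet_in[of E E] rk_mono[of E "meet E E"] assms
    by (auto simp: lv_def)
  have "(\<Sum>l\<in>{l \<in> lv 2. l \<preceq> E}. lsum f l)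
      = (\<Sum>E'\<in>lv 3. real (card {l \<in> {l \<in> lv 2. l \<preceq> E}. l \<preceq> E'}) * f E')"
    unfolding lsum_def by (rule sum_swap_card) simp_all
  also have "\<dots> = (\<Sum>E'\<in>lv 3. (if E' = E then gn q 3 * f E else 0)
      + (if rk (meet E E') = 2 then f E' else 0))"
    by (rule sum.cong) (use cnt_common_lines[OF assms] rE in auto)
  also have "\<dots> = gn q 3 * f E + (\<Sum>E'\<in>{E' \<in> lv 3. rk (meet E E') = 2}. f E')"
    using assms by (simp add: sum.distrib sum.delta sum.inter_filter)
  finally show ?thesis .
qed

lemma sum_lsum_point:
  fixes f :: "'a \<Rightarrow> real"
  assumes "P \<in> lv 1"
  shows "(\<Sum>l\<in>{l \<in> lv 2. P \<preceq> l}. lsum f l) = (q + 1) * lsum f P"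
proof -
  have "(\<Sum>l\<in>{l \<in> lv 2. P \<preceq> l}. lsum f l)
      = (\<Sum>E\<in>lv 3. real (card {l \<in> {l \<in> lv 2. P \<preceq> l}. l \<preceq> E}) * f E)"
    unfolding lsum_def by (rule sum_swap_card) simp_all
  also have "\<dots> = (\<Sum>E\<in>lv 3. if P \<preceq> E then (q + 1) * f E else 0)"
  proof (rule sum.cong, rule refl)
    fix E assume E: "E \<in> lv 3"
    show "real (card {l \<in> {l \<in> lv 2. P \<preceq> l}. l \<preceq> E}) * f E = (if P \<preceq> E then (q + 1) * f E else 0)"
    proof (cases "P \<preceq> E")
      case True then show ?thesis using cnt_lines_flag[OF assms E] by simp
    next
      case False
      then have "{l \<in> {l \<in> lv 2. P \<preceq> l}. l \<preceq> E} = {}" using lv_trans assms E by blast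
      then show ?thesis using False by simp
    qed
  qed
  also have "\<dots> = (q + 1) * lsum f P"
    unfolding lsum_def by (simp add: sum.inter_filter sum_distrib_left if_distrib cong: if_cong)
  finally show ?thesis .
qed

text \<open>Distinct lines span a plane exactly if they meet in a point, so their common planes and
  common points are equal in number. Only for \<open>l' = l\<close> do the two counts,
  \<open>gn q (N - 2)\<close> and \<open>q + 1\<close>, differ. This trades the planes on a line for
  its points.\<close>

lemma cnt_planes_two_lines:
  assumes "l \<in> lv 2" "l' \<in> lv 2"
  shows "real (card {E \<in> lv 3. l \<preceq> E \<and> l' \<preceq> E}) =
    real (card {P \<in> lv 1. P \<preceq> l \<and> P \<preceq> l'}) + (if l' = l then real (gn q (N - 2)) - (q + 1) else 0)"
proof -
  have j: "rk (meet l l') + rk (join l l') = 4" using rk_meet_join[OF assms] by simp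
  consider "l' = l" | "l' \<noteq> l" "rk (meet l l') = 1" | "l' \<noteq> l" "rk (meet l l') < 1"
    using rk_meet_le[OF assms] by fastforce
  then show ?thesis
  proof cases
    case 1 then show ?thesis using cnt_planes_line cnt_points_line assms by simp
  next
    case 2 then show ?thesis using common_meet[OF assms, of 1] common_join[OF assms, of 3] j by simp
  next
    case 3
    have P0: "card {P \<in> lv 1. P \<preceq> l \<and> P \<preceq> l'} = 0"
      by (simp only: common_meet_empty[OF assms 3(2)] card.empty)
    have E0: "card {E \<in> lv 3. l \<preceq> E \<and> l' \<preceq> E} = 0"
    proof -
      have False if "E \<in> lv 3" "l \<preceq> E" "l' \<preceq> E" for E
      proof -
        have "join l l' \<preceq> E" "join l l' \<in> car" "E \<in> car" "rk E = 3"
          using that assms join_least join_in by (auto simp: lv_def)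
        then show False using rk_mono j 3 by fastforce
      qed
      then have "{E \<in> lv 3. l \<preceq> E \<and> l' \<preceq> E} = {}" by blast
      then show ?thesis by (simp only: card.empty)
    qed
    show ?thesis unfolding P0 E0 using 3(1) by simp
  qed
qed

lemma sum_planes_on_line:
  fixes u :: "'a \<Rightarrow> real"
  assumes "l \<in> lv 2"
  shows "(\<Sum>E\<in>{E \<in> lv 3. l \<preceq> E}. \<Sum>l'\<in>{l' \<in> lv 2. l' \<preceq> E}. u l') =
    (gn q (N - 2) - (q + 1 :: real)) * u l
      + (\<Sum>P\<in>{P \<in> lv 1. P \<preceq> l}. \<Sum>l'\<in>{l' \<in> lv 2. P \<preceq> l'}. u l')"
proof -
  have "(\<Sum>E\<in>{E \<in> lv 3. l \<preceq> E}. \<Sum>l'\<in>{l' \<in> lv 2. l' \<preceq> E}. u l')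
      = (\<Sum>l'\<in>lv 2. real (card {E \<in> {E \<in> lv 3. l \<preceq> E}. l' \<preceq> E}) * u l')"
    by (rule sum_swap_card) simp_all
  also have "\<dots> = (\<Sum>l'\<in>lv 2. real (card {P \<in> {P \<in> lv 1. P \<preceq> l}. P \<preceq> l'}) * u l'
      + (if l' = l then (gn q (N - 2) - (q + 1 :: real)) * u l' else 0))"
    by (rule sum.cong) (use cnt_planes_two_lines[OF assms] in \<open>auto simp: algebra_simps\<close>)
  also have "\<dots> = (\<Sum>P\<in>{P \<in> lv 1. P \<preceq> l}. \<Sum>l'\<in>{l' \<in> lv 2. P \<preceq> l'}. u l')
      + (gn q (N - 2) - (q + 1 :: real)) * u l"
    using assms sum_swap_card[where A = "{P \<in> lv 1. P \<preceq> l}" and B = "lv 2" and R = "(\<preceq>)" and f = u]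
    by (simp add: sum.distrib sum.delta)
  finally show ?thesis by simp
qed

lemma cnt_lines_two_points:
  assumes "P \<in> lv 1" "P' \<in> lv 1"
  shows "card {l \<in> lv 2. P \<preceq> l \<and> P' \<preceq> l} = (if P' = P then gn q (N - 1) else 1)"
proof (cases "P' = P")
  case False
  then have "\<not> P' \<preceq> P" using lv_eqI assms by blast
  then have "rk (join P' P) = 2" using point_join_rk[of P' P 1] assms by simp
  then have "{l \<in> lv 2. P' \<preceq> l \<and> P \<preceq> l} = {join P' P}" by (rule common_join[OF assms(2,1)])
  then show ?thesis using False by (simp add: conj_commute)
qed (use cnt_lines_point[OF assms(1)] in simp)

lemma sum_lines_on_point:
  fixes h :: "'a \<Rightarrow> real"
  assumes "P \<in> lv 1"
  shows "(\<Sum>l\<in>{l \<in> lv 2. P \<preceq> l}. \<Sum>P'\<in>{P' \<in> lv 1. P' \<preceq> l}. h P') =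
    (gn q (N - 1) - (1 :: real)) * h P + (\<Sum>P'\<in>lv 1. h P')"
proof -
  have "(\<Sum>l\<in>{l \<in> lv 2. P \<preceq> l}. \<Sum>P'\<in>{P' \<in> lv 1. P' \<preceq> l}. h P')
      = (\<Sum>P'\<in>lv 1. real (card {l \<in> {l \<in> lv 2. P \<preceq> l}. P' \<preceq> l}) * h P')"
    by (rule sum_swap_card) simp_all
  also have "\<dots> = (\<Sum>P'\<in>lv 1. h P' + (if P' = P then (gn q (N - 1) - (1 :: real)) * h P' else 0))"
    by (rule sum.cong) (use cnt_lines_two_points[OF assms] in \<open>auto simp: algebra_simps\<close>)
  also have "\<dots> = (gn q (N - 1) - (1 :: real)) * h P + (\<Sum>P'\<in>lv 1. h P')"
    using assms by (simp add: sum.distrib sum.delta)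
  finally show ?thesis .
qed

text \<open>Both sides evaluate the sum of \<open>lsum f\<close> over the lines of the planes on \<open>l\<close>.\<close>

lemma point_sums_on_line:
  fixes f :: "'a \<Rightarrow> real" and \<kappa> c :: real
  assumes "\<And>E. E \<in> lv 3 \<Longrightarrow> (\<Sum>l\<in>{l \<in> lv 2. l \<preceq> E}. lsum f l) = \<kappa> * f E + c"
    and l: "l \<in> lv 2"
  shows "(\<kappa> - (gn q (N - 2) - (q + 1 :: real))) * lsum f l + gn q (N - 2) * c
    = (q + 1) * (\<Sum>P\<in>{P \<in> lv 1. P \<preceq> l}. lsum f P)"
proof -
  have "(\<Sum>E\<in>{E \<in> lv 3. l \<preceq> E}. \<Sum>l'\<in>{l' \<in> lv 2. l' \<preceq> E}. lsum f l')
      = (\<Sum>E\<in>{E \<in> lv 3. l \<preceq> E}. \<kappa> * f E + c)"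
    by (rule sum.cong) (use assms(1) in auto)
  also have "\<dots> = \<kappa> * lsum f l + gn q (N - 2) * c"
    using cnt_planes_line[OF l] by (simp add: sum.distrib lsum_def sum_distrib_left)
  finally have "\<kappa> * lsum f l + gn q (N - 2) * c = (gn q (N - 2) - (q + 1 :: real)) * lsum f l
      + (\<Sum>P\<in>{P \<in> lv 1. P \<preceq> l}. \<Sum>l'\<in>{l' \<in> lv 2. P \<preceq> l'}. lsum f l')"
    using sum_planes_on_line[OF l, of "lsum f"] by simp
  moreover have "(\<Sum>P\<in>{P \<in> lv 1. P \<preceq> l}. \<Sum>l'\<in>{l' \<in> lv 2. P \<preceq> l'}. lsum f l')
      = (\<Sum>P\<in>{P \<in> lv 1. P \<preceq> l}. (q + 1) * lsum f P)"
    by (rule sum.cong) (use sum_lsum_point in auto)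
  ultimately show ?thesis by (simp add: sum_distrib_left algebra_simps)
qed

text \<open>Away from the three values, three factors are non-zero and are cancelled in turn:
  \<open>lsum f\<close> is constant on points, then on lines, and finally \<open>f\<close> is
  constant. The term \<open>c\<close> makes the lemma apply to eigenvectors (\<open>c = 0\<close>)
  and to indicator functions of intriguing sets (\<open>c = x\<close>) alike.\<close>

lemma spectrum_cases:
  fixes f :: "'a \<Rightarrow> real" and \<theta> c :: real
  assumes f: "\<And>E. E \<in> lv 3 \<Longrightarrow> (\<Sum>E'\<in>{E' \<in> lv 3. rk (meet E E') = 2}. f E') = \<theta> * f E + c"
    and N: "N \<ge> 3"
  shows "\<theta> = - real (gn q 3) \<or> \<theta> = real (gn q (N - 2)) - (q + 1) - gn q 3
    \<or> \<theta> = real (gn q (N - 2)) - (q + 1) - gn q 3 - 1 + gn q (N - 1)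
    \<or> (\<exists>b. \<forall>E\<in>lv 3. f E = b)"
proof (rule ccontr)
  let ?a = "real (gn q (N - 2)) - (q + 1)" and ?\<kappa> = "\<theta> + gn q 3"
  assume neg: "\<not> ?thesis"
  have *: "(\<Sum>l\<in>{l \<in> lv 2. l \<preceq> E}. lsum f l) = ?\<kappa> * f E + c" if "E \<in> lv 3" for E
    using sum_lsum_plane[OF that, of f] f[OF that] by (simp add: algebra_simps)
  note L = point_sums_on_line[of f, OF *]
  define S where "S = (\<Sum>P\<in>lv 1. lsum f P)"
  have P: "(?\<kappa> - ?a - (real (gn q (N - 1)) - 1)) * ((q + 1) * lsum f P)
      = (q + 1) * S - gn q (N - 1) * (gn q (N - 2) * c)" if "P \<in> lv 1" for P
  proof -
    have "(\<Sum>l\<in>{l \<in> lv 2. P \<preceq> l}. (?\<kappa> - ?a) * lsum f l + gn q (N - 2) * c)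
      = (\<Sum>l\<in>{l \<in> lv 2. P \<preceq> l}. (q + 1) * (\<Sum>P'\<in>{P' \<in> lv 1. P' \<preceq> l}. lsum f P'))"
      by (rule sum.cong) (use L in auto)
    then have "(?\<kappa> - ?a) * (\<Sum>l\<in>{l \<in> lv 2. P \<preceq> l}. lsum f l) + gn q (N - 1) * (gn q (N - 2) * c)
      = (q + 1) * (\<Sum>l\<in>{l \<in> lv 2. P \<preceq> l}. \<Sum>P'\<in>{P' \<in> lv 1. P' \<preceq> l}. lsum f P')"
      using cnt_lines_point[OF that] by (simp add: sum.distrib sum_distrib_left)
    then show ?thesis
      unfolding sum_lsum_point[OF that] sum_lines_on_point[OF that] S_def by (simp add: algebra_simps)
  qed
  have "?\<kappa> - ?a - (real (gn q (N - 1)) - 1) \<noteq> 0" using neg by auto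
  then have "\<exists>b. \<forall>P\<in>lv 1. lsum f P = b"
    using P by (metis (no_types, lifting) mult_left_cancel of_nat_eq_0_iff add_is_0 one_neq_zero)
  then obtain b where b: "\<And>P. P \<in> lv 1 \<Longrightarrow> lsum f P = b" by blast
  have "\<exists>b'. \<forall>l\<in>lv 2. lsum f l = b'"
  proof -
    have "(?\<kappa> - ?a) * lsum f l = (q + 1) * ((q + 1) * b) - gn q (N - 2) * c" if "l \<in> lv 2" for l
    proof -
      have "(\<Sum>P\<in>{P \<in> lv 1. P \<preceq> l}. lsum f P) = (q + 1) * b"
        using b cnt_points_line[OF that] by simp
      then show ?thesis using L[OF _ that] by (simp add: algebra_simps)
    qed
    moreover have "?\<kappa> - ?a \<noteq> 0" using neg by auto
    ultimately show ?thesis by (metis mult_left_cancel)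
  qed
  then obtain b' where "\<And>l. l \<in> lv 2 \<Longrightarrow> lsum f l = b'" by blast
  then have "?\<kappa> * f E = gn q 3 * b' - c" if "E \<in> lv 3" for E
    using *[OF that] cnt_lines_plane[OF that] by simp
  moreover have "?\<kappa> \<noteq> 0" using neg by auto
  ultimately have "\<exists>b. \<forall>E\<in>lv 3. f E = b" by (metis mult_left_cancel)
  then show False using neg by blast
qed

end

section \<open>Intriguing sets for the middle eigenvalue\<close>

text \<open>The pair of parameters is encoded by \<open>x\<close> alone, the second one being
  \<open>x\<close> plus the middle eigenvalue. A plane meets itself in rank 3 and so is not its own
  neighbour.\<close>

locale intriguing_geom = proj_geom +
  fixes Y :: "'a set" and x :: real
  assumes Y_sub: "Y \<subseteq> lv 3"
    and N6: "6 \<le> N"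
    and adjacent: "E \<in> lv 3 \<Longrightarrow> real (card {E' \<in> Y. rk (meet E E') = 2}) =
      x + (if E \<in> Y then real (gn q (N - 2)) - (q + 1) - gn q 3 else 0)"
begin

definition up :: "'a \<Rightarrow> real" where
  "up X = real (card {E \<in> Y. X \<preceq> E})"

definition dn :: "'a \<Rightarrow> real" where
  "dn U = real (card {E \<in> Y. E \<preceq> U})"

text \<open>The middle eigenvalue plus \<open>gn q 3\<close>; as \<open>\<kappa>\<close> it makes
  the factor of \<open>lsum f l\<close> in \<open>point_sums_on_line\<close> vanish.\<close>

definition D :: real where
  "D = real (gn q (N - 2)) - (q + 1)"

lemma finite_Y [simp]: "finite Y"
  using Y_sub finite_lv finite_subset by blast

lemma Y_lv: "E \<in> Y \<Longrightarrow> E \<in> lv 3"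
  using Y_sub by blast

lemma up_nonneg [simp]: "0 \<le> up X"
  by (simp add: up_def)

lemma sum_indicator_Y:
  "finite A \<Longrightarrow> (\<Sum>E\<in>A. indicator Y E :: real) = real (card (A \<inter> Y))"
  by (simp add: indicator_def sum.inter_restrict[symmetric] flip: sum.inter_filter)

lemma lsum_up: "lsum (indicator Y) X = up X"
proof -
  have "{E \<in> lv 3. X \<preceq> E} \<inter> Y = {E \<in> Y. X \<preceq> E}" using Y_sub by blast
  then show ?thesis unfolding lsum_def up_def by (subst sum_indicator_Y) simp_all
qed

lemma sum_up_plane:
  assumes "E \<in> lv 3"
  shows "(\<Sum>l\<in>{l \<in> lv 2. l \<preceq> E}. up l) = x + (if E \<in> Y then D else 0)"
proof -
  have "{E' \<in> lv 3. rk (meet E E') = 2} \<inter> Y = {E' \<in> Y. rk (meet E E') = 2}" using Y_sub by blast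
  then have "(\<Sum>E'\<in>{E' \<in> lv 3. rk (meet E E') = 2}. indicator Y E' :: real)
      = x + (if E \<in> Y then D - gn q 3 else 0)"
    using adjacent[OF assms] by (subst sum_indicator_Y) (simp_all add: D_def)
  then show ?thesis
    using sum_lsum_plane[OF assms, of "indicator Y"] by (simp add: lsum_up split: if_splits)
qed

lemma point_sum_line:
  assumes "l \<in> lv 2"
  shows "(q + 1) * (\<Sum>P\<in>{P \<in> lv 1. P \<preceq> l}. up P) = gn q (N - 2) * x"
  using point_sums_on_line[of "indicator Y" D x l] sum_up_plane assms
  by (simp add: lsum_up D_def indicator_def if_distrib cong: if_cong)

text \<open>The sums of \<open>point_sum_line\<close> over the lines on a point give a positive
  multiple of \<open>up P\<close> plus a term that does not depend on \<open>P\<close>. Hence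
  \<open>up\<close> is constant on points, and any single line yields its value.\<close>

lemma up_point:
  assumes "P \<in> lv 1"
  shows "(q + 1)^2 * up P = gn q (N - 2) * x"
proof -
  define S where "S = (\<Sum>P\<in>lv 1. up P)"
  have N1: "real (gn q (N - 1)) - 1 > 0"
  proof -
    have "gn q 5 \<le> gn q (N - 1)" by (rule gn_mono) (use N6 in simp)
    then show ?thesis using q2 by (simp add: gn_numerals)
  qed
  have *: "(real (gn q (N - 1)) - 1) * ((q + 1) * up R) + (q + 1) * S = gn q (N - 1) * (gn q (N - 2) * x)"
    if "R \<in> lv 1" for R
  proof -
    have "(\<Sum>l\<in>{l \<in> lv 2. R \<preceq> l}. (q + 1) * (\<Sum>P\<in>{P \<in> lv 1. P \<preceq> l}. up P))
        = (\<Sum>l\<in>{l \<in> lv 2. R \<preceq> l}. gn q (N - 2) * x)"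
      by (rule sum.cong) (use point_sum_line in auto)
    then have "(q + 1) * (\<Sum>l\<in>{l \<in> lv 2. R \<preceq> l}. \<Sum>P\<in>{P \<in> lv 1. P \<preceq> l}. up P)
        = gn q (N - 1) * (gn q (N - 2) * x)"
      using cnt_lines_point[OF that] by (simp add: sum_distrib_left)
    then show ?thesis
      unfolding sum_lines_on_point[OF that] S_def by (simp add: algebra_simps)
  qed
  have "up R = up P" if "R \<in> lv 1" for R
  proof -
    have "(real (gn q (N - 1)) - 1) * (real (q + 1) * up R) = (real (gn q (N - 1)) - 1) * (real (q + 1) * up P)"
      using *[OF that] *[OF assms] by linarith
    moreover have "real (q + 1) > 0" by simp
    ultimately show ?thesis using N1 by (metis mult_left_cancel less_irrefl)
  qed
  moreover obtain l where l: "l \<in> lv 2"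
  proof -
    have "card {l \<in> lv 2. P \<preceq> l} > 0" using cnt_lines_point[OF assms] gn_pos N6 by simp
    then show ?thesis using that by (metis (no_types, lifting) card_gt_0_iff empty_iff equals0I mem_Collect_eq)
  qed
  ultimately have "(\<Sum>P\<in>{P \<in> lv 1. P \<preceq> l}. up P) = (q + 1) * up P"
    using cnt_points_line[OF l] by simp
  then show ?thesis using point_sum_line[OF l] by (simp add: power2_eq_square algebra_simps)
qed

lemma x_nonneg: "0 \<le> x"
proof -
  have "lv 1 \<noteq> {}" using card_lv1 gn_pos[of N q] N6 by auto
  then obtain P where "P \<in> lv 1" by blast
  then have "0 \<le> gn q (N - 2) * x" using up_point up_nonneg[of P] by (metis mult_nonneg_nonneg of_nat_0_le_iff)
  moreover have "gn q (N - 2) > 0" using gn_pos N6 by simp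
  ultimately show ?thesis by (simp add: zero_le_mult_iff)
qed

text \<open>Counting incident pairs of points and planes of \<open>Y\<close>. This turns every bound
  on \<open>x\<close> into a bound on the size of \<open>Y\<close>.\<close>

lemma card_Y: "gn q 3 * (q + 1)^2 * card Y = gn q N * gn q (N - 2) * x"
proof -
  have "(\<Sum>P\<in>lv 1. \<Sum>E\<in>{E \<in> Y. P \<preceq> E}. 1 :: real) = (\<Sum>E\<in>Y. real (card {P \<in> lv 1. P \<preceq> E}) * 1)"
    by (rule sum_swap_card) simp_all
  also have "\<dots> = (\<Sum>E\<in>Y. real (gn q 3))"
    by (rule sum.cong) (use cnt_points Y_lv in auto)
  also have "\<dots> = card Y * gn q 3" by simp
  finally have "(\<Sum>P\<in>lv 1. up P) = card Y * gn q 3" by (simp add: up_def)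
  moreover have "(\<Sum>P\<in>lv 1. (q + 1)^2 * up P) = (\<Sum>P\<in>lv 1. gn q (N - 2) * x)"
    by (rule sum.cong) (use up_point in auto)
  then have "(q + 1)^2 * (\<Sum>P\<in>lv 1. up P) = gn q N * (gn q (N - 2) * x)"
    using card_lv1 by (simp flip: sum_distrib_left)
  ultimately show ?thesis by (simp add: algebra_simps)
qed

end

text \<open>Two spread lines in one plane would meet in a point, so every plane of \<open>Y\<close>
  contains exactly one, and the planes are counted spread line by spread line. This settles the
  converse of the equality case by a mere count.\<close>

lemma (in proj_geom) card_spread_planes:
  assumes S: "S \<subseteq> lv 2" and u: "\<And>P. P \<in> lv 1 \<Longrightarrow> \<exists>!l. l \<in> S \<and> P \<preceq> l"
    and Y: "Y = {E \<in> lv 3. \<exists>l\<in>S. l \<preceq> E}"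
  shows "(q + 1) * real (card Y) = gn q N * gn q (N - 2)"
proof -
  have fin: "finite S" "finite Y" using S Y finite_subset[OF S] by auto
  have one: "card {l \<in> S. l \<preceq> E} = 1" if "E \<in> Y" for E
  proof -
    have E: "E \<in> lv 3" "\<exists>l\<in>S. l \<preceq> E" using that Y by blast+
    obtain l where l: "l \<in> S" "l \<preceq> E" using E(2) by blast
    note E = E(1)
    have "l' = l" if "l' \<in> S" "l' \<preceq> E" for l'
    proof (rule ccontr)
      assume ne: "l' \<noteq> l"
      have lv: "l' \<in> lv 2" "l \<in> lv 2" using S l that by auto
      have "Suc (rk (meet l' l)) = 2" using cover_rk_meet[OF lv ne that(2) l(2)] E by simp
      then have m: "meet l' l \<in> lv 1" using lv_meet lv by simp
      have "meet l' l \<preceq> l'" "meet l' l \<preceq> l"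
        using meet_le1[OF lv_car[OF lv(1)] lv_car[OF lv(2)]]
          meet_le2[OF lv_car[OF lv(1)] lv_car[OF lv(2)]] by simp_all
      then show False using u[OF m] that(1) l(1) ne by blast
    qed
    then have "{l \<in> S. l \<preceq> E} = {l}" using l by blast
    then show ?thesis by simp
  qed
  have "real (card Y) = (\<Sum>E\<in>Y. real (card {l \<in> S. l \<preceq> E}) * 1)" using one by simp
  also have "\<dots> = (\<Sum>l\<in>S. \<Sum>E\<in>{E \<in> Y. l \<preceq> E}. 1)"
    by (rule sum_swap_card[symmetric]) (use fin in auto)
  also have "\<dots> = (\<Sum>l\<in>S. real (gn q (N - 2)))"
  proof (rule sum.cong, rule refl)
    fix l assume l: "l \<in> S"
    then have "{E \<in> Y. l \<preceq> E} = {E \<in> lv 3. l \<preceq> E}" using Y by blast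
    then show "(\<Sum>E\<in>{E \<in> Y. l \<preceq> E}. 1) = real (gn q (N - 2))" using cnt_planes_line l S by auto
  qed
  finally have cY: "real (card Y) = real (card S) * real (gn q (N - 2))" by simp
  have "(\<Sum>P\<in>lv 1. real (card {l \<in> S. P \<preceq> l}) * 1) = (\<Sum>l\<in>S. \<Sum>P\<in>{P \<in> lv 1. P \<preceq> l}. 1)"
    by (rule sum_swap_card[symmetric]) (use fin in auto)
  also have "\<dots> = (\<Sum>l\<in>S. real (q + 1))"
    by (rule sum.cong) (use cnt_points_line S in auto)
  finally have "(\<Sum>P\<in>lv 1. real (card {l \<in> S. P \<preceq> l})) = card S * (q + 1)"
    by (simp add: algebra_simps)
  moreover have "card {l \<in> S. P \<preceq> l} = 1" if "P \<in> lv 1" for P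
  proof -
    have "\<exists>l. {l \<in> S. P \<preceq> l} = {l}" using u[OF that] by blast
    then show ?thesis by auto
  qed
  ultimately have "real (card S) * (real q + 1) = real (gn q N)"
    using card_lv1 by (simp add: algebra_simps)
  then have "(real q + 1) * real (card Y) = real (gn q N) * real (gn q (N - 2))"
    unfolding cY by (simp flip: mult.assoc add: mult.commute)
  then show ?thesis by (simp add: algebra_simps)
qed

section \<open>Lines all of whose planes lie in the set\<close>

context intriguing_geom
begin

definition full :: "'a set" where
  "full = {l \<in> lv 2. \<forall>E\<in>lv 3. l \<preceq> E \<longrightarrow> E \<in> Y}"

lemma full_lv: "l \<in> full \<Longrightarrow> l \<in> lv 2"
  by (simp add: full_def)

lemma full_planes: "l \<in> full \<Longrightarrow> {E \<in> Y. l \<preceq> E} = {E \<in> lv 3. l \<preceq> E}"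
  using Y_sub by (auto simp: full_def)

lemma up_full: "l \<in> full \<Longrightarrow> up l = gn q (N - 2)"
  using full_planes[of l] cnt_planes_line[OF full_lv] by (simp add: up_def)

text \<open>Some plane on \<open>l\<close> is outside \<open>Y\<close>, and \<open>x\<close> is the
  total weight of the lines of such a plane.\<close>

lemma up_le_x:
  assumes "l \<in> lv 2" "l \<notin> full"
  shows "up l \<le> x"
proof -
  obtain E where E: "E \<in> lv 3" "l \<preceq> E" "E \<notin> Y" using assms by (auto simp: full_def)
  have "up l \<le> (\<Sum>l\<in>{l \<in> lv 2. l \<preceq> E}. up l)"
    by (rule member_le_sum) (use assms E in auto)
  then show ?thesis using sum_up_plane[OF E(1)] E(3) by simp
qed

text \<open>Two full lines in one plane have weight \<open>2 * gn q (N - 2)\<close>, which is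
  \<open>2 * D + 2 * (q + 1)\<close>, whereas the whole plane has at most
  \<open>x + D\<close>.\<close>

lemma full_disjoint:
  assumes "x < D + 2 * (q + 1)" "l \<in> full" "l' \<in> full" "l \<preceq> E" "l' \<preceq> E" "E \<in> lv 3"
  shows "l = l'"
proof (rule ccontr)
  assume ne: "l \<noteq> l'"
  have "up l + up l' = (\<Sum>l\<in>{l, l'}. up l)" using ne by simp
  also have "\<dots> \<le> (\<Sum>l\<in>{l \<in> lv 2. l \<preceq> E}. up l)"
    by (rule sum_mono2) (use assms full_lv in auto)
  also have "\<dots> \<le> x + D"
  proof -
    have "gn q 2 \<le> gn q (N - 2)" by (rule gn_mono) (use N6 in simp)
    then have "0 \<le> D" by (simp add: D_def gn_numerals)
    then show ?thesis using sum_up_plane[OF assms(6)] by simp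
  qed
  finally show False using assms up_full by (simp add: D_def)
qed

text \<open>A plane of \<open>Y\<close> contains exactly one full line. Hence \<open>up P\<close>
  adds up, over the full lines, all planes of the line if \<open>P\<close> is on it, and otherwise
  only the plane that it spans with \<open>P\<close>; these are the values of \<open>c\<close>. A
  point on a full line thus has larger weight than a point on none. As \<open>up\<close> is constant
  on points and some point is covered, all points are.\<close>

lemma spread_of_full:
  assumes x: "x < D + 2 * (q + 1)"
    and cover: "\<And>E. E \<in> Y \<Longrightarrow> \<exists>l\<in>full. l \<preceq> E" and ne: "Y \<noteq> {}"
  shows "\<forall>P\<in>lv 1. \<exists>!l. l \<in> full \<and> P \<preceq> l"
    and "Y = {E \<in> lv 3. \<exists>l\<in>full. l \<preceq> E}"
    and "x = (q + 1) * gn q 3"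
proof -
  have fin: "finite full" by (rule finite_subset[of _ "lv 2"]) (auto simp: full_def)
  show Yeq: "Y = {E \<in> lv 3. \<exists>l\<in>full. l \<preceq> E}"
    using cover Y_sub by (auto simp: full_def)
  have one: "card {l \<in> full. l \<preceq> E} = 1" if E: "E \<in> Y" for E
  proof -
    obtain l where l: "l \<in> full" "l \<preceq> E" using cover[OF E] by blast
    have "{l \<in> full. l \<preceq> E} = {l}" using full_disjoint[OF x] l E Y_sub by blast
    then show ?thesis by simp
  qed
  define c where "c P l = (if P \<preceq> l then real (gn q (N - 2)) else 1)" for P l
  have upP: "up P = (\<Sum>l\<in>full. c P l)" if P: "P \<in> lv 1" for P
  proof -
    have "up P = (\<Sum>E\<in>{E \<in> Y. P \<preceq> E}. real (card {l \<in> full. l \<preceq> E}) * 1)"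
      using one by (simp add: up_def)
    also have "\<dots> = (\<Sum>l\<in>full. \<Sum>E\<in>{E \<in> {E \<in> Y. P \<preceq> E}. l \<preceq> E}. 1)"
      by (rule sum_swap_card[symmetric]) (use fin in auto)
    also have "\<dots> = (\<Sum>l\<in>full. c P l)"
    proof (rule sum.cong, rule refl)
      fix l assume l: "l \<in> full"
      note lv = full_lv[OF l]
      have eq: "{E \<in> {E \<in> Y. P \<preceq> E}. l \<preceq> E} = {E \<in> lv 3. l \<preceq> E \<and> P \<preceq> E}"
        using full_planes[OF l] by auto
      show "(\<Sum>E\<in>{E \<in> {E \<in> Y. P \<preceq> E}. l \<preceq> E}. 1) = c P l"
      proof (cases "P \<preceq> l")
        case True
        then have "{E \<in> lv 3. l \<preceq> E \<and> P \<preceq> E} = {E \<in> lv 3. l \<preceq> E}" using lv_trans P lv by blast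
        then show ?thesis using True cnt_planes_line[OF lv] unfolding eq by (simp add: c_def)
      next
        case False
        have "rk (join P l) = 3" using point_join_rk[of P l 2] P lv False by simp
        then have "{E \<in> lv 3. P \<preceq> E \<and> l \<preceq> E} = {join P l}" by (rule common_join[OF P lv])
        then show ?thesis using False unfolding eq by (simp add: c_def conj_commute)
      qed
    qed
    finally show ?thesis .
  qed
  have atmost: "l = l'" if "l \<in> full" "l' \<in> full" "P \<preceq> l" "P \<preceq> l'" "P \<in> lv 1" for P l l'
  proof (rule ccontr)
    assume ne: "l \<noteq> l'"
    note lv = full_lv[OF that(1)] full_lv[OF that(2)]
    have "rk (join l l') = 3"
      using cover_rk_join[OF lv ne that(3,4,5)] by simp
    then have E: "join l l' \<in> lv 3" using lv_join lv by blast
    have "l \<preceq> join l l'" "l' \<preceq> join l l'"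
      using join_ge1[OF lv_car[OF lv(1)] lv_car[OF lv(2)]]
        join_ge2[OF lv_car[OF lv(1)] lv_car[OF lv(2)]] by simp_all
    then show False using full_disjoint[OF x that(1,2) _ _ E] ne by blast
  qed
  have on: "up P = gn q (N - 2) + real (card full) - 1" if "P \<in> lv 1" "l \<in> full" "P \<preceq> l" for P l
  proof -
    have "(\<Sum>l'\<in>full. c P l') = (\<Sum>l'\<in>full. 1 + (if l' = l then real (gn q (N - 2)) - 1 else 0))"
      by (rule sum.cong) (use atmost that in \<open>auto simp: c_def\<close>)
    then show ?thesis using upP[OF that(1)] that(2) fin by (simp add: sum.distrib)
  qed
  obtain l0 where l0: "l0 \<in> full" using cover ne by blast
  have "card {P \<in> lv 1. P \<preceq> l0} = q + 1" using cnt_points_line full_lv l0 by blast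
  then obtain P0 where P0: "P0 \<in> lv 1" "P0 \<preceq> l0"
    by (metis (no_types, lifting) Suc_eq_plus1 card_eq_0_iff nat.distinct(1) empty_Collect_eq)
  have const: "up P = up P0" if "P \<in> lv 1" for P
  proof -
    have "real ((q + 1)^2) * up P = real ((q + 1)^2) * up P0" using up_point that P0 by simp
    then show ?thesis by simp
  qed
  have big: "gn q (N - 2) > 1"
  proof -
    have "gn q 2 \<le> gn q (N - 2)" by (rule gn_mono) (use N6 in simp)
    then show ?thesis using q2 by (simp add: gn_numerals)
  qed
  have ex: "\<exists>l\<in>full. P \<preceq> l" if "P \<in> lv 1" for P
  proof (rule ccontr)
    assume "\<not> ?thesis"
    then have "up P = real (card full)" using upP[OF that] by (simp add: c_def)
    then show False using const[OF that] on[OF P0(1) l0 P0(2)] big by simp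
  qed
  then show uniq: "\<forall>P\<in>lv 1. \<exists>!l. l \<in> full \<and> P \<preceq> l" using atmost by blast
  have "(\<Sum>P\<in>lv 1. real (card {l \<in> full. P \<preceq> l}) * 1) = (\<Sum>l\<in>full. \<Sum>P\<in>{P \<in> lv 1. P \<preceq> l}. 1)"
    by (rule sum_swap_card[symmetric]) (use fin in auto)
  also have "\<dots> = (\<Sum>l\<in>full. real (q + 1))"
    by (rule sum.cong) (use cnt_points_line full_lv in auto)
  finally have "(\<Sum>P\<in>lv 1. real (card {l \<in> full. P \<preceq> l})) = card full * (q + 1)"
    by (simp add: algebra_simps)
  moreover have "card {l \<in> full. P \<preceq> l} = 1" if "P \<in> lv 1" for P
  proof -
    have "\<exists>l. {l \<in> full. P \<preceq> l} = {l}" using uniq that by blast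
    then show ?thesis by auto
  qed
  ultimately have f: "card full * (q + 1) = real (gn q N)" using card_lv1 by simp
  have gN: "real (gn q N) = 1 + q + q^2 * gn q (N - 2)"
  proof -
    obtain k where "N = Suc (Suc k)" using that[of "N - 2"] N6 by simp
    then show ?thesis by (simp add: gn_Suc power2_eq_square algebra_simps)
  qed
  have f': "real (card full) * (real q + 1) = 1 + real q + (real q)^2 * real (gn q (N - 2))"
    using f gN by (simp add: algebra_simps)
  have "real (gn q (N - 2)) * x = (real q + 1)^2 * (real (gn q (N - 2)) + real (card full) - 1)"
    using up_point[OF P0(1)] on[OF P0(1) l0 P0(2)] by (simp add: add.commute)
  then have "real (gn q (N - 2)) * x = real (gn q (N - 2)) * ((real q + 1) * (1 + real q + (real q)^2))"
    using f' by algebra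
  moreover have "real (gn q (N - 2)) \<noteq> 0" using big by simp
  ultimately have "x = (real q + 1) * (1 + real q + (real q)^2)" using mult_left_cancel by blast
  then show "x = (q + 1) * gn q 3" by (simp add: gn_numerals algebra_simps)
qed

lemma full_line_large_N:
  assumes "10 \<le> N" "x \<le> (q + 1) * gn q 3" "E \<in> Y"
  shows "\<exists>l\<in>full. l \<preceq> E"
proof (rule ccontr)
  assume "\<not> ?thesis"
  then have "(\<Sum>l\<in>{l \<in> lv 2. l \<preceq> E}. up l) \<le> (\<Sum>l\<in>{l \<in> lv 2. l \<preceq> E}. x)"
    using up_le_x by (intro sum_mono) auto
  then have *: "x + D \<le> gn q 3 * x"
    using sum_up_plane[of E] cnt_lines_plane[of E] assms(3) Y_lv by simp
  have "gn q 8 \<le> gn q (N - 2)" by (rule gn_mono) (use assms in simp)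
  then have "real (gn q 8) - (q + 1) \<le> (gn q 3 - (1::real)) * x" using * by (simp add: D_def algebra_simps)
  also have "\<dots> \<le> (gn q 3 - (1::real)) * ((q + 1) * gn q 3)"
    by (rule mult_left_mono) (use assms in \<open>simp_all add: gn_numerals\<close>)
  finally have "real (gn q 8) - (q + 1) \<le> (q + q^2) * ((q + 1) * (1 + q + real q^2))"
    by (simp add: gn_numerals algebra_simps)
  moreover have "gn q 8 = 1 + q + q^2 + q^3 + q^4 + q^5 + q^6 + q^7"
    by (simp add: gn_def eval_nat_numeral)
  moreover define r where "r = real q"
  ultimately have "r^2 + r^3 + r^4 + r^5 + r^6 + r^7 \<le> (r + r^2) * ((r + 1) * (1 + r + r^2))"
    by (simp add: add.commute)
  also have "\<dots> = r + 3 * r^2 + 4 * r^3 + 3 * r^4 + r^5"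
    by (simp add: eval_nat_numeral algebra_simps)
  finally have 1: "r^7 + r^6 \<le> r + 2 * r^2 + 3 * r^3 + 2 * r^4"
    by simp
  have r: "2 \<le> r" using q2 by (simp add: r_def)
  have p: "2^k \<le> r^k" for k using r by (intro power_mono) auto
  have "2^3 * r^4 \<le> r^3 * r^4" "2^2 * r^4 \<le> r^2 * r^4" "2^1 * r^3 \<le> r^1 * r^3"
    "2^2 * r^2 \<le> r^2 * r^2" "2^3 * r \<le> r^3 * r"
    using r by (intro mult_right_mono p; simp)+
  then have "8 * r^4 \<le> r^7" "4 * r^4 \<le> r^6" "2 * r^3 \<le> r^4" "4 * r^2 \<le> r^4" "8 * r \<le> r^4"
    by (simp_all add: eval_nat_numeral algebra_simps)
  moreover have "r^4 > 0" using r by simp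
  ultimately show False using 1 by linarith
qed

end

section \<open>Double counting in a solid\<close>

context proj_geom
begin

abbreviation pl :: "'a \<Rightarrow> 'a set" where "pl T \<equiv> {E \<in> lv 3. E \<preceq> T}"
abbreviation ln :: "'a \<Rightarrow> 'a set" where "ln T \<equiv> {l \<in> lv 2. l \<preceq> T}"
abbreviation pt :: "'a \<Rightarrow> 'a set" where "pt T \<equiv> {P \<in> lv 1. P \<preceq> T}"
abbreviation lnp :: "'a \<Rightarrow> 'a \<Rightarrow> 'a set" where "lnp P T \<equiv> {l \<in> lv 2. P \<preceq> l \<and> l \<preceq> T}"

definition thru :: "'a set \<Rightarrow> 'a \<Rightarrow> real" where
  "thru K X = real (card {E \<in> K. X \<preceq> E})"

lemma thru_nonneg [simp]: "0 \<le> thru K X"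
  by (simp add: thru_def)

lemma cnt_planes_solid: "T \<in> lv 4 \<Longrightarrow> card (pl T) = gn q 4"
  using cnt_dn_all[of T 3] by (simp add: eval_nat_numeral)

lemma cnt_planes_flag: "\<lbrakk>l \<in> lv 2; T \<in> lv 4; l \<preceq> T\<rbrakk> \<Longrightarrow> card {E \<in> pl T. l \<preceq> E} = q + 1"
  using cnt_up[of l T 2 4] by (simp add: eval_nat_numeral gn_Suc conj_ac)

lemma cnt_planes_point_solid: "\<lbrakk>P \<in> lv 1; T \<in> lv 4; P \<preceq> T\<rbrakk> \<Longrightarrow> card {E \<in> pl T. P \<preceq> E} = gn q 3"
  using cnt_dn[of P T 1 3] by (simp add: eval_nat_numeral conj_ac)

end

text \<open>In the dual of the solid, \<open>K\<close> is a set of points and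
  \<open>thru K l\<close> the number of its points on a line. The identities below are the standard
  equations for these intersection numbers.\<close>

locale solid = proj_geom +
  fixes T :: 'a and K :: "'a set"
  assumes T: "T \<in> lv 4" and K: "K \<subseteq> pl T"
begin

lemma finite_K [simp]: "finite K"
  by (rule finite_subset[OF K]) simp

lemma KD: "E \<in> K \<Longrightarrow> E \<in> lv 3 \<and> E \<preceq> T"
  using K by blast

lemma meet_rk: "\<lbrakk>E \<in> pl T; E' \<in> pl T; E \<noteq> E'\<rbrakk> \<Longrightarrow> rk (meet E E') = 2"
  using cover_rk_meet[of E 3 E' T] T by simp

lemma card_common:
  assumes "E \<in> pl T" "E' \<in> pl T"
  shows "card {l \<in> lv 2. l \<preceq> E \<and> l \<preceq> E'} = (if E' = E then gn q 3 else 1)"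
  using cnt_common_lines[of E E'] meet_rk[of E E'] assms by (auto split: if_splits)

text \<open>Every sum weighted by \<open>thru K\<close> becomes a sum over the planes of
  \<open>K\<close>, where the plane condition of an intriguing set applies. The choice of
  \<open>thru K\<close> itself for \<open>f\<close> gives the second moment.\<close>

lemma sum_thru_lines:
  fixes f :: "'a \<Rightarrow> real"
  shows "(\<Sum>l\<in>ln T. thru K l * f l) = (\<Sum>E\<in>K. \<Sum>l\<in>ln E. f l)"
proof -
  have "(\<Sum>E\<in>K. \<Sum>l\<in>ln E. f l) = (\<Sum>E\<in>K. \<Sum>l\<in>{l \<in> ln T. l \<preceq> E}. f l)"
  proof (rule sum.cong, rule refl)
    fix E assume "E \<in> K"
    then have "ln E = {l \<in> ln T. l \<preceq> E}" using KD[of E] T lv_trans[of _ E T 2 3 4] by blast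
    then show "(\<Sum>l\<in>ln E. f l) = (\<Sum>l\<in>{l \<in> ln T. l \<preceq> E}. f l)" by simp
  qed
  also have "\<dots> = (\<Sum>l\<in>ln T. thru K l * f l)"
    unfolding thru_def by (rule sum_swap_card) simp_all
  finally show ?thesis by simp
qed

lemma sum_thru_plane:
  assumes "E \<in> pl T"
  shows "(\<Sum>l\<in>ln E. thru K l) = card K + (if E \<in> K then gn q 3 - (1 :: real) else 0)"
proof -
  have "(\<Sum>l\<in>ln E. thru K l) = (\<Sum>l\<in>ln E. \<Sum>E'\<in>{E' \<in> K. l \<preceq> E'}. 1)" by (simp add: thru_def)
  also have "\<dots> = (\<Sum>E'\<in>K. real (card {l \<in> ln E. l \<preceq> E'}) * 1)"
    by (rule sum_swap_card) simp_all
  also have "\<dots> = (\<Sum>E'\<in>K. 1 + (if E' = E then gn q 3 - (1 :: real) else 0))"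
    by (rule sum.cong) (use card_common[OF assms] K in \<open>auto simp: subset_iff\<close>)
  also have "\<dots> = card K + (if E \<in> K then gn q 3 - (1 :: real) else 0)"
    by (simp add: sum.distrib sum.delta)
  finally show ?thesis .
qed

lemma sum_thru_sq: "(\<Sum>l\<in>ln T. thru K l * thru K l) = real (card K) * (real (card K) + gn q 3 - 1)"
proof -
  have "(\<Sum>E\<in>K. \<Sum>l\<in>ln E. thru K l) = (\<Sum>E\<in>K. real (card K) + gn q 3 - 1)"
    by (rule sum.cong) (use sum_thru_plane KD in auto)
  then show ?thesis unfolding sum_thru_lines by simp
qed

lemma sum_thru_pairs: "(\<Sum>l\<in>ln T. thru K l * (thru K l - 1)) = real (card K) * (real (card K) - 1)"
proof -
  have "(\<Sum>l\<in>ln T. thru K l * 1) = real (card K) * real (gn q 3)"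
    unfolding sum_thru_lines using KD cnt_lines_plane by simp
  then show ?thesis using sum_thru_sq by (simp add: right_diff_distrib sum_subtractf algebra_simps)
qed

lemma thru_compl: "l \<in> ln T \<Longrightarrow> thru K l + thru (pl T - K) l = q + 1"
proof -
  assume l: "l \<in> ln T"
  have "{E \<in> pl T. l \<preceq> E} = {E \<in> K. l \<preceq> E} \<union> {E \<in> pl T - K. l \<preceq> E}" using K by blast
  then have "card {E \<in> pl T. l \<preceq> E} = card {E \<in> K. l \<preceq> E} + card {E \<in> pl T - K. l \<preceq> E}"
    by (simp add: card_Un_disjoint disjoint_iff)
  then show ?thesis using cnt_planes_flag[of l T] l T by (simp add: thru_def flip: of_nat_add)
qed

lemma solid_compl: "solid car le meet join rk q N T (pl T - K)"
  by unfold_locales (use T in auto)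

lemma card_compl: "real (card (pl T - K)) = gn q 4 - real (card K)"
proof -
  have "card (pl T - K) = gn q 4 - card K"
    using card_Diff_subset[OF finite_K K] cnt_planes_solid[OF T] by simp
  moreover have "card K \<le> gn q 4" using card_mono[OF _ K] cnt_planes_solid[OF T] by simp
  ultimately show ?thesis by (simp add: of_nat_diff)
qed

lemma sum_planes_weight:
  fixes u :: "'a \<Rightarrow> real"
  shows "(\<Sum>E\<in>pl T. \<Sum>l\<in>ln E. u l) = (q + 1) * (\<Sum>l\<in>ln T. u l)"
proof -
  interpret A: solid car le meet join rk q N T "pl T"
    by unfold_locales (use T in auto)
  have "(\<Sum>l\<in>ln T. thru (pl T) l * u l) = (\<Sum>l\<in>ln T. (q + 1) * u l)"
    by (rule sum.cong) (use cnt_planes_flag T in \<open>auto simp: thru_def\<close>)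
  then show ?thesis using A.sum_thru_lines[of u] by (simp add: sum_distrib_left)
qed

text \<open>Of the \<open>q + 1\<close> planes of \<open>T\<close> on a line off \<open>P\<close>,
  exactly one contains \<open>P\<close>, namely the join with \<open>P\<close>. A line on
  \<open>P\<close> lies on none of the planes considered.\<close>

lemma sum_planes_off_point:
  fixes u :: "'a \<Rightarrow> real"
  assumes P: "P \<in> pt T"
  shows "(\<Sum>E\<in>{E \<in> pl T. \<not> P \<preceq> E}. \<Sum>l\<in>ln E. u l) = q * ((\<Sum>l\<in>ln T. u l) - (\<Sum>l\<in>lnp P T. u l))"
proof -
  interpret A: solid car le meet join rk q N T "{E \<in> pl T. \<not> P \<preceq> E}"
    by unfold_locales (use T in auto)
  have th: "thru {E \<in> pl T. \<not> P \<preceq> E} l = (if P \<preceq> l then 0 else q)" if l: "l \<in> ln T" for l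
  proof (cases "P \<preceq> l")
    case True
    then have "{E \<in> {E \<in> pl T. \<not> P \<preceq> E}. l \<preceq> E} = {}" using lv_trans[of P l _ 1 2 3] l P by blast
    then show ?thesis using True by (simp only: thru_def card.empty if_True of_nat_0)
  next
    case False
    have lv: "P \<in> lv 1" "l \<in> lv 2" "l \<preceq> T" "P \<preceq> T" using P l by auto
    have "rk (join P l) = 3" using point_join_rk[of P l 2] lv False by simp
    then have c: "{E \<in> lv 3. P \<preceq> E \<and> l \<preceq> E} = {join P l}" by (rule common_join[OF lv(1,2)])
    have jT: "join P l \<preceq> T" using join_least lv T lv_car by blast
    have "{E \<in> {E \<in> pl T. \<not> P \<preceq> E}. l \<preceq> E} = {E \<in> pl T. l \<preceq> E} - {join P l}"
      using c by blast
    moreover have "join P l \<in> {E \<in> pl T. l \<preceq> E}" using c jT by blast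
    ultimately have "card {E \<in> {E \<in> pl T. \<not> P \<preceq> E}. l \<preceq> E} = q"
      using cnt_planes_flag[OF lv(2) T lv(3)] by (simp add: card_Diff_singleton)
    then show ?thesis using False by (simp only: thru_def if_False)
  qed
  have "(\<Sum>l\<in>ln T. thru {E \<in> pl T. \<not> P \<preceq> E} l * u l) = (\<Sum>l\<in>ln T. q * u l - (if P \<preceq> l then q * u l else 0))"
    by (rule sum.cong) (use th in auto)
  also have "\<dots> = q * (\<Sum>l\<in>ln T. u l) - (\<Sum>l\<in>{l \<in> ln T. P \<preceq> l}. q * u l)"
    unfolding sum_subtractf sum_distrib_left by (subst (2) sum.inter_filter) simp_all
  also have "{l \<in> ln T. P \<preceq> l} = lnp P T" by blast
  finally show ?thesis using A.sum_thru_lines[of u] by (simp add: sum_distrib_left right_diff_distrib)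
qed

text \<open>A plane of \<open>K\<close> meets \<open>l\<close> in a single point unless it contains
  \<open>l\<close>, and then it has \<open>q\<close> further points of \<open>l\<close>.\<close>

lemma sum_points_line: "l \<in> ln T \<Longrightarrow> (\<Sum>P\<in>pt l. thru K P) = card K + q * thru K l"
proof -
  assume l: "l \<in> ln T"
  have "(\<Sum>P\<in>pt l. thru K P) = (\<Sum>P\<in>pt l. \<Sum>E\<in>{E \<in> K. P \<preceq> E}. 1)" by (simp add: thru_def)
  also have "\<dots> = (\<Sum>E\<in>K. real (card {P \<in> pt l. P \<preceq> E}) * 1)"
    by (rule sum_swap_card) simp_all
  also have "\<dots> = (\<Sum>E\<in>K. 1 + (if l \<preceq> E then real q else 0))"
  proof (rule sum.cong, rule refl)
    fix E assume "E \<in> K"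
    then have E: "E \<in> lv 3" "E \<preceq> T" using KD by auto
    show "real (card {P \<in> pt l. P \<preceq> E}) * 1 = 1 + (if l \<preceq> E then real q else 0)"
    proof (cases "l \<preceq> E")
      case True
      then have "{P \<in> pt l. P \<preceq> E} = pt l" using lv_trans[of _ l E 1 2 3] l E by blast
      then show ?thesis using True cnt_points_line[of l] l by simp
    next
      case False
      have lv: "l \<in> lv 2" "l \<preceq> T" using l by auto
      have "Suc (rk (meet l E)) = 2"
        using coatom_rk_meet[OF lv(1) E(1) lv(2) E(2) _ False] T by simp
      then have "{P \<in> lv 1. P \<preceq> l \<and> P \<preceq> E} = {meet l E}"
        by (intro common_meet[OF lv(1) E(1)]) simp
      then show ?thesis using False by (simp add: conj_assoc)
    qed
  qed
  also have "\<dots> = card K + q * thru K l"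
    by (simp add: sum.distrib thru_def sum.inter_filter[symmetric])
  finally show ?thesis .
qed

lemma sum_thru_points:
  fixes f :: "'a \<Rightarrow> real"
  shows "(\<Sum>P\<in>pt T. thru K P * f P) = (\<Sum>E\<in>K. \<Sum>P\<in>pt E. f P)"
proof -
  have "(\<Sum>E\<in>K. \<Sum>P\<in>pt E. f P) = (\<Sum>E\<in>K. \<Sum>P\<in>{P \<in> pt T. P \<preceq> E}. f P)"
  proof (rule sum.cong, rule refl)
    fix E assume "E \<in> K"
    then have "pt E = {P \<in> pt T. P \<preceq> E}" using KD[of E] T lv_trans[of _ E T 1 3 4] by blast
    then show "(\<Sum>P\<in>pt E. f P) = (\<Sum>P\<in>{P \<in> pt T. P \<preceq> E}. f P)" by simp
  qed
  also have "\<dots> = (\<Sum>P\<in>pt T. thru K P * f P)"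
    unfolding thru_def by (rule sum_swap_card) simp_all
  finally show ?thesis by simp
qed

lemma sum_points: "(\<Sum>P\<in>pt T. thru K P) = real (card K) * gn q 3"
  using sum_thru_points[of "\<lambda>_. 1"] KD cnt_points[of _ 3] by simp

lemma sum_points_plane:
  assumes "E \<in> K"
  shows "(\<Sum>P\<in>pt E. thru K P) = gn q 3 + (real (card K) - 1) * (q + 1)"
proof -
  have "(\<Sum>P\<in>pt E. thru K P) = (\<Sum>P\<in>pt E. \<Sum>E'\<in>{E' \<in> K. P \<preceq> E'}. 1)" by (simp add: thru_def)
  also have "\<dots> = (\<Sum>E'\<in>K. real (card {P \<in> pt E. P \<preceq> E'}) * 1)"
    by (rule sum_swap_card) simp_all
  also have "\<dots> = (\<Sum>E'\<in>K. real (q + 1) + (if E' = E then real (gn q 3) - (q + 1) else 0))"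
  proof (rule sum.cong, rule refl)
    fix E' assume "E' \<in> K"
    then have E: "E \<in> lv 3" "E' \<in> lv 3" "E \<in> pl T" "E' \<in> pl T" using KD assms by auto
    show "real (card {P \<in> pt E. P \<preceq> E'}) * 1 = real (q + 1) + (if E' = E then real (gn q 3) - (q + 1) else 0)"
    proof (cases "E' = E")
      case True
      then have "{P \<in> pt E. P \<preceq> E'} = pt E" by blast
      then show ?thesis using True cnt_points[OF E(1)] by simp
    next
      case False
      have r: "rk (meet E E') = 2" using meet_rk E False by auto
      have m: "meet E E' \<in> lv 2" by (rule lv_meet[OF E(1,2) r])
      have c: "E \<in> car" "E' \<in> car" using E by (auto simp: lv_def)
      have "{P \<in> pt E. P \<preceq> E'} = pt (meet E E')"
        using meet_greatest[OF _ _ c] meet_le1[OF c] meet_le2[OF c]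
          lv_trans[OF _ meet_le1[OF c] _ m E(1)] lv_trans[OF _ meet_le2[OF c] _ m E(2)] lv_car by blast
      then show ?thesis using False cnt_points_line[OF m] by simp
    qed
  qed
  also have "\<dots> = gn q 3 + (real (card K) - 1) * (q + 1)"
    using assms by (simp add: sum.distrib sum.delta algebra_simps)
  finally show ?thesis .
qed

lemma sum_points_sq:
  "(\<Sum>P\<in>pt T. thru K P * thru K P) = real (card K) * (gn q 3 + (real (card K) - 1) * (q + 1))"
  unfolding sum_thru_points using sum_points_plane by simp

lemma sum_thru_lines_point:
  fixes f :: "'a \<Rightarrow> real"
  assumes P: "P \<in> pt T"
  shows "(\<Sum>l\<in>lnp P T. thru K l * f l) = (\<Sum>E\<in>{E \<in> K. P \<preceq> E}. \<Sum>l\<in>lnp P E. f l)"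
proof -
  have "(\<Sum>E\<in>{E \<in> K. P \<preceq> E}. \<Sum>l\<in>lnp P E. f l)
      = (\<Sum>E\<in>{E \<in> K. P \<preceq> E}. \<Sum>l\<in>{l \<in> lnp P T. l \<preceq> E}. f l)"
  proof (rule sum.cong, rule refl)
    fix E assume "E \<in> {E \<in> K. P \<preceq> E}"
    then have "lnp P E = {l \<in> lnp P T. l \<preceq> E}" using KD[of E] T lv_trans[of _ E T 2 3 4] by blast
    then show "(\<Sum>l\<in>lnp P E. f l) = (\<Sum>l\<in>{l \<in> lnp P T. l \<preceq> E}. f l)" by simp
  qed
  also have "\<dots> = (\<Sum>l\<in>lnp P T. real (card {E \<in> {E \<in> K. P \<preceq> E}. l \<preceq> E}) * f l)"
    by (rule sum_swap_card) simp_all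
  also have "\<dots> = (\<Sum>l\<in>lnp P T. thru K l * f l)"
  proof (rule sum.cong, rule refl)
    fix l assume "l \<in> lnp P T"
    then have "{E \<in> {E \<in> K. P \<preceq> E}. l \<preceq> E} = {E \<in> K. l \<preceq> E}"
      using lv_trans[of P l _ 1 2 3] KD P by blast
    then show "real (card {E \<in> {E \<in> K. P \<preceq> E}. l \<preceq> E}) * f l = thru K l * f l" by (simp add: thru_def)
  qed
  finally show ?thesis by simp
qed

lemma sum_thru_point: "P \<in> pt T \<Longrightarrow> (\<Sum>l\<in>lnp P T. thru K l) = (q + 1) * thru K P"
  using sum_thru_lines_point[of P "\<lambda>_. 1"] cnt_lines_flag[of P] KD by (simp add: thru_def)

text \<open>For \<open>E\<close> in \<open>K\<close> on \<open>P\<close>, every other plane of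
  \<open>K\<close> on \<open>P\<close> shares exactly one line on \<open>P\<close> with
  \<open>E\<close>, the planes off \<open>P\<close> share none, and \<open>E\<close> itself accounts
  for \<open>q + 1\<close> lines.\<close>

lemma sum_thru_point_sq:
  assumes P: "P \<in> pt T"
  shows "(\<Sum>l\<in>lnp P T. thru K l * thru K l) = thru K P * (thru K P + q)"
proof -
  have "(\<Sum>l\<in>lnp P E. thru K l) = thru K P + q" if E: "E \<in> K" "P \<preceq> E" for E
  proof -
    have Ep: "E \<in> pl T" "E \<in> lv 3" using E KD by auto
    have "(\<Sum>l\<in>lnp P E. thru K l) = (\<Sum>l\<in>lnp P E. \<Sum>E'\<in>{E' \<in> K. l \<preceq> E'}. 1)" by (simp add: thru_def)
    also have "\<dots> = (\<Sum>E'\<in>K. real (card {l \<in> lnp P E. l \<preceq> E'}) * 1)"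
      by (rule sum_swap_card) simp_all
    also have "\<dots> = (\<Sum>E'\<in>K. (if P \<preceq> E' then 1 else 0) + (if E' = E then real q else 0))"
    proof (rule sum.cong, rule refl)
      fix E' assume E': "E' \<in> K"
      then have Ep': "E' \<in> pl T" "E' \<in> lv 3" using KD by auto
      show "real (card {l \<in> lnp P E. l \<preceq> E'}) * 1 = (if P \<preceq> E' then 1 else 0) + (if E' = E then real q else 0)"
      proof (cases "E' = E")
        case True
        then have "{l \<in> lnp P E. l \<preceq> E'} = lnp P E" by blast
        then show ?thesis using True E cnt_lines_flag[of P E] P Ep by simp
      next
        case ne: False
        have r: "rk (meet E E') = 2" using meet_rk Ep Ep' ne by auto
        have c: "E \<in> car" "E' \<in> car" using Ep Ep' by (auto simp: lv_def)
        have eq: "{l \<in> lv 2. l \<preceq> E \<and> l \<preceq> E'} = {meet E E'}" by (rule common_meet[OF Ep(2) Ep'(2) r])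
        show ?thesis
        proof (cases "P \<preceq> E'")
          case True
          have "P \<preceq> meet E E'" using meet_greatest[OF E(2) True c] P lv_car by blast
          then have "{l \<in> lnp P E. l \<preceq> E'} = {meet E E'}" using eq by blast
          then show ?thesis using True ne by simp
        next
          case False
          then have "{l \<in> lnp P E. l \<preceq> E'} = {}" using lv_trans[of P _ E' 1 2 3] P Ep' by blast
          then have "card {l \<in> lnp P E. l \<preceq> E'} = 0" by (simp only: card.empty)
          then show ?thesis using False ne by simp
        qed
      qed
    qed
    also have "\<dots> = thru K P + q"
      using E by (simp add: sum.distrib sum.delta thru_def sum.inter_filter[symmetric])
    finally show ?thesis .
  qed
  then show ?thesis unfolding sum_thru_lines_point[OF P] by (simp add: thru_def)
qed

end

section \<open>Dimension five\<close>

lemma cubic_gap: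
  fixes q t x :: real
  assumes q: "25 \<le> q" and x: "x \<le> (q + 1)^2" and t: "q + 2 \<le> t" "t \<le> 6 * (q + 1)"
  shows "t^2 * (t - 1) / 2 < t * (x + q^3) - (q^2 + 1) * x"
proof -
  \<comment> \<open>\<open>f\<close> is the gap at the extreme value \<open>x = (q + 1)^2\<close>.
    This is the worst case, since the gap decreases in \<open>x\<close> as long as
    \<open>t <= q^2 + 1\<close>.\<close>
  define f where "f t = t * (q^3 + (q+1)^2) - (q+1)^2 * (q^2 + 1) - t^3 / 2 + t^2 / 2" for t
  have "25 * q \<le> q * q" using q by (intro mult_right_mono) auto
  then have q2: "25 * q \<le> q^2" by (simp add: power2_eq_square)
  have "25 * q^2 \<le> q * q^2" using q by (intro mult_right_mono) auto
  then have q3: "25 * q^2 \<le> q^3" by (simp add: power2_eq_square power3_eq_cube)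
  have "f (q + 2) = (q^3 - q^2 - 2 * q - 2) / 2"
    by (simp add: f_def power2_eq_square power3_eq_cube field_simps)
  then have f1: "f (q + 2) > 0" using q q2 q3 by simp
  have "f (6 * (q + 1)) = (q + 1) * (5 * q^3 - 103 * q^2 - 187 * q - 85)"
    by (simp add: f_def power2_eq_square power3_eq_cube field_simps)
  then have f2: "f (6 * (q + 1)) > 0" using q q2 q3 by simp
  \<comment> \<open>Interpolation between the end points, whose distance is
    \<open>5 * q + 4\<close>. The last summand is non-negative, so \<open>f\<close> lies above its
    chord.\<close>
  have "(5 * q + 4) * f t = (6 * (q + 1) - t) * f (q + 2) + (t - (q + 2)) * f (6 * (q + 1))
      + (5 * q + 4) * (t - (q + 2)) * (6 * (q + 1) - t) * (t + 7 * q + 7) / 2"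
    by (simp add: f_def power2_eq_square power3_eq_cube field_simps)
  moreover have "0 < (6 * (q + 1) - t) * f (q + 2) + (t - (q + 2)) * f (6 * (q + 1))"
  proof (cases "t = q + 2")
    case True then show ?thesis using f1 q by simp
  next
    case False
    then show ?thesis using f1 f2 t by (intro add_nonneg_pos mult_nonneg_nonneg mult_pos_pos) auto
  qed
  moreover have "0 \<le> (5 * q + 4) * (t - (q + 2)) * (6 * (q + 1) - t) * (t + 7 * q + 7) / 2"
    using t q by (intro divide_nonneg_nonneg mult_nonneg_nonneg) auto
  ultimately have "0 < (5 * q + 4) * f t" by linarith
  then have f: "0 < f t" using q by (simp add: zero_less_mult_iff)
  have "0 \<le> q^2 + 1 - t" using t q q2 by simp
  with x have "x * (q^2 + 1 - t) \<le> (q+1)^2 * (q^2 + 1 - t)" by (rule mult_right_mono)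
  then have "t * (x + q^3) - (q^2 + 1) * x \<ge> t * q^3 - (q+1)^2 * (q^2 + 1 - t)"
    by (simp add: algebra_simps)
  moreover have "t * q^3 - (q+1)^2 * (q^2 + 1 - t) - t^2 * (t - 1) / 2 = f t"
    by (simp add: f_def power2_eq_square power3_eq_cube field_simps)
  ultimately show ?thesis using f by linarith
qed

text \<open>Both sides are compared with their chords over \<open>6 \<le> t \<le> q + 1\<close>, so that only the two
  end points matter.\<close>

lemma chord_gap:
  fixes q t a :: real
  assumes q: "25 \<le> q" and a: "a = q + 1" and t: "6 \<le> t" "t \<le> a"
  shows "(1 + 1 / t) * (225/56 + t / (14 * q) * (2 * t + q - 2 + t / q))
      + (t - t / q) * (t - t / q - 1) * (a + t) / (14 * (q^2 + a))
    < a * q^2 / (q^2 + 1) * t / (a + t) + a^2 / (q^2 + a)"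
proof -
  have Z: "0 \<le> (t - 6) * (a - t)" using t by simp
  have apos: "0 < a" "26 \<le> a" using q a by auto
  have tpos: "0 < t" using t by simp
  define p where "p = 1 - 1 / q"
  have p: "0 \<le> p" "p \<le> 1" "1 \<le> p * 6" using q by (auto simp: p_def field_simps)
  have t2: "t^2 \<le> (a + 6) * t - 6 * a" using Z by (simp add: power2_eq_square algebra_simps)
  have "t * t^2 \<le> t * ((a + 6) * t - 6 * a)" using t2 tpos by (intro mult_left_mono) auto
  also have "\<dots> = (a + 6) * t^2 - 6 * a * t" by (simp add: power2_eq_square algebra_simps)
  also have "\<dots> \<le> (a + 6) * ((a + 6) * t - 6 * a) - 6 * a * t" using t2 apos by simp
  finally have t3: "t^3 \<le> ((a + 6)^2 - 6 * a) * t - 6 * a * (a + 6)"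
    by (simp add: power2_eq_square power3_eq_cube algebra_simps)
  have inv: "1 / t \<le> (a + 6 - t) / (6 * a)"
    using Z tpos apos by (simp add: field_simps)
  have frac: "(t + 6) / (2 * (a + 6)) \<le> t / (a + t)"
    using Z tpos apos by (simp add: field_simps)
  define c where "c = a * q^2 / (q^2 + 1)"
  have c0: "0 \<le> c" using apos by (simp add: c_def)
  define g where "g s = c * ((s + 6) / (2 * (a + 6))) + a^2 / (q^2 + a)
    - (225/56 + 225/56 * ((a + 6 - s) / (6 * a))
       + ((2 + 1/q) * ((a + 6) * s - 6 * a) + (q + 1/q) * s + q - 2) / (14 * q))
    - (p^2 * (((a + 6)^2 - 6 * a) * s - 6 * a * (a + 6)) + (p^2 * a - p) * ((a + 6) * s - 6 * a) - p * a * s)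
      / (14 * (q^2 + a))" for s
  have den: "0 < 14 * (q^2 + a)" "0 < 14 * q" using apos q by (auto intro!: add_nonneg_pos)
  have pa: "0 \<le> p^2 * a - p"
  proof -
    have "p * 6 \<le> p * a" using p apos by (intro mult_left_mono) auto
    then have "1 \<le> p * a" using p(3) by linarith
    then have "p * 1 \<le> p * (p * a)" using p(1) by (rule mult_left_mono)
    then show ?thesis by (simp add: power2_eq_square mult_ac)
  qed
  have R1: "(1 + 1 / t) * (225/56 + t / (14 * q) * (2 * t + q - 2 + t / q))
      = 225/56 + 225/56 * (1 / t) + ((2 + 1/q) * t^2 + (q + 1/q) * t + q - 2) / (14 * q)"
    using tpos q by (simp add: field_simps power2_eq_square)
  have "((2 + 1/q) * t^2 + (q + 1/q) * t + q - 2) / (14 * q)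
      \<le> ((2 + 1/q) * ((a + 6) * t - 6 * a) + (q + 1/q) * t + q - 2) / (14 * q)"
    using t2 q by (intro divide_right_mono diff_right_mono add_right_mono mult_left_mono) auto
  moreover have "225/56 * (1 / t) \<le> 225/56 * ((a + 6 - t) / (6 * a))"
    using inv by (intro mult_left_mono) auto
  ultimately have R1': "(1 + 1 / t) * (225/56 + t / (14 * q) * (2 * t + q - 2 + t / q))
      \<le> 225/56 + 225/56 * ((a + 6 - t) / (6 * a))
       + ((2 + 1/q) * ((a + 6) * t - 6 * a) + (q + 1/q) * t + q - 2) / (14 * q)"
    unfolding R1 by linarith
  have "(t - t / q) * (t - t / q - 1) * (a + t) = p^2 * t^3 + (p^2 * a - p) * t^2 - p * a * t"
  proof -
    have "t - t / q = p * t" by (simp add: p_def algebra_simps)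
    then show ?thesis by (simp only:) (simp add: power2_eq_square power3_eq_cube algebra_simps)
  qed
  moreover have "p^2 * t^3 \<le> p^2 * (((a + 6)^2 - 6 * a) * t - 6 * a * (a + 6))"
    using t3 by (intro mult_left_mono) auto
  moreover have "(p^2 * a - p) * t^2 \<le> (p^2 * a - p) * ((a + 6) * t - 6 * a)"
    using t2 pa by (intro mult_left_mono) auto
  ultimately have R2: "(t - t / q) * (t - t / q - 1) * (a + t) / (14 * (q^2 + a))
    \<le> (p^2 * (((a + 6)^2 - 6 * a) * t - 6 * a * (a + 6)) + (p^2 * a - p) * ((a + 6) * t - 6 * a) - p * a * t)
      / (14 * (q^2 + a))"
    using den by (intro divide_right_mono) auto
  have L: "c * ((t + 6) / (2 * (a + 6))) \<le> a * q^2 / (q^2 + 1) * t / (a + t)"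
    using mult_left_mono[OF frac c0] by (simp add: c_def)
  have lin: "(a - 6) * g t = (a - t) * g 6 + (t - 6) * g a"
    unfolding g_def by (simp add: algebra_simps add_divide_distrib diff_divide_distrib)
  have q2: "25 * q \<le> q^2" using q mult_right_mono[of 25 q q] by (simp add: power2_eq_square)
  have sq: "1 \<le> a^2 / (q^2 + a)" using q a den by (simp add: power2_eq_square field_simps)
  have cl: "c \<ge> a - 1/24"
  proof -
    have "c = a - a / (q^2 + 1)" by (simp add: c_def field_simps add_nonneg_eq_0_iff)
    moreover have "a / (q^2 + 1) \<le> 1/24" using q2 q a by (simp add: field_simps add_nonneg_pos)
    ultimately show ?thesis by simp
  qed
  have g6: "g 6 > 0"
  proof -
    have h: "(6 + 6) / (2 * (a + 6)) = 6 / (a + 6)" using apos by (simp add: field_simps)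
    have e: "g 6 = c * (6 / (a + 6)) + a^2 / (q^2 + a) - (225/56 + 225/56 * (1/6)
       + ((2 + 1/q) * 36 + (q + 1/q) * 6 + q - 2) / (14 * q))
      - (6 * p * (6 * p - 1)) * ((a + 6) / (14 * (q^2 + a)))"
      unfolding g_def h using apos by (simp add: power2_eq_square algebra_simps add_divide_distrib diff_divide_distrib)
    have "c * (6 / (a + 6)) \<ge> (a - 1/24) * (6 / (a + 6))" using cl apos by (intro mult_right_mono) auto
    moreover have "(a - 1/24) * (6 / (a + 6)) \<ge> 243/50" using apos by (simp add: field_simps)
    moreover have "((2 + 1/q) * 36 + (q + 1/q) * 6 + q - 2) / (14 * q) \<le> 71/100"
    proof -
      have "42 / q \<le> 42/25" using q by (intro divide_left_mono) auto
      moreover have "(2 + 1/q) * 36 + (q + 1/q) * 6 + q - 2 = 7 * q + 70 + 42 / q"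
        using q by (simp add: field_simps)
      ultimately have "(2 + 1/q) * 36 + (q + 1/q) * 6 + q - 2 \<le> 71/100 * (14 * q)" using q by simp
      then show ?thesis by (simp only: pos_divide_le_eq[OF den(2)])
    qed
    moreover have "(6 * p * (6 * p - 1)) * ((a + 6) / (14 * (q^2 + a))) \<le> 30 * (32 / (14 * 651))"
    proof (rule mult_mono)
      show "6 * p * (6 * p - 1) \<le> 30" using p mult_mono[of "6 * p" 6 "6 * p - 1" 5] by simp
      have "0 \<le> (q - 25) * (32 * q + 181)" using q by simp
      then show "(a + 6) / (14 * (q^2 + a)) \<le> 32 / (14 * 651)"
        using den a by (simp add: field_simps power2_eq_square)
    qed (use apos p den in auto)
    ultimately show ?thesis unfolding e using sq by linarith
  qed
  have ga: "g a > 0"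
  proof -
    have h: "(a + 6) / (2 * (a + 6)) = 1 / 2" using apos by (simp add: field_simps)
    have e: "g a = c / 2 + a^2 / (q^2 + a) - (225/56 + 225/56 * (1/a)
       + ((2 + 1/q) * a^2 + (q + 1/q) * a + q - 2) / (14 * q))
      - (p * a * (p * a - 1) * (2 * a)) / (14 * (q^2 + a))"
      unfolding g_def h using apos by (simp add: power2_eq_square algebra_simps add_divide_distrib diff_divide_distrib)
    have "225/56 * (1/a) \<le> 225/56 * (1/26)" using apos by (intro mult_left_mono divide_left_mono) auto
    moreover have "((2 + 1/q) * a^2 + (q + 1/q) * a + q - 2) / (14 * q) \<le> (3 * q + 713/100) / 14"
    proof -
      have "(2 + 1/q) * a^2 + (q + 1/q) * a + q - 2 = 3 * q^2 + 7 * q + 3 + 2 / q"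
        unfolding a using q by (simp add: field_simps power2_eq_square)
      moreover have "3 + 2 / q \<le> 13/100 * q"
      proof -
        have "2 / q \<le> 2 / 25" using q by (intro divide_left_mono) auto
        then show ?thesis using q by simp
      qed
      ultimately have "(2 + 1/q) * a^2 + (q + 1/q) * a + q - 2 \<le> (3 * q + 713/100) * q"
        by (simp add: power2_eq_square algebra_simps)
      then show ?thesis using q by (simp add: field_simps)
    qed
    moreover have "(p * a * (p * a - 1) * (2 * a)) / (14 * (q^2 + a)) \<le> (q - 1) / 7"
    proof -
      have pa': "p * a = q - 1 / q" unfolding p_def a using q by (simp add: field_simps power2_eq_square)
      have "0 \<le> 1 / q" "1 / q \<le> 1" using q by simp_all
      then have "p * a * (p * a - 1) \<le> q * (q - 1)"
        unfolding pa' using q by (intro mult_mono) linarith+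
      then have "p * a * (p * a - 1) * (2 * a) \<le> q * (q - 1) * (2 * a)" using apos by (intro mult_right_mono) auto
      also have "\<dots> = 2 * (q - 1) * (q * a)" by simp
      also have "\<dots> \<le> 2 * (q - 1) * (q^2 + a)"
        using q by (intro mult_left_mono) (auto simp: a power2_eq_square algebra_simps)
      also have "\<dots> = (q - 1) / 7 * (14 * (q^2 + a))" by (simp add: field_simps)
      finally show ?thesis using den by (simp add: pos_divide_le_eq)
    qed
    moreover have "c / 2 \<ge> q / 2 + 479/1000" using cl a by simp
    moreover have "0 < u + v - (225/56 + w + y) - z"
      if "w \<le> 225/56 * (1/26)" "y \<le> (3 * q + 713/100) / 14" "z \<le> (q - 1) / 7"
        "q / 2 + 479/1000 \<le> u" "1 \<le> v" for u v w y z :: real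
      using that q by (simp add: field_simps)
    ultimately show ?thesis unfolding e using sq by blast
  qed
  have "0 < (a - t) * g 6 + (t - 6) * g a"
  proof (cases "t = 6")
    case True then show ?thesis using g6 apos by simp
  next
    case False
    then show ?thesis using g6 ga t by (intro add_nonneg_pos mult_nonneg_nonneg mult_pos_pos) auto
  qed
  then have "0 < g t" using lin apos zero_less_mult_iff[of "a - 6" "g t"] by simp
  then show ?thesis using R1' R2 L unfolding g_def by linarith
qed

text \<open>The final inequality of \<open>large_False\<close> after division by powers of
  \<open>q + 1\<close>: \<open>s\<close> and \<open>t\<close> stand for \<open>x\<close> and the
  number of planes in the solid, \<open>n\<close> for \<open>x + D\<close>, \<open>V\<close> for the
  total line weight, \<open>R\<close> for the second moment of the point weights, and
  \<open>k\<close> for the number of planes that the affine law \<open>wP_eq\<close> assigns to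
  weight zero. The extreme case \<open>s = q + 1\<close> is \<open>chord_gap\<close>; the proof
  reduces to it by monotonicity in \<open>s\<close>.\<close>

lemma scaled_gap:
  fixes q s t :: real
  assumes q: "25 \<le> q" and t: "6 \<le> t" "t \<le> s" and s: "s \<le> q + 1"
  defines "V \<equiv> q^2 * (s + t) + s" and "n \<equiv> s + q^2"
  defines "R \<equiv> t * n^2 + (q^2 + 1 - t) * s^2" and "k \<equiv> t - s / q"
  shows "225/56 * R + t / 14 * ((k^2 - k) * V + (2 * k - 1) * R / q + (q * s + t) * R / q^2)
    < (q + 1) * q^2 * t^2 * n^2 / V + (q + 1) * s * t * n"
proof -
  define a where "a = q + 1"
  have sp: "6 \<le> s" using t by simp
  have q2: "25 * q \<le> q^2" using q mult_right_mono[of 25 q q] by (simp add: power2_eq_square)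
  have pos: "0 < n" "0 < V" "0 < q" "0 < t" "0 < s" "0 < a"
    using q sp t q2 by (auto simp: n_def V_def a_def intro!: add_pos_pos mult_pos_pos)
  have sq: "s / q \<le> 2" using s q by (simp add: field_simps)
  have k: "4 \<le> k" using sq t by (simp add: k_def)
  have qs: "q * s \<le> n"
  proof -
    have "(q - 1) * s \<le> (q - 1) * (q + 1)" using s q by (intro mult_left_mono) auto
    then show ?thesis by (simp add: n_def power2_eq_square algebra_simps)
  qed
  have "(q^2 + 1 - t) * s^2 \<le> q^2 * s^2" using t by (intro mult_right_mono) auto
  also have "\<dots> = (q * s)^2" by (simp add: power_mult_distrib)
  also have "\<dots> \<le> n^2" using qs pos by (intro power_mono) auto
  finally have R: "R \<le> n^2 * (t + 1)" by (simp add: R_def algebra_simps)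
  have V1: "V \<le> (s + t) * (q^2 + 1)" using pos by (simp add: V_def algebra_simps)
  have "1 * s \<le> (s + t) * s" using sp t by (intro mult_right_mono) auto
  then have V2: "V \<le> (s + t) * n" by (simp add: V_def n_def algebra_simps)
  define b where "b = 2 * k - 1 + s + t / q"
  have b: "0 \<le> b" using k pos by (simp add: b_def)
  have e1: "225/56 * R + t / 14 * ((k^2 - k) * V + (2 * k - 1) * R / q + (q * s + t) * R / q^2)
      = R * (225/56 + t / (14 * q) * b) + t / 14 * (k * (k - 1)) * V"
    using pos by (simp add: b_def field_simps power2_eq_square)
  have "R * (225/56 + t / (14 * q) * b) \<le> n^2 * (t + 1) * (225/56 + t / (14 * q) * b)"
    using R b pos by (intro mult_right_mono) auto
  also have "\<dots> = n^2 * t * ((1 + 1 / t) * (225/56 + t / (14 * q) * b))"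
    using pos by (simp add: field_simps)
  finally have u1: "R * (225/56 + t / (14 * q) * b) \<le> n^2 * t * ((1 + 1 / t) * (225/56 + t / (14 * q) * b))" .
  have "t / 14 * (k * (k - 1)) * V \<le> t / 14 * (k * (k - 1)) * ((s + t) * n)"
    using V2 k pos by (intro mult_left_mono) auto
  also have "\<dots> = n^2 * t * (k * (k - 1) * (s + t) / (14 * n))"
    using pos by (simp add: field_simps power2_eq_square)
  finally have u2: "t / 14 * (k * (k - 1)) * V \<le> n^2 * t * (k * (k - 1) * (s + t) / (14 * n))" .
  define k1 where "k1 = t - t / q"
  have kk: "k \<le> k1" using t pos by (simp add: k_def k1_def divide_right_mono)
  have "b = 2 * t - 1 + (s * (q - 2) / q) + t / q"
    using pos by (simp add: b_def k_def field_simps)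
  moreover have "s * (q - 2) / q \<le> (q + 1) * (q - 2) / q"
    using s q by (intro divide_right_mono mult_right_mono) auto
  moreover have "(q + 1) * (q - 2) / q \<le> q - 1" using pos by (simp add: field_simps)
  ultimately have b2: "b \<le> 2 * t + q - 2 + t / q" by linarith
  have v1: "(1 + 1 / t) * (225/56 + t / (14 * q) * b)
      \<le> (1 + 1 / t) * (225/56 + t / (14 * q) * (2 * t + q - 2 + t / q))"
    using b2 pos by (intro mult_left_mono add_left_mono) auto
  have "(s + t) / n \<le> (a + t) / (q^2 + a)"
  proof -
    have "(a - s) * t \<le> (a - s) * q^2"
      using s t q2 q by (intro mult_left_mono) (auto simp: a_def)
    then have "(s + t) * (q^2 + a) \<le> (a + t) * n" by (simp add: n_def algebra_simps)
    then show ?thesis using pos by (simp add: frac_le_eq field_simps add_pos_pos)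
  qed
  then have "k * (k - 1) * ((s + t) / n) \<le> k1 * (k1 - 1) * ((a + t) / (q^2 + a))"
    using kk k pos by (intro mult_mono) auto
  then have "k * (k - 1) * ((s + t) / n) / 14 \<le> k1 * (k1 - 1) * ((a + t) / (q^2 + a)) / 14"
    by (rule divide_right_mono) simp
  then have v2: "k * (k - 1) * (s + t) / (14 * n) \<le> k1 * (k1 - 1) * (a + t) / (14 * (q^2 + a))"
    by (simp only: times_divide_eq_right divide_divide_eq_left mult.commute[of _ 14])
  have L1: "n^2 * t * (a * q^2 / (q^2 + 1) * t / (s + t)) \<le> a * q^2 * t^2 * n^2 / V"
  proof -
    have "a * q^2 * t^2 * n^2 / ((s + t) * (q^2 + 1)) \<le> a * q^2 * t^2 * n^2 / V"
      using V1 pos by (intro divide_left_mono mult_pos_pos) (auto intro: add_pos_pos)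
    then show ?thesis by (simp add: field_simps power2_eq_square)
  qed
  have L2: "a * s * t * n = n^2 * t * (a * s / n)"
    using pos by (simp add: field_simps power2_eq_square)
  \<comment> \<open>Lowering \<open>s\<close> from \<open>a\<close> decreases
    \<open>a * s / n\<close> but increases \<open>t / (s + t)\<close>. The increase prevails because
    \<open>(a + t)^2 <= q^2 * t\<close>.\<close>
  have L3: "a * q^2 / (q^2 + 1) * t / (a + t) + a^2 / (q^2 + a)
      \<le> a * q^2 / (q^2 + 1) * t / (s + t) + a * s / n"
  proof -
    have d1: "t / (s + t) - t / (a + t) = t * (a - s) / ((s + t) * (a + t))"
      using pos by (simp add: field_simps)
    have d2: "a / (q^2 + a) - s / n = q^2 * (a - s) / (n * (q^2 + a))"
    proof -
      have nz: "q^2 + a \<noteq> 0" "n \<noteq> 0" using pos by (auto simp: add_pos_pos add_nonneg_eq_0_iff)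
      show ?thesis unfolding diff_frac_eq[OF nz] by (simp add: n_def algebra_simps)
    qed
    have as: "0 \<le> a - s" using s by (simp add: a_def)
    have "0 < q^2 + a" using pos by (simp add: add_pos_pos)
    then have "q^2 / (q^2 + a) \<le> 1" using pos by (simp add: divide_le_eq_1_pos)
    then have "q^2 * (a - s) / (n * (q^2 + a)) \<le> (a - s) / n"
      using as pos mult_left_mono[of "q^2 / (q^2 + a)" 1 "(a - s) / n"] by (simp add: field_simps)
    also have "\<dots> \<le> (a - s) / (q^2 + 1)"
      using as sp pos by (intro divide_left_mono) (auto simp: n_def intro!: mult_pos_pos add_pos_pos)
    also have "\<dots> \<le> q^2 / (q^2 + 1) * (t * (a - s) / ((s + t) * (a + t)))"
    proof -
      have "(s + t) * (a + t) \<le> (a + t) * (a + t)" using s t pos by (intro mult_right_mono) (auto simp: a_def)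
      also have "\<dots> \<le> q^2 * t"
      proof -
        have Z: "0 \<le> (t - 6) * (a - t)" using t s by (simp add: a_def)
        have "t * t \<le> (a + 6) * t - 6 * a" using Z by (simp add: algebra_simps)
        then have "(a + t) * (a + t) \<le> a * a - 6 * a + (3 * a + 6) * t" by (simp add: algebra_simps)
        also have "\<dots> \<le> (a * a - 6 * a) * (t / 6) + (3 * a + 6) * t"
        proof -
          have "0 \<le> a * (a - 6)" using q by (simp add: a_def)
          then have nn: "0 \<le> a * a - 6 * a" by (simp add: algebra_simps)
          have "(a * a - 6 * a) * 1 \<le> (a * a - 6 * a) * (t / 6)"
            by (rule mult_left_mono[OF _ nn]) (use t in simp)
          then show ?thesis by simp
        qed
        also have "\<dots> = t * (a * a / 6 + 2 * a + 6)" by (simp add: algebra_simps)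
        also have "\<dots> \<le> t * q^2"
        proof (intro mult_left_mono)
          have "a * a / 6 + 2 * a + 6 = (q^2 + 14 * q + 49) / 6"
            by (simp add: a_def power2_eq_square field_simps)
          then show "a * a / 6 + 2 * a + 6 \<le> q^2" using q2 q by simp
        qed (use pos in simp)
        finally show ?thesis by (simp add: mult.commute)
      qed
      finally have "1 \<le> q^2 * t / ((s + t) * (a + t))" using pos by (simp add: add_pos_pos)
      then have "(a - s) / (q^2 + 1) * 1 \<le> (a - s) / (q^2 + 1) * (q^2 * t / ((s + t) * (a + t)))"
        using as by (intro mult_left_mono) (auto simp: add_nonneg_pos)
      then show ?thesis by (simp add: field_simps)
    qed
    finally have "a / (q^2 + a) - s / n \<le> q^2 / (q^2 + 1) * (t / (s + t) - t / (a + t))"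
      unfolding d1 d2 .
    then have "a * (a / (q^2 + a) - s / n) \<le> a * (q^2 / (q^2 + 1) * (t / (s + t) - t / (a + t)))"
      using pos by (intro mult_left_mono) auto
    then show ?thesis by (simp add: algebra_simps power2_eq_square)
  qed
  have "(1 + 1 / t) * (225/56 + t / (14 * q) * b) + k * (k - 1) * (s + t) / (14 * n)
      < a * q^2 / (q^2 + 1) * t / (s + t) + a * s / n"
    using chord_gap[OF q a_def t(1)] t s v1 v2 L3 unfolding a_def[symmetric] k1_def by linarith
  then have "n^2 * t * ((1 + 1 / t) * (225/56 + t / (14 * q) * b) + k * (k - 1) * (s + t) / (14 * n))
      < n^2 * t * (a * q^2 / (q^2 + 1) * t / (s + t) + a * s / n)"
    using pos by (intro mult_strict_left_mono) auto
  then show ?thesis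
    unfolding e1 a_def[symmetric] distrib_left[of "n^2 * t"] using u1 u2 L1 L2 by linarith
qed

lemma card_split: "finite A \<Longrightarrow> card A = card {a \<in> A. Q a} + card {a \<in> A. \<not> Q a}"
  by (subst card_Un_disjoint[symmetric]) (auto intro: arg_cong[where f = card])

section \<open>Weights of the lines and points of one solid\<close>

locale solid5 = intriguing_geom +
  fixes T :: 'a
  assumes N: "N = 6" and T4: "T \<in> lv 4"
begin

definition K :: "'a set" where "K = {E \<in> Y. E \<preceq> T}"
definition t :: real where "t = real (card K)"
definition m :: "'a \<Rightarrow> real" where "m l = thru K l"
definition W :: real where "W = (\<Sum>l\<in>ln T. up l)"
definition wP :: "'a \<Rightarrow> real" where "wP P = (\<Sum>l\<in>lnp P T. up l)"
abbreviation r :: real where "r \<equiv> real q"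

sublocale solid car le meet join rk q N T K
  by unfold_locales (use T4 Y_sub in \<open>auto simp: K_def\<close>)

lemma D5: "D = r^2 + r^3"
  unfolding D_def by (simp add: N gn_numerals)

lemma r2: "2 \<le> r"
  using q2 by simp

lemma K_iff: "E \<in> pl T \<Longrightarrow> E \<in> Y \<longleftrightarrow> E \<in> K"
  by (simp add: K_def)

text \<open>The planes of \<open>T\<close> have weight \<open>x\<close> or \<open>x + D\<close>, and
  every line of \<open>T\<close> lies on \<open>r + 1\<close> of them. The factor
  \<open>r + 1\<close> cancels since it also divides \<open>D\<close> and the number of
  planes.\<close>

lemma W_eq: "W = (r^2 + 1) * x + r^2 * t"
proof -
  have "(r + 1) * W = (\<Sum>E\<in>pl T. \<Sum>l\<in>ln E. up l)"
    using sum_planes_weight[of up] by (simp add: W_def add.commute)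
  also have "\<dots> = (\<Sum>E\<in>pl T. x + (if E \<in> K then D else 0))"
    by (rule sum.cong) (use sum_up_plane K_iff in auto)
  also have "\<dots> = gn q 4 * x + t * D"
    using cnt_planes_solid[OF T4] K
    by (simp add: sum.distrib t_def sum.inter_restrict[symmetric] inf.absorb2)
  also have "\<dots> = (r + 1) * ((r^2 + 1) * x + r^2 * t)"
    by (simp add: gn_numerals D5 power2_eq_square power3_eq_cube algebra_simps)
  finally show ?thesis using r2 by simp
qed

text \<open>The planes of \<open>T\<close> off \<open>P\<close> determine the weight of the lines
  off \<open>P\<close>. So the weight at \<open>P\<close> is an affine function of the number of
  planes of \<open>K\<close> on \<open>P\<close>, and moments of one are moments of the
  other.\<close>

lemma wP_eq:
  assumes "P \<in> pt T"
  shows "wP P = x - r * t + r * (r + 1) * thru K P"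
proof -
  let ?A = "{E \<in> pl T. \<not> P \<preceq> E}"
  have P: "P \<in> lv 1" "P \<preceq> T" using assms by auto
  have "card (pl T) = card {E \<in> pl T. P \<preceq> E} + card ?A"
    by (rule card_split) simp
  then have cA: "real (card ?A) = r^3"
    using cnt_planes_solid[OF T4] cnt_planes_point_solid[OF P(1) T4 P(2)] by (simp add: gn_numerals)
  have "?A \<inter> K = {E \<in> K. \<not> P \<preceq> E}" using K by blast
  then have "card K = card {E \<in> K. P \<preceq> E} + card (?A \<inter> K)"
    using card_split[OF finite_K, of "\<lambda>E. P \<preceq> E"] by simp
  then have cAK: "real (card (?A \<inter> K)) = t - thru K P" by (simp add: t_def thru_def)
  have "r * (W - wP P) = (\<Sum>E\<in>?A. \<Sum>l\<in>ln E. up l)"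
    using sum_planes_off_point[OF assms, of up] by (simp add: W_def wP_def)
  also have "\<dots> = (\<Sum>E\<in>?A. x + (if E \<in> K then D else 0))"
    by (rule sum.cong) (use sum_up_plane K_iff in auto)
  also have "\<dots> = r^3 * x + (t - thru K P) * D"
    using cA cAK by (simp add: sum.distrib sum.inter_restrict[symmetric])
  also have "\<dots> = r * (r^2 * x + r * (r + 1) * (t - thru K P))"
    by (simp add: D5 power2_eq_square power3_eq_cube algebra_simps)
  finally have "W - wP P = r^2 * x + r * (r + 1) * (t - thru K P)" using r2 by simp
  then show ?thesis unfolding W_eq by (simp add: power2_eq_square algebra_simps)
qed

lemma up_point5: "P \<in> lv 1 \<Longrightarrow> (r + 1) * up P = (r^2 + 1) * x"
proof -
  assume "P \<in> lv 1"
  then have "(r + 1) * ((r + 1) * up P) = (r + 1) * ((r^2 + 1) * x)"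
    using up_point[of P] by (simp add: N gn_numerals power2_eq_square power3_eq_cube algebra_simps)
  then show ?thesis using r2 by (metis mult_left_cancel add_nonneg_eq_0_iff of_nat_0_le_iff zero_le_one zero_neq_one)
qed

lemma wP_nonneg: "0 \<le> wP P"
  unfolding wP_def by (rule sum_nonneg) simp

text \<open>A plane of \<open>Y\<close> on \<open>P\<close> that is not in \<open>T\<close> meets
  \<open>T\<close> in at most one line, whereas a plane in \<open>T\<close> is counted on all its
  \<open>r + 1\<close> lines through \<open>P\<close>.\<close>

lemma wP_le_up:
  assumes P: "P \<in> pt T"
  shows "wP P \<le> up P + r * thru K P"
proof -
  have "wP P = (\<Sum>l\<in>lnp P T. \<Sum>E\<in>{E \<in> Y. l \<preceq> E}. 1)" by (simp add: wP_def up_def)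
  also have "\<dots> = (\<Sum>E\<in>Y. real (card {l \<in> lnp P T. l \<preceq> E}) * 1)"
    by (rule sum_swap_card) simp_all
  also have "\<dots> \<le> (\<Sum>E\<in>Y. (if P \<preceq> E then 1 else 0) + (if P \<preceq> E \<and> E \<preceq> T then r else 0))"
  proof (rule sum_mono)
    fix E assume "E \<in> Y"
    then have E: "E \<in> lv 3" using Y_lv by blast
    have Pl: "P \<in> lv 1" "P \<preceq> T" using P by auto
    consider "\<not> P \<preceq> E" | "P \<preceq> E" "E \<preceq> T" | "P \<preceq> E" "\<not> E \<preceq> T" by blast
    then show "real (card {l \<in> lnp P T. l \<preceq> E}) * 1
        \<le> (if P \<preceq> E then 1 else 0) + (if P \<preceq> E \<and> E \<preceq> T then r else 0)"
    proof cases
      case 1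
      then have "{l \<in> lnp P T. l \<preceq> E} = {}" using lv_trans[of P _ E 1 2 3] Pl E by blast
      then have "card {l \<in> lnp P T. l \<preceq> E} = 0" by (simp only: card.empty)
      then show ?thesis using 1 by simp
    next
      case 2
      then have "{l \<in> lnp P T. l \<preceq> E} = lnp P E" using lv_trans[of _ E T 2 3 4] E T4 by blast
      then show ?thesis using 2 cnt_lines_flag[OF Pl(1) E] by simp
    next
      case 3
      have c: "E \<in> car" "T \<in> car" using E T4 by (auto simp: lv_def)
      have "meet E T \<noteq> E" using 3 meet_le2[OF c] by auto
      then have "rk (meet E T) < 3"
        using rk_strict[OF meet_le1[OF c]] meet_in[OF c] c E by (simp add: lv_def)
      then have le1: "card {l \<in> lv 2. l \<preceq> E \<and> l \<preceq> T} \<le> 1"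
      proof (cases "rk (meet E T) = 2")
        case True then show ?thesis using common_meet[OF E T4 True] by simp
      next
        case False
        then have "rk (meet E T) < 2" using \<open>rk (meet E T) < 3\<close> by simp
        then have "{l \<in> lv 2. l \<preceq> E \<and> l \<preceq> T} = {}" by (rule common_meet_empty[OF E T4])
        then have c0: "card {l \<in> lv 2. l \<preceq> E \<and> l \<preceq> T} = 0" by (simp only: card.empty)
        show ?thesis unfolding c0 by simp
      qed
      have "card {l \<in> lnp P T. l \<preceq> E} \<le> card {l \<in> lv 2. l \<preceq> E \<and> l \<preceq> T}"
        by (rule card_mono) auto
      then have "card {l \<in> lnp P T. l \<preceq> E} \<le> 1" using le1 by (rule order_trans)
      then show ?thesis using 3 by simp
    qed
  qed
  also have "\<dots> = up P + r * thru K P"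
  proof -
    have "{E \<in> Y. P \<preceq> E \<and> E \<preceq> T} = {E \<in> K. P \<preceq> E}" by (auto simp: K_def)
    then show ?thesis
      by (simp add: sum.distrib up_def thru_def sum.inter_filter[symmetric])
  qed
  finally show ?thesis .
qed

text \<open>Elimination of \<open>thru K P\<close> between \<open>wP_eq\<close> and
  \<open>wP_le_up\<close>, with the constant value of \<open>up P\<close>.\<close>

lemma wP_le:
  assumes P: "P \<in> pt T"
  shows "wP P \<le> r * x + t"
proof -
  have "(r + 1) * wP P \<le> (r + 1) * (up P + r * thru K P)"
    using wP_le_up[OF P] r2 by (intro mult_left_mono) auto
  also have "\<dots> = (r^2 + 1) * x + r * (r + 1) * thru K P"
    using up_point5[of P] P by (simp add: algebra_simps)
  also have "\<dots> = (r^2 + 1) * x + wP P - x + r * t"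
    using wP_eq[OF P] by simp
  finally have "r * wP P \<le> r * (r * x + t)" by (simp add: power2_eq_square algebra_simps)
  then show ?thesis using r2 by simp
qed

lemma card_pt: "card (pt T) = gn q 4"
  using cnt_points[OF T4] by simp

lemma sum_wP: "(\<Sum>P\<in>pt T. wP P) = (r + 1) * W"
proof -
  have "(\<Sum>P\<in>pt T. wP P) = (\<Sum>P\<in>pt T. x - r * t + r * (r + 1) * thru K P)"
    by (rule sum.cong) (use wP_eq in auto)
  also have "\<dots> = gn q 4 * (x - r * t) + r * (r + 1) * (t * gn q 3)"
    using sum_points card_pt by (simp add: sum.distrib t_def flip: sum_distrib_left)
  also have "\<dots> = (r + 1) * W"
    unfolding W_eq by (simp add: gn_numerals power2_eq_square power3_eq_cube algebra_simps)
  finally show ?thesis .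
qed

text \<open>The value agrees with the sum of the squared weights of the planes of \<open>T\<close>,
  of which \<open>t\<close> have weight \<open>x + D\<close> and the others
  \<open>x\<close>.\<close>

lemma sum_wP_sq: "(\<Sum>P\<in>pt T. wP P * wP P) = t * (x + D)^2 + (gn q 4 - t) * x^2"
proof -
  have "(\<Sum>P\<in>pt T. wP P * wP P) = (\<Sum>P\<in>pt T. (x - r * t)^2 + 2 * (x - r * t) * (r * (r + 1)) * thru K P
      + (r * (r + 1))^2 * (thru K P * thru K P))"
    by (rule sum.cong) (auto simp: wP_eq power2_eq_square algebra_simps)
  also have "\<dots> = gn q 4 * (x - r * t)^2 + 2 * (x - r * t) * (r * (r + 1)) * (t * gn q 3)
      + (r * (r + 1))^2 * (t * (gn q 3 + (t - 1) * (r + 1)))"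
    using sum_points sum_points_sq card_pt
    by (simp add: sum.distrib t_def add.commute[of 1 r] flip: sum_distrib_left)
  also have "\<dots> = t * (x + D)^2 + (gn q 4 - t) * x^2"
    unfolding D5 by (simp add: gn_numerals power2_eq_square power3_eq_cube algebra_simps)
  finally show ?thesis .
qed

definition A1 :: real where "A1 = (\<Sum>l\<in>ln T. m l * up l)"
definition A2 :: real where "A2 = (\<Sum>l\<in>ln T. m l * m l * up l)"

lemma A1_eq: "A1 = t * (x + D)"
proof -
  have "(\<Sum>E\<in>K. \<Sum>l\<in>ln E. up l) = (\<Sum>E\<in>K. x + D)"
  proof (rule sum.cong, rule refl)
    fix E assume "E \<in> K"
    then have "E \<in> Y" by (simp add: K_def)
    then show "(\<Sum>l\<in>ln E. up l) = x + D" using sum_up_plane[OF Y_lv[of E]] by simp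
  qed
  then show ?thesis unfolding A1_def m_def sum_thru_lines by (simp add: t_def)
qed

text \<open>The Cauchy-Schwarz inequality for the numbers \<open>m l\<close> with weights
  \<open>up l\<close>, read off from a sum of squares.\<close>

lemma A1_sq: "A1^2 \<le> W * A2" if "0 < W"
proof -
  have "0 \<le> (\<Sum>l\<in>ln T. up l * (m l * W - A1)^2)" by (intro sum_nonneg) simp
  also have "\<dots> = (\<Sum>l\<in>ln T. W^2 * (m l * m l * up l) - 2 * W * A1 * (m l * up l) + A1^2 * up l)"
    by (rule sum.cong) (auto simp: power2_eq_square algebra_simps)
  also have "\<dots> = W^2 * A2 - 2 * W * A1 * A1 + A1^2 * W"
    unfolding A1_def A2_def W_def by (simp add: sum.distrib sum_subtractf sum_distrib_left)
  also have "\<dots> = W * (W * A2 - A1^2)" by (simp add: power2_eq_square algebra_simps)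
  finally show ?thesis using that by (simp add: zero_le_mult_iff)
qed

definition B :: "'a \<Rightarrow> real" where "B P = (\<Sum>l\<in>lnp P T. m l * up l)"

lemma sum_flags:
  fixes f :: "'a \<Rightarrow> 'a \<Rightarrow> real"
  shows "(\<Sum>P\<in>pt T. \<Sum>l\<in>lnp P T. f P l) = (\<Sum>l\<in>ln T. \<Sum>P\<in>pt l. f P l)"
proof -
  have "(\<Sum>P\<in>pt T. \<Sum>l\<in>{l \<in> ln T. P \<preceq> l}. f P l) = (\<Sum>l\<in>ln T. \<Sum>P\<in>{P \<in> pt T. P \<preceq> l}. f P l)"
    by (rule sum.swap_restrict) simp_all
  moreover have "{l \<in> ln T. P \<preceq> l} = lnp P T" for P by blast
  moreover have "{P \<in> pt T. P \<preceq> l} = pt l" if "l \<in> ln T" for l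
    using that lv_trans[of _ l T 1 2 4] T4 by blast
  ultimately show ?thesis by simp
qed

text \<open>The points of a line have total weight \<open>(r + 1) * (x + r^2 * m l)\<close>. Its
  linear term in \<open>m l\<close> produces \<open>A2\<close>, which Cauchy-Schwarz bounds from
  below, while each \<open>B P\<close> can be bounded from above point by point.\<close>

lemma sum_wP_B: "(\<Sum>P\<in>pt T. wP P * B P) = r^2 * (r + 1) * A2 + x * (r + 1) * A1"
proof -
  have "(\<Sum>P\<in>pt T. wP P * B P) = (\<Sum>P\<in>pt T. \<Sum>l\<in>lnp P T. (x - r * t + r * (r + 1) * thru K P) * (m l * up l))"
    by (rule sum.cong) (auto simp: wP_eq B_def sum_distrib_left)
  also have "\<dots> = (\<Sum>l\<in>ln T. \<Sum>P\<in>pt l. (x - r * t + r * (r + 1) * thru K P) * (m l * up l))"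
    by (rule sum_flags)
  also have "\<dots> = (\<Sum>l\<in>ln T. r^2 * (r + 1) * (m l * m l * up l) + x * (r + 1) * (m l * up l))"
  proof (rule sum.cong, rule refl)
    fix l assume l: "l \<in> ln T"
    have "(\<Sum>P\<in>pt l. x - r * t + r * (r + 1) * thru K P) = (r + 1) * (x - r * t) + r * (r + 1) * (t + r * m l)"
      using sum_points_line[OF l] cnt_points_line[of l] l
      by (simp add: sum.distrib t_def m_def add.commute[of 1 r] flip: sum_distrib_left)
    then show "(\<Sum>P\<in>pt l. (x - r * t + r * (r + 1) * thru K P) * (m l * up l))
        = r^2 * (r + 1) * (m l * m l * up l) + x * (r + 1) * (m l * up l)"
      unfolding sum_distrib_right[symmetric] by (simp add: power2_eq_square algebra_simps)
  qed
  also have "\<dots> = r^2 * (r + 1) * A2 + x * (r + 1) * A1"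
    unfolding A1_def A2_def by (simp add: sum.distrib sum_distrib_left)
  finally show ?thesis .
qed

lemma m_nat: "\<exists>n. m l = real n"
  by (simp add: m_def thru_def)

lemma m_quadratic: "0 \<le> m l * (m l - 1)"
proof -
  obtain n where "m l = real n" using m_nat by blast
  then show ?thesis by (cases n) auto
qed

lemma sum_m_pairs: "(\<Sum>l\<in>ln T. m l * (m l - 1)) = t * (t - 1)"
  using sum_thru_pairs by (simp add: m_def t_def)

text \<open>For natural \<open>m >= 1\<close> one has \<open>m - 1 <= m * (m - 1) / 2\<close>, with
  equality exactly at 1 and 2; for \<open>m = 0\<close> the left side is not positive. The equality
  cases matter in \<open>critical_False\<close>.\<close>

lemma excess_le:
  assumes "l \<in> ln T" "up l \<le> t"
  shows "(m l - 1) * up l \<le> t / 2 * (m l * (m l - 1))"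
proof -
  obtain n where n: "m l = real n" using m_nat by blast
  have t: "0 \<le> t" by (simp add: t_def)
  consider "n = 0" | "n = 1" | "2 \<le> n" by linarith
  then show ?thesis
  proof cases
    case 3
    have "(m l - 1) * up l \<le> (m l - 1) * t" using n 3 assms by (intro mult_left_mono) auto
    also have "\<dots> \<le> (m l - 1) * (t * (m l / 2))"
      using n 3 t mult_left_mono[of 1 "m l / 2" t] by (intro mult_left_mono) auto
    finally show ?thesis by (simp add: algebra_simps)
  qed (use n in auto)
qed

lemma excess_sum: "(\<Sum>l\<in>ln T. (m l - 1) * up l) = A1 - W"
  by (simp add: A1_def W_def sum_subtractf left_diff_distrib)

lemma excess_bound:
  assumes "\<And>l. l \<in> ln T \<Longrightarrow> up l \<le> t"
  shows "A1 - W \<le> t^2 * (t - 1) / 2"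
proof -
  have "A1 - W \<le> (\<Sum>l\<in>ln T. t / 2 * (m l * (m l - 1)))"
    unfolding excess_sum[symmetric] by (rule sum_mono) (use excess_le assms in auto)
  also have "\<dots> = t / 2 * (t * (t - 1))" unfolding sum_m_pairs[symmetric] sum_distrib_left ..
  finally show ?thesis by (simp add: power2_eq_square)
qed

lemma A1_minus_W: "A1 - W = t * (x + r^3) - (r^2 + 1) * x"
  unfolding A1_eq W_eq D5 by (simp add: algebra_simps)

text \<open>The constants 225/56 and 14 make \<open>m * u \<le> 225/56 * u + c / 14 * m * (m - 1)\<close> valid for all
  \<open>u \<le> c\<close> and integers \<open>m\<close>: the difference at \<open>u = c\<close> is \<open>c * (m - 15/2)^2 / 14\<close>.\<close>

lemma B_le:
  assumes P: "P \<in> pt T" and u: "\<And>l. l \<in> ln T \<Longrightarrow> up l \<le> t"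
  shows "B P \<le> 225/56 * wP P + t / 14 * (thru K P * (thru K P - 1))"
proof -
  have t: "0 \<le> t" by (simp add: t_def)
  have "m l * up l \<le> 225/56 * up l + t / 14 * (m l * m l - m l)" if l: "l \<in> lnp P T" for l
  proof (cases "m l \<le> 225/56")
    case True
    have "m l * up l \<le> 225/56 * up l" using True by (intro mult_right_mono) auto
    moreover have "0 \<le> t / 14 * (m l * m l - m l)"
      using mult_nonneg_nonneg[of "t / 14", OF _ m_quadratic[of l]] t by (simp add: right_diff_distrib)
    ultimately show ?thesis by linarith
  next
    case False
    have "(m l - 225/56) * up l \<le> (m l - 225/56) * t"
      using False l u[of l] by (intro mult_left_mono) auto
    also have "\<dots> \<le> t / 14 * (m l * m l - m l)"
    proof -
      have "0 \<le> t / 14 * (m l - 15/2)^2" using t by simp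
      then show ?thesis by (simp add: power2_eq_square algebra_simps)
    qed
    finally show ?thesis by (simp add: algebra_simps)
  qed
  then have "B P \<le> (\<Sum>l\<in>lnp P T. 225/56 * up l + t / 14 * (m l * m l - m l))"
    unfolding B_def by (rule sum_mono)
  also have "\<dots> = 225/56 * wP P + t / 14 * ((\<Sum>l\<in>lnp P T. m l * m l) - (\<Sum>l\<in>lnp P T. m l))"
    unfolding wP_def sum_subtractf[symmetric] sum_distrib_left sum.distrib[symmetric] ..
  also have "(\<Sum>l\<in>lnp P T. m l * m l) - (\<Sum>l\<in>lnp P T. m l) = thru K P * (thru K P - 1)"
    using sum_thru_point[OF P] sum_thru_point_sq[OF P] by (simp add: m_def algebra_simps)
  finally show ?thesis .
qed

text \<open>By \<open>wP_eq\<close> the number of planes of \<open>K\<close> on \<open>P\<close> is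
  \<open>k + s * w\<close> for the weight \<open>w\<close> of \<open>P\<close>, so each summand is a
  cubic in \<open>w\<close>. The bound \<open>w <= r * x + t\<close> turns the cubic term into a
  quadratic one, and the first two moments are known.\<close>

lemma third_moment:
  assumes x: "0 \<le> x"
  defines "k \<equiv> (r * t - x) / (r * (r + 1))" and "s \<equiv> 1 / (r * (r + 1))"
  shows "(\<Sum>P\<in>pt T. wP P * (thru K P * (thru K P - 1)))
    \<le> (k^2 - k) * ((r + 1) * W)
      + ((2 * k - 1) * s + s^2 * (r * x + t)) * (t * (x + D)^2 + (gn q 4 - t) * x^2)"
proof -
  have rr: "r * (r + 1) \<noteq> 0" using r2 by simp
  have "wP P * (thru K P * (thru K P - 1))
      \<le> (k^2 - k) * wP P + ((2 * k - 1) * s + s^2 * (r * x + t)) * (wP P * wP P)" if P: "P \<in> pt T" for P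
  proof -
    define w where "w = wP P"
    have "thru K P = (wP P + (r * t - x)) / (r * (r + 1))"
      using wP_eq[OF P] rr by (simp add: nonzero_eq_divide_eq algebra_simps)
    then have th: "thru K P = k + s * w" by (simp add: k_def s_def w_def add_divide_distrib)
    have "s^2 * (w * w) * w \<le> s^2 * (w * w) * (r * x + t)"
      using wP_le[OF P] by (intro mult_left_mono) (auto simp: w_def)
    then show ?thesis unfolding th w_def[symmetric] by (simp add: power2_eq_square algebra_simps)
  qed
  then have "(\<Sum>P\<in>pt T. wP P * (thru K P * (thru K P - 1)))
      \<le> (\<Sum>P\<in>pt T. (k^2 - k) * wP P + ((2 * k - 1) * s + s^2 * (r * x + t)) * (wP P * wP P))"
    by (rule sum_mono)
  also have "\<dots> = (k^2 - k) * ((r + 1) * W)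
      + ((2 * k - 1) * s + s^2 * (r * x + t)) * (t * (x + D)^2 + (gn q 4 - t) * x^2)"
    unfolding sum_wP[symmetric] sum_wP_sq[symmetric] by (simp only: sum.distrib sum_distrib_left)
  finally show ?thesis .
qed

text \<open>The sum of \<open>wP P * B P\<close> is bounded from above by \<open>B_le\<close> and
  \<open>third_moment\<close>, and from below by \<open>sum_wP_B\<close> and Cauchy-Schwarz. Both
  bounds are \<open>a^3\<close> times a side of \<open>scaled_gap\<close>, in the wrong
  order.\<close>

lemma large_False:
  assumes q: "25 \<le> q" and u: "\<And>l. l \<in> ln T \<Longrightarrow> up l \<le> t"
    and x: "x \<le> (r + 1)^2" and t: "6 * (r + 1) \<le> t" "t \<le> x"
  shows False
proof -
  define a where "a = r + 1"
  define k where "k = (r * t - x) / (r * (r + 1))"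
  define s where "s = 1 / (r * (r + 1))"
  define Sw where "Sw = t * (x + D)^2 + (gn q 4 - t) * x^2"
  define \<xi> where "\<xi> = x / a"
  define \<tau> where "\<tau> = t / a"
  have a: "0 < a" "0 < r" using q by (auto simp: a_def)
  have xi: "x = a * \<xi>" and tau: "t = a * \<tau>" using a by (simp_all add: \<xi>_def \<tau>_def)
  have t0: "0 < t" using t a by (simp add: a_def)
  have x0: "0 \<le> x" using t t0 by simp
  have bounds: "6 \<le> \<tau>" "\<tau> \<le> \<xi>" "\<xi> \<le> a"
  proof -
    show "6 \<le> \<tau>" using t(1) a by (simp add: \<tau>_def a_def[symmetric] pos_le_divide_eq)
    show "\<tau> \<le> \<xi>" using t(2) a by (simp add: \<tau>_def \<xi>_def divide_right_mono)
    show "\<xi> \<le> a" using x a by (simp add: \<xi>_def a_def[symmetric] pos_divide_le_eq power2_eq_square)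
  qed
  define V where "V = r^2 * (\<xi> + \<tau>) + \<xi>"
  define n where "n = \<xi> + r^2"
  define R where "R = \<tau> * n^2 + (r^2 + 1 - \<tau>) * \<xi>^2"
  define \<kappa> where "\<kappa> = \<tau> - \<xi> / r"
  have eW: "W = a * V" unfolding W_eq V_def by (simp add: xi tau algebra_simps)
  have eD: "x + D = a * n" unfolding D5 n_def by (simp add: xi a_def power2_eq_square power3_eq_cube algebra_simps)
  have eS: "Sw = a^3 * R"
    unfolding Sw_def R_def eD by (simp add: xi tau a_def gn_numerals power2_eq_square power3_eq_cube algebra_simps)
  have ek: "k = \<kappa>"
  proof -
    have "k = (r * (a * \<tau>) - a * \<xi>) / (r * a)"
      unfolding k_def by (simp only: a_def[symmetric] xi[symmetric] tau[symmetric])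
    then show ?thesis using a by (simp add: \<kappa>_def diff_divide_distrib)
  qed
  have es: "s = 1 / (r * a)" by (simp add: s_def a_def)
  have Vpos: "0 < V" using bounds a by (auto simp: V_def intro!: add_pos_pos mult_pos_pos)
  have W0: "0 < W" using eW a Vpos by simp
  have eA: "A1 = a^2 * \<tau> * n" unfolding A1_eq eD by (simp add: tau power2_eq_square)
  have "r^2 * a * A2 + x * a * A1 = (\<Sum>P\<in>pt T. wP P * B P)" using sum_wP_B by (simp add: a_def)
  also have "\<dots> \<le> (\<Sum>P\<in>pt T. wP P * (225/56 * wP P + t / 14 * (thru K P * (thru K P - 1))))"
    by (intro sum_mono mult_left_mono B_le u wP_nonneg)
  also have "\<dots> = 225/56 * Sw + t / 14 * (\<Sum>P\<in>pt T. wP P * (thru K P * (thru K P - 1)))"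
    unfolding Sw_def sum_wP_sq[symmetric] by (simp only: sum.distrib sum_distrib_left distrib_left mult.left_commute)
  also have "\<dots> \<le> 225/56 * Sw + t / 14 * ((k^2 - k) * (a * W) + ((2 * k - 1) * s + s^2 * (r * x + t)) * Sw)"
  proof (intro add_left_mono mult_left_mono)
    show "(\<Sum>P\<in>pt T. wP P * (thru K P * (thru K P - 1)))
        \<le> (k^2 - k) * (a * W) + ((2 * k - 1) * s + s^2 * (r * x + t)) * Sw"
      unfolding k_def s_def Sw_def a_def by (rule third_moment[OF x0])
  qed (use t0 in simp)
  finally have 1: "r^2 * a * A2 + x * a * A1
      \<le> 225/56 * Sw + t / 14 * ((k^2 - k) * (a * W) + ((2 * k - 1) * s + s^2 * (r * x + t)) * Sw)" .
  have "A1^2 / W \<le> A2" using A1_sq[OF W0] W0 by (simp add: pos_divide_le_eq mult.commute)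
  then have "r^2 * a * (A1^2 / W) \<le> r^2 * a * A2" using a by (intro mult_left_mono) auto
  with 1 have 2: "r^2 * a * (A1^2 / W) + x * a * A1
      \<le> 225/56 * Sw + t / 14 * ((k^2 - k) * (a * W) + ((2 * k - 1) * s + s^2 * (r * x + t)) * Sw)"
    by linarith
  have l: "r^2 * a * (A1^2 / W) + x * a * A1 = a^3 * ((r + 1) * r^2 * \<tau>^2 * n^2 / V + (r + 1) * \<xi> * \<tau> * n)"
    unfolding eA eW a_def[symmetric] using a Vpos
    by (simp add: xi field_simps power2_eq_square power3_eq_cube)
  have rhs: "225/56 * Sw + t / 14 * ((k^2 - k) * (a * W) + ((2 * k - 1) * s + s^2 * (r * x + t)) * Sw)
      = a^3 * (225/56 * R + \<tau> / 14 * ((\<kappa>^2 - \<kappa>) * V + (2 * \<kappa> - 1) * R / r + (r * \<xi> + \<tau>) * R / r^2))"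
  proof -
    have "t * ((k^2 - k) * (a * W)) = a^3 * (\<tau> * ((\<kappa>^2 - \<kappa>) * V))"
      unfolding eW ek by (simp add: tau power3_eq_cube)
    moreover have "t * ((2 * k - 1) * s * Sw) = a^3 * (\<tau> * ((2 * \<kappa> - 1) * R / r))"
      unfolding eS ek es tau using a by (simp add: power3_eq_cube)
    moreover have "t * (s^2 * (r * x + t) * Sw) = a^3 * (\<tau> * ((r * \<xi> + \<tau>) * R / r^2))"
      unfolding eS es tau xi using a by (simp add: power3_eq_cube power2_eq_square field_simps)
    ultimately have e: "t * ((k^2 - k) * (a * W) + ((2 * k - 1) * s + s^2 * (r * x + t)) * Sw)
      = a^3 * (\<tau> * ((\<kappa>^2 - \<kappa>) * V + (2 * \<kappa> - 1) * R / r + (r * \<xi> + \<tau>) * R / r^2))"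
      by (simp only: distrib_left distrib_right mult.assoc)
    have "225/56 * S' + t / 14 * Y' = a^3 * (225/56 * R + \<tau> / 14 * Z')"
      if "t * Y' = a^3 * (\<tau> * Z')" "S' = a^3 * R" for Y' Z' S' :: real
      using that by (simp add: field_simps)
    then show ?thesis using e eS by blast
  qed
  have "225/56 * R + \<tau> / 14 * ((\<kappa>^2 - \<kappa>) * V + (2 * \<kappa> - 1) * R / r + (r * \<xi> + \<tau>) * R / r^2)
      < (r + 1) * r^2 * \<tau>^2 * n^2 / V + (r + 1) * \<xi> * \<tau> * n"
    unfolding V_def n_def R_def \<kappa>_def by (rule scaled_gap) (use q bounds in \<open>auto simp: a_def\<close>)
  then have "a^3 * (225/56 * R + \<tau> / 14 * ((\<kappa>^2 - \<kappa>) * V + (2 * \<kappa> - 1) * R / r + (r * \<xi> + \<tau>) * R / r^2))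
      < a^3 * ((r + 1) * r^2 * \<tau>^2 * n^2 / V + (r + 1) * \<xi> * \<tau> * n)"
    using a by (intro mult_strict_left_mono) auto
  then show False using 2 unfolding l rhs by linarith
qed

text \<open>Here the estimates leave no room: \<open>excess_bound\<close> is an equality and
  \<open>x\<close> equals its upper bound. Then lines on no plane of \<open>K\<close> have weight
  zero and no line is on three planes of \<open>K\<close>. This leaves a point on no plane of
  \<open>K\<close>; its weight is zero, which forces another value of \<open>x\<close>.\<close>

lemma critical_False:
  assumes u: "\<And>l. l \<in> ln T \<Longrightarrow> up l \<le> t"
    and x: "x \<le> (r + 1)^2 - (r + 1) / 2" and t: "t = r + 1"
  shows False
proof -
  have r0: "0 < r" "2 \<le> r" using r2 by simp_all
  have e: "A1 - W = (r + 1) * r^3 - x * (r * (r - 1))"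
    unfolding A1_minus_W t by (simp add: power2_eq_square power3_eq_cube algebra_simps)
  have x': "x * (r * (r - 1)) \<le> ((r + 1)^2 - (r + 1) / 2) * (r * (r - 1))"
    using x r0 by (intro mult_right_mono) auto
  have e': "(r + 1) * r^3 - ((r + 1)^2 - (r + 1) / 2) * (r * (r - 1)) = t^2 * (t - 1) / 2"
    unfolding t by (simp add: power2_eq_square power3_eq_cube field_simps)
  have eq: "A1 - W = t^2 * (t - 1) / 2"
    using excess_bound[OF u] e e' x' by linarith
  then have "x * (r * (r - 1)) = ((r + 1)^2 - (r + 1) / 2) * (r * (r - 1))"
    using e e' by linarith
  moreover have "r * (r - 1) \<noteq> 0" using r0 by simp
  ultimately have x_eq: "x = (r + 1)^2 - (r + 1) / 2" by (metis mult_right_cancel)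
  \<comment> \<open>The slack in \<open>excess_le\<close> is non-negative on every line and its sum
    is zero, so it vanishes line by line.\<close>
  have "(\<Sum>l\<in>ln T. t / 2 * (m l * (m l - 1)) - (m l - 1) * up l) = t / 2 * (t * (t - 1)) - (A1 - W)"
    unfolding sum_subtractf excess_sum sum_m_pairs[symmetric] sum_distrib_left ..
  also have "\<dots> = 0" unfolding eq by (simp add: power2_eq_square)
  finally have z: "t / 2 * (m l * (m l - 1)) - (m l - 1) * up l = 0" if "l \<in> ln T" for l
    using sum_nonneg_eq_0_iff[of "ln T" "\<lambda>l. t / 2 * (m l * (m l - 1)) - (m l - 1) * up l"]
      excess_le u that by simp
  have m0: "up l = 0" if "l \<in> ln T" "m l = 0" for l using z[OF that(1)] that(2) by simp
  have m2: "m l \<le> 2" if l: "l \<in> ln T" for l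
  proof (cases "m l \<le> 1")
    case False
    then have "m l - 1 \<noteq> 0" by simp
    moreover have "(m l - 1) * (t / 2 * m l) = (m l - 1) * up l"
      using z[OF l] by (simp add: algebra_simps diff_divide_distrib)
    ultimately have "t / 2 * m l = up l" using mult_left_cancel by blast
    then have "t * m l \<le> t * 2" using u[OF l] by simp
    moreover have "0 < t" using t r0 by simp
    ultimately show ?thesis using mult_le_cancel_left_pos by blast
  qed simp
  have cardK: "card K = q + 1" using t by (simp add: t_def)
  then have "1 < card K" using r0 by simp
  then obtain E1 E2 where E: "E1 \<in> K" "E2 \<in> K" "E1 \<noteq> E2"
    by (metis card_le_Suc0_iff_eq finite_K not_less One_nat_def)
  have Elv: "E1 \<in> lv 3" "E2 \<in> lv 3" "E1 \<in> pl T" "E2 \<in> pl T" using E KD by auto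
  note Ec = lv_car[OF Elv(1)] lv_car[OF Elv(2)]
  define l where "l = meet E1 E2"
  have l2: "l \<in> lv 2" unfolding l_def by (rule lv_meet[OF Elv(1,2) meet_rk[OF Elv(3,4) E(3)]])
  have lE: "l \<preceq> E1" "l \<preceq> E2" unfolding l_def using meet_le1 meet_le2 Ec by auto
  have lT: "l \<in> ln T" using l2 lv_trans[OF lE(1) _ l2 Elv(1) T4] Elv by blast
  have "\<not> {E \<in> pl T. l \<preceq> E} \<subseteq> K"
  proof
    assume "{E \<in> pl T. l \<preceq> E} \<subseteq> K"
    then have "{E \<in> pl T. l \<preceq> E} = {E \<in> K. l \<preceq> E}" using K by blast
    then have "m l = r + 1" using cnt_planes_flag[OF l2 T4] lT by (simp add: m_def thru_def)
    then show False using m2[OF lT] r0 by simp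
  qed
  then obtain F where F: "F \<in> pl T" "l \<preceq> F" "F \<notin> K" by blast
  have F3: "F \<in> lv 3" using F by blast
  note Fc = lv_car[OF F3]
  \<comment> \<open>\<open>E1\<close> and \<open>E2\<close> both cut \<open>F\<close> in
    \<open>l\<close>. Hence the \<open>q + 1\<close> planes of \<open>K\<close> cut \<open>F\<close>
    in at most \<open>q\<close> lines, which cannot cover its \<open>q^2 + q + 1\<close>
    points.\<close>
  define M where "M = (\<lambda>E. meet F E) ` K"
  have ml: "meet F E \<in> lv 2 \<and> meet F E \<preceq> F \<and> meet F E \<preceq> E" if "E \<in> K" for E
  proof -
    have E': "E \<in> lv 3" "E \<in> pl T" "F \<noteq> E" using that KD F by auto
    show ?thesis
      using lv_meet[OF F3 E'(1) meet_rk[OF F(1) E'(2,3)]] meet_le1[OF Fc lv_car[OF E'(1)]]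
        meet_le2[OF Fc lv_car[OF E'(1)]] by blast
  qed
  have mE: "meet F E = l" if "E \<in> K" "l \<preceq> E" for E
  proof -
    have E': "E \<in> lv 3" "E \<in> car" using that(1) KD lv_car by auto
    have "l \<preceq> meet F E" by (rule meet_greatest[OF F(2) that(2) Fc E'(2) lv_car[OF l2]])
    then show ?thesis using lv_eqI[OF _ l2] ml[OF that(1)] by blast
  qed
  have "M \<subseteq> meet F ` (K - {E1})"
  proof
    fix y assume "y \<in> M"
    then obtain E where "E \<in> K" "y = meet F E" by (auto simp: M_def)
    then show "y \<in> meet F ` (K - {E1})"
      using mE[OF E(1) lE(1)] mE[OF E(2) lE(2)] E
      by (cases "E = E1") (auto intro: rev_image_eqI[of E2])
  qed
  then have "card M \<le> card (meet F ` (K - {E1}))" by (intro card_mono) simp_all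
  also have "\<dots> \<le> card (K - {E1})" by (rule card_image_le) simp
  also have "\<dots> = q" using cardK E by simp
  finally have cM: "card M \<le> q" .
  have "card (\<Union>l\<in>M. pt l) \<le> (\<Sum>l\<in>M. card (pt l))"
    by (rule card_UN_le) (simp add: M_def)
  also have "\<dots> = (\<Sum>l\<in>M. q + 1)"
    by (rule sum.cong) (use ml cnt_points_line in \<open>auto simp: M_def\<close>)
  also have "\<dots> = card M * (q + 1)" by simp
  also have "\<dots> \<le> q * (q + 1)" using cM by (rule mult_right_mono) simp
  also have "\<dots> < card (pt F)" using cnt_points[OF F3] by (simp add: gn_numerals power2_eq_square)
  finally have "\<not> pt F \<subseteq> (\<Union>l\<in>M. pt l)"
    using card_mono[of "\<Union>l\<in>M. pt l" "pt F"] by (fastforce simp: M_def)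
  then obtain P where P: "P \<in> pt F" "P \<notin> (\<Union>l\<in>M. pt l)" by blast
  have PT: "P \<in> pt T" using P F lv_trans[of P F T 1 3 4] T4 by blast
  have noK: "{E \<in> K. P \<preceq> E} = {}"
  proof -
    have False if "E \<in> K" "P \<preceq> E" for E
    proof -
      have E': "E \<in> car" using that(1) KD lv_car by blast
      have "P \<preceq> meet F E" by (rule meet_greatest[OF _ that(2) Fc E']) (use P lv_car in auto)
      then show False using P that(1) by (auto simp: M_def)
    qed
    then show ?thesis by blast
  qed
  then have k0: "thru K P = 0" by (simp only: thru_def card.empty of_nat_0)
  have "up l = 0" if "l \<in> lnp P T" for l
  proof -
    have "{E \<in> K. l \<preceq> E} \<subseteq> {E \<in> K. P \<preceq> E}" using that PT KD lv_trans[of P l _ 1 2 3] by blast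
    then have "{E \<in> K. l \<preceq> E} = {}" using noK by blast
    then have "m l = 0" by (simp only: m_def thru_def card.empty of_nat_0)
    then show ?thesis using m0 that by blast
  qed
  then have "wP P = 0" by (simp add: wP_def)
  then have "x = r * (r + 1)" using wP_eq[OF PT] k0 t by simp
  \<comment> \<open>The value found before is \<open>(r + 1) * (r + 1/2)\<close>.\<close>
  then show False using x_eq r0 by (simp add: power2_eq_square field_simps)
qed

text \<open>The range of \<open>t\<close> is exhausted by three methods: the equality case at
  \<open>q + 1\<close>, the pair count with \<open>cubic_gap\<close> from \<open>q + 2\<close> up to
  \<open>6 * (q + 1)\<close>, and the third moment from there on.\<close>

lemma maximal_solid_False:
  assumes q: "25 \<le> q" and u: "\<And>l. l \<in> ln T \<Longrightarrow> up l \<le> t"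
    and x: "x \<le> (r + 1)^2 - (r + 1) / 2" and t: "r + 1 \<le> t" "t \<le> x"
  shows False
proof -
  have "0 \<le> (r + 1) / 2" by simp
  then have x': "x \<le> (r + 1)^2" using x by linarith
  have "real (q + 1) \<le> real (card K)" using t by (simp add: t_def)
  then have "q + 1 \<le> card K" by linarith
  then consider "card K = q + 1" | "q + 2 \<le> card K" by linarith
  then show False
  proof cases
    case 1
    then show False using critical_False[OF u x] by (simp add: t_def)
  next
    case 2
    then have t2: "r + 2 \<le> t" by (simp add: t_def)
    show False
    proof (cases "6 * (r + 1) \<le> t")
      case True
      then show False using large_False[OF q u x'] t by blast
    next
      case False
      then have "t^2 * (t - 1) / 2 < t * (x + r^3) - (r^2 + 1) * x"
        using cubic_gap[of r x t] q x' t2 by simp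
      then show False using excess_bound[OF u] A1_minus_W by linarith
    qed
  qed
qed

end

section \<open>Duality and the bound for PG(5,q)\<close>

context intriguing_geom
begin

text \<open>In rank 6 planes are dual to planes, and two planes meet in a line exactly if they span
  a solid. So \<open>Y\<close> stays intriguing with the same \<open>x\<close>.\<close>

lemma dual5:
  assumes N: "N = 6"
  shows "intriguing_geom car (\<lambda>x y. y \<preceq> x) join meet (\<lambda>x. N - rk x) q N Y x"
proof -
  interpret P: proj_geom car "\<lambda>x y. y \<preceq> x" join meet "\<lambda>x. N - rk x" q N by (rule dual)
  have l3: "P.lv 3 = lv 3"
  proof (rule set_eqI)
    fix u show "u \<in> P.lv 3 \<longleftrightarrow> u \<in> lv 3"
      unfolding P.lv_def lv_def using rk_le[of u] N by auto
  qed
  show ?thesis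
  proof unfold_locales
    show "Y \<subseteq> P.lv 3" using Y_sub l3 by simp
    show "6 \<le> N" using N by simp
    fix E assume "E \<in> P.lv 3"
    then have E: "E \<in> lv 3" using l3 by simp
    have "N - rk (join E E') = 2 \<longleftrightarrow> rk (meet E E') = 2" if "E' \<in> Y" for E'
    proof -
      have "E' \<in> lv 3" using that Y_sub by blast
      then have "rk (meet E E') + rk (join E E') = 6" "rk (join E E') \<le> 6"
        using rk_meet_join[OF E] rk_le[OF join_in[of E E']] E N by (auto simp: lv_def)
      then show ?thesis using N by linarith
    qed
    then have "{E' \<in> Y. N - rk (join E E') = 2} = {E' \<in> Y. rk (meet E E') = 2}" by blast
    then show "real (card {E' \<in> Y. N - rk (join E E') = 2}) =
        x + (if E \<in> Y then real (gn q (N - 2)) - real (q + 1) - real (gn q 3) else 0)"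
      using adjacent[OF E] by simp
  qed
qed

text \<open>A full line would put \<open>gn q 4\<close> planes of \<open>Y\<close> on each of its
  points, and by \<open>up_point\<close> this means \<open>x >= (q + 1)^2\<close>. So the general
  bound for lines that are not full applies.\<close>

lemma up_le_x5:
  assumes N: "N = 6" and x: "x < (q + 1)^2" and l: "l \<in> lv 2"
  shows "up l \<le> x"
proof (rule up_le_x[OF l])
  show "l \<notin> full"
  proof
    assume f: "l \<in> full"
    obtain P where P: "P \<in> lv 1" "P \<preceq> l"
    proof -
      have "card {P \<in> lv 1. P \<preceq> l} \<noteq> 0" using cnt_points_line[OF l] by simp
      then have "{P \<in> lv 1. P \<preceq> l} \<noteq> {}" by (metis card.empty)
      then show ?thesis using that by blast
    qed
    have "{E \<in> Y. l \<preceq> E} \<subseteq> {E \<in> Y. P \<preceq> E}"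
      using lv_trans[OF P(2) _ P(1) l] Y_lv by blast
    then have "up l \<le> up P" unfolding up_def using card_mono[of "{E \<in> Y. P \<preceq> E}"] by simp
    then have "real ((q + 1)^2) * gn q 4 \<le> (q + 1)^2 * up P"
      using up_full[OF f] N by (intro mult_left_mono) auto
    also have "\<dots> = gn q 4 * x" using up_point[OF P(1)] N by simp
    finally have "real (gn q 4) * real ((q + 1)^2) \<le> gn q 4 * x" by (simp only: mult.commute)
    moreover have "0 < real (gn q 4)" by (simp add: gn_pos)
    ultimately have "real ((q + 1)^2) \<le> x" by simp
    then show False using x by simp
  qed
qed

lemma five_bound:
  assumes N: "N = 6" and q: "25 \<le> q" and ne: "Y \<noteq> {}" "Y \<noteq> lv 3"
  shows "(q + 1)^2 \<le> x"
proof (rule ccontr)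
  assume "\<not> ?thesis"
  then have x: "x < (q + 1)^2" by simp
  let ?r = "real q"
  interpret P: intriguing_geom car "\<lambda>x y. y \<preceq> x" join meet "\<lambda>x. N - rk x" q N Y x
    by (rule dual5[OF N])
  have Plv: "P.lv d = lv (6 - d)" if "d \<le> 6" for d
  proof (rule set_eqI)
    fix u show "u \<in> P.lv d \<longleftrightarrow> u \<in> lv (6 - d)"
      unfolding P.lv_def lv_def using rk_le[of u] that N by auto
  qed
  obtain n where n: "x = real n"
  proof -
    obtain E where "E \<in> lv 3" "E \<notin> Y" using ne Y_sub by blast
    then show ?thesis using adjacent[of E] that[of "card {E' \<in> Y. rk (meet E E') = 2}"] by simp
  qed
  have "lv 1 \<noteq> {}" using card_lv1 gn_pos[of N q] N by auto
  then obtain R where R: "R \<in> lv 1" by blast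
  obtain u where u: "up R = real u" by (simp add: up_def)
  have "real ((q + 1) * ((q + 1) * u)) = real ((q + 1) * ((q^2 + 1) * n))"
    using up_point[OF R] unfolding u n
    by (simp add: N gn_numerals power2_eq_square power3_eq_cube algebra_simps)
  then have "(q + 1) * u = (q^2 + 1) * n" using of_nat_eq_iff by (metis Suc_eq_plus1 nat.distinct(1) mult_left_cancel)
  \<comment> \<open>Modulo \<open>q + 1\<close> the number \<open>q^2 + 1\<close> is 2, so
    \<open>2 * x\<close> is a multiple of \<open>q + 1\<close>. An \<open>x\<close> below
    \<open>(q + 1)^2\<close> therefore stays below it by at least \<open>(q + 1) / 2\<close>, the
    margin that \<open>critical_False\<close> requires.\<close>
  then have "(q + 1) dvd (q^2 + 1) * n" by (metis dvd_triv_left)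
  moreover have "(q^2 + 1) * n = (q + 1) * ((q - 1) * n) + 2 * n"
    using q by (cases q) (auto simp: power2_eq_square algebra_simps)
  ultimately have "(q + 1) dvd (q + 1) * ((q - 1) * n) + 2 * n" by (simp only:)
  then have "(q + 1) dvd 2 * n" using dvd_add_right_iff dvd_triv_left by blast
  then obtain j where j: "2 * n = (q + 1) * j" by blast
  have "n < (q + 1)^2" using x unfolding n by (simp only: of_nat_less_iff)
  then have "(q + 1) * j < (q + 1) * (2 * (q + 1))"
    unfolding j[symmetric] by (simp add: power2_eq_square)
  then have "j < 2 * (q + 1)" by (simp only: mult_less_cancel1)
  then have "j \<le> 2 * q + 1" by simp
  then have "2 * n \<le> (q + 1) * (2 * q + 1)" unfolding j by (rule mult_left_mono) simp
  then have "real (2 * n) \<le> real ((q + 1) * (2 * q + 1))" by (simp only: of_nat_le_iff)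
  then have xle: "x \<le> (?r + 1)^2 - (?r + 1) / 2"
    by (simp add: n power2_eq_square field_simps)
  have D: "D = ?r^2 + ?r^3" unfolding D_def by (simp add: N gn_numerals)
  obtain E where E: "E \<in> Y" using ne by blast
  have sE: "(\<Sum>l\<in>{l \<in> lv 2. l \<preceq> E}. up l) = x + D" using sum_up_plane[OF Y_lv[OF E]] E by simp
  have le: "x + D \<le> gn q 3 * b" if "\<And>l. l \<in> lv 2 \<Longrightarrow> up l \<le> b" for b :: real
  proof -
    have "(\<Sum>l\<in>{l \<in> lv 2. l \<preceq> E}. up l) \<le> (\<Sum>l\<in>{l \<in> lv 2. l \<preceq> E}. b)"
      by (rule sum_mono) (use that in auto)
    then show ?thesis using sE cnt_lines_plane[OF Y_lv[OF E]] by simp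
  qed
  \<comment> \<open>The strict inequality lifts the largest weight \<open>M\<close> from
    \<open>q\<close> to \<open>q + 1\<close> below. Equality fails because \<open>q + 1\<close> does
    not divide \<open>2 * q\<close>.\<close>
  have xq: "?r < x"
  proof -
    have "?r * (?r * (?r + 1)) \<le> x * (?r * (?r + 1))"
      using le[OF up_le_x5[OF N x]] D by (simp add: gn_numerals power2_eq_square power3_eq_cube algebra_simps)
    then have "?r \<le> x" using q by (simp add: mult_le_cancel_right)
    moreover have "x \<noteq> ?r"
    proof
      assume "x = ?r"
      then have "2 * q = (q + 1) * j" using n j by simp
      moreover have "j = 0 \<or> j = 1 \<or> 2 \<le> j" by linarith
      moreover have "(q + 1) * 2 \<le> (q + 1) * j" if "2 \<le> j" using that by (intro mult_left_mono) auto
      ultimately show False using q by fastforce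
    qed
    ultimately show ?thesis by simp
  qed
  define S where "S = up ` lv 2 \<union> dn ` lv 4"
  have lv2: "lv 2 \<noteq> {}"
  proof
    assume "lv 2 = {}"
    then have "x + D \<le> 0" using le[of 0] by simp
    then show False using xq D q by (smt (verit) of_nat_0_le_iff zero_le_power)
  qed
  have fS: "finite S" "S \<noteq> {}" using lv2 by (auto simp: S_def)
  define M where "M = Max S"
  have Mup: "up l \<le> M" if "l \<in> lv 2" for l
    unfolding M_def by (rule Max_ge[OF fS(1)]) (use that in \<open>auto simp: S_def\<close>)
  have Mdn: "dn T \<le> M" if "T \<in> lv 4" for T
    unfolding M_def by (rule Max_ge[OF fS(1)]) (use that in \<open>auto simp: S_def\<close>)
  have MS: "M \<in> S" unfolding M_def by (rule Max_in[OF fS])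
  have M1: "?r + 1 \<le> M"
  proof -
    obtain k where k: "M = real k" using MS by (auto simp: S_def up_def dn_def)
    have "x + D \<le> gn q 3 * M" by (rule le[OF Mup])
    then have "\<not> M \<le> ?r"
      using xq D mult_left_mono[of M ?r "real (gn q 3)"]
      by (auto simp: gn_numerals power2_eq_square power3_eq_cube algebra_simps)
    then show ?thesis using k by simp
  qed
  have dnx: "dn T \<le> x" if "T \<in> lv 4" for T
  proof -
    have "P.up T \<le> x" by (rule P.up_le_x5[OF N x]) (use that Plv[of 2] in simp)
    then show ?thesis by (simp add: P.up_def dn_def)
  qed
  from MS consider l where "l \<in> lv 2" "M = up l" | T where "T \<in> lv 4" "M = dn T"
    by (auto simp: S_def)
  then show False
  proof cases
    case (2 T)
    interpret solid5 car le meet join rk q N Y x T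
      by unfold_locales (use N 2 in auto)
    have t: "t = M" by (simp add: t_def K_def 2(2) dn_def)
    show False
      by (rule maximal_solid_False) (use q xle M1 Mup dnx 2 in \<open>auto simp: t\<close>)
  next
    case (1 l)
    interpret Q: solid5 car "\<lambda>x y. y \<preceq> x" join meet "\<lambda>x. N - rk x" q N Y x l
      by unfold_locales (use N 1 Plv[of 4] in auto)
    have t: "Q.t = M" by (simp add: Q.t_def Q.K_def 1(2) up_def)
    show False
    proof (rule Q.maximal_solid_False)
      fix T assume "T \<in> {T \<in> P.lv 2. l \<preceq> T}"
      then have "T \<in> lv 4" using Plv[of 2] by simp
      then show "P.up T \<le> Q.t" using Mdn by (simp add: t P.up_def dn_def)
    qed (use q xle M1 up_le_x5[OF N x] 1 in \<open>auto simp: t\<close>)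
  qed
qed

end

section \<open>Dimension seven\<close>

locale intriguing8 = intriguing_geom +
  assumes N: "N = 8" and q13: "13 \<le> q" and xle: "x \<le> (q + 1) * gn q 3"
begin

abbreviation r :: real where "r \<equiv> real q"

text \<open>The value of \<open>x\<close> for the planes on the lines of a spread.\<close>

definition X :: real where "X = (r + 1) * (r^2 + r + 1)"

definition Y0 :: "'a set" where "Y0 = {E \<in> Y. \<not> (\<exists>l\<in>full. l \<preceq> E)}"

abbreviation w :: "'a \<Rightarrow> real" where "w \<equiv> thru Y0"

lemma x_le_X: "x \<le> X"
proof -
  have "real ((q + 1) * gn q 3) = X" by (simp add: X_def gn_numerals algebra_simps)
  then show ?thesis using xle by simp
qed

lemma D8: "D = r^2 * (r + 1) * (r^2 + 1)"
proof -
  have "D = r^2 + r^3 + r^4 + r^5" unfolding D_def by (simp add: N gn_numerals)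
  then show ?thesis by (simp add: eval_nat_numeral algebra_simps)
qed

lemma r13: "13 \<le> r"
  using q13 by simp

lemma powers: "13 * r \<le> r^2" "13 * r^2 \<le> r^3" "13 * r^3 \<le> r^4" "13 * r^4 \<le> r^5" "13 * r^5 \<le> r^6"
  "13 * r^6 \<le> r^7"
  using r13 mult_right_mono[of 13 r "r^k" for k]
  by (simp_all add: eval_nat_numeral mult_right_mono)

lemma X_pos: "0 < X"
  using r13 by (auto simp: X_def intro!: mult_pos_pos add_pos_pos)

lemma Y0_lv: "E \<in> Y0 \<Longrightarrow> E \<in> lv 3"
  using Y_lv by (simp add: Y0_def)

lemma finite_Y0 [simp]: "finite Y0"
  by (rule finite_subset[of _ Y]) (auto simp: Y0_def)

lemma w_le_up: "w l \<le> up l"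
  unfolding thru_def up_def by (simp, rule card_mono) (auto simp: Y0_def)

lemma w_full: "l \<in> full \<Longrightarrow> w l = 0"
proof -
  assume "l \<in> full"
  then have "{E \<in> Y0. l \<preceq> E} = {}" by (auto simp: Y0_def)
  then show ?thesis by (simp only: thru_def card.empty of_nat_0)
qed

lemma w_le_X: "l \<in> lv 2 \<Longrightarrow> w l \<le> X"
  using w_full[of l] up_le_x[of l] w_le_up[of l] x_le_X X_pos by (cases "l \<in> full") auto

text \<open>A plane of \<open>Y\<close> on \<open>l\<close> outside \<open>Y0\<close> contains a
  full line, which meets \<open>l\<close> in a point. Full lines are pairwise disjoint, so different
  planes give different points of \<open>l\<close>.\<close>

lemma few_full_planes:
  assumes l: "l \<in> lv 2" "l \<notin> full"
  shows "up l - w l \<le> r + 1"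
proof -
  define A where "A = {E \<in> Y. l \<preceq> E \<and> (\<exists>l'\<in>full. l' \<preceq> E)}"
  have "{E \<in> Y. l \<preceq> E} = {E \<in> Y0. l \<preceq> E} \<union> A" by (auto simp: Y0_def A_def)
  moreover have "{E \<in> Y0. l \<preceq> E} \<inter> A = {}" by (auto simp: Y0_def A_def)
  moreover have fA: "finite A" by (simp add: A_def)
  ultimately have eq: "up l = w l + card A"
    by (simp add: up_def thru_def card_Un_disjoint)
  define f where "f E = (SOME l'. l' \<in> full \<and> l' \<preceq> E)" for E
  have f: "f E \<in> full \<and> f E \<preceq> E" if "E \<in> A" for E
    unfolding f_def by (rule someI_ex) (use that in \<open>auto simp: A_def\<close>)
  have P: "meet l (f E) \<in> pt l \<and> meet l (f E) \<preceq> f E \<and> join l (f E) = E" if E: "E \<in> A" for E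
  proof -
    have lv: "f E \<in> lv 2" "E \<in> lv 3" "l \<preceq> E" "f E \<preceq> E" "l \<noteq> f E"
      using f[OF E] full_lv E Y_lv l by (auto simp: A_def)
    have c: "l \<in> car" "f E \<in> car" using lv l by (auto simp: lv_def)
    have "Suc (rk (meet l (f E))) = 2" using cover_rk_meet[OF l(1) lv(1,5,3,4)] lv(2) by simp
    then have "meet l (f E) \<in> lv 1" using lv_meet[OF l(1) lv(1)] by simp
    moreover have "join l (f E) = E" using cover_join[OF l(1) lv(1,5,3,4)] lv(2) by simp
    ultimately show ?thesis using meet_le1[OF c] meet_le2[OF c] by simp
  qed
  have xD: "x < D + 2 * (q + 1)"
  proof -
    have "X = r^3 + 2 * r^2 + 2 * r + 1"
      by (simp add: X_def power2_eq_square power3_eq_cube algebra_simps)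
    moreover have "D = r^2 + r^3 + r^4 + r^5" by (simp add: D8 eval_nat_numeral algebra_simps)
    ultimately have "X \<le> D" using powers r13 by linarith
    moreover have "(0::real) < 2 * (q + 1)" by simp
    ultimately show ?thesis using x_le_X by linarith
  qed
  have "inj_on (\<lambda>E. meet l (f E)) A"
  proof (rule inj_onI)
    fix E E' assume E: "E \<in> A" "E' \<in> A" "meet l (f E) = meet l (f E')"
    have "f E = f E'"
    proof (rule ccontr)
      assume ne: "f E \<noteq> f E'"
      note lv = full_lv[OF conjunct1[OF f[OF E(1)]]] full_lv[OF conjunct1[OF f[OF E(2)]]]
      let ?P = "meet l (f E)"
      have p: "?P \<preceq> f E" "?P \<preceq> f E'" "?P \<in> lv 1" using P[OF E(1)] P[OF E(2)] E(3) by auto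
      have "rk (join (f E) (f E')) = 3" using cover_rk_join[OF lv ne p] by simp
      then have J: "join (f E) (f E') \<in> lv 3" using lv_join lv by blast
      have "f E \<preceq> join (f E) (f E')" "f E' \<preceq> join (f E) (f E')"
        using join_ge1[OF lv_car[OF lv(1)] lv_car[OF lv(2)]]
          join_ge2[OF lv_car[OF lv(1)] lv_car[OF lv(2)]] by simp_all
      then show False using full_disjoint[OF xD _ _ _ _ J] f E(1,2) ne by blast
    qed
    then show "E = E'" using P E(1,2) by metis
  qed
  then have "card A \<le> card (pt l)"
    by (rule card_inj_on_le) (use P in auto)
  then show ?thesis using eq cnt_points_line[OF l(1)] by simp
qed

text \<open>Replacing \<open>up\<close> by \<open>w\<close> costs at most \<open>r + 1\<close> on
  each of the \<open>r^2 + r + 1\<close> lines of \<open>E\<close>, in total at most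
  \<open>X\<close>.\<close>

lemma w_plane_Y0:
  assumes E: "E \<in> Y0"
  shows "D - X \<le> (\<Sum>l\<in>ln E. w l)" "(\<Sum>l\<in>ln E. w l) \<le> D + X"
proof -
  have s: "(\<Sum>l\<in>ln E. up l) = x + D" using sum_up_plane[OF Y0_lv[OF E]] E by (simp add: Y0_def)
  have "(\<Sum>l\<in>ln E. w l) \<le> (\<Sum>l\<in>ln E. up l)" by (rule sum_mono) (rule w_le_up)
  then show "(\<Sum>l\<in>ln E. w l) \<le> D + X" using s x_le_X by simp
  have "(\<Sum>l\<in>ln E. up l) \<le> (\<Sum>l\<in>ln E. w l + (r + 1))"
    by (rule sum_mono) (use few_full_planes E in \<open>force simp: Y0_def\<close>)
  also have "\<dots> = (\<Sum>l\<in>ln E. w l) + X"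
    using cnt_lines_plane[OF Y0_lv[OF E]] by (simp add: sum.distrib X_def gn_numerals algebra_simps)
  finally show "D - X \<le> (\<Sum>l\<in>ln E. w l)" using s x_nonneg by simp
qed

text \<open>In a plane of \<open>Y\<close> with a full line, that line uses up
  \<open>gn q (N - 2) = D + q + 1\<close> of the total \<open>x + D\<close> and has no
  \<open>w\<close>-weight itself.\<close>

lemma w_plane:
  assumes E: "E \<in> lv 3" "E \<notin> Y0"
  shows "(\<Sum>l\<in>ln E. w l) \<le> X"
proof (cases "E \<in> Y")
  case False
  have "(\<Sum>l\<in>ln E. w l) \<le> (\<Sum>l\<in>ln E. up l)" by (rule sum_mono) (rule w_le_up)
  then show ?thesis using sum_up_plane[OF E(1)] False x_le_X by simp
next
  case True
  then obtain l0 where l0: "l0 \<in> full" "l0 \<preceq> E" using E by (auto simp: Y0_def)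
  then have l0E: "l0 \<in> ln E" using full_lv by blast
  have "(\<Sum>l\<in>ln E. w l) = w l0 + (\<Sum>l\<in>ln E - {l0}. w l)" using l0E by (intro sum.remove) auto
  also have "\<dots> \<le> (\<Sum>l\<in>ln E - {l0}. up l)"
    using w_full[OF l0(1)] by (simp add: sum_mono w_le_up)
  also have "\<dots> = x + D - gn q (N - 2)"
    using sum.remove[of "ln E" l0 up] l0E sum_up_plane[OF E(1)] True up_full[OF l0(1)] by simp
  also have "\<dots> \<le> X" using x_le_X by (simp add: D_def)
  finally show ?thesis .
qed

end

section \<open>Planes without full line inside one solid of PG(7,q)\<close>

locale solid8 = intriguing8 +
  fixes T :: 'a
  assumes T4: "T \<in> lv 4"
begin

definition K :: "'a set" where "K = {E \<in> Y0. E \<preceq> T}"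

sublocale solid car le meet join rk q N T K
  by unfold_locales (use T4 Y0_lv in \<open>auto simp: K_def\<close>)

sublocale C: solid car le meet join rk q N T "pl T - K"
  by (rule solid_compl)

definition t :: real where "t = real (card K)"
definition g :: real where "g = r^3 + r^2 + r + 1 - t"
abbreviation m :: "'a \<Rightarrow> real" where "m \<equiv> thru K"
abbreviation c :: "'a \<Rightarrow> real" where "c \<equiv> thru (pl T - K)"

lemma g_eq: "g = real (card (pl T - K))"
  using card_compl by (simp add: g_def t_def gn_numerals algebra_simps)

lemma g_nonneg: "0 \<le> g"
  by (simp add: g_eq)

lemma mc: "l \<in> ln T \<Longrightarrow> m l + c l = r + 1"
  using thru_compl[of l] by simp

lemma c_nat: "\<exists>n. c l = real n" and m_nat: "\<exists>n. m l = real n"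
  by (simp_all add: thru_def)

lemma quad: "0 \<le> thru A l * (thru A l - 1)"
proof -
  obtain n where "thru A l = real n" by (simp add: thru_def)
  then show ?thesis by (cases n) auto
qed

lemma sum_mw_ge: "t * (D - X) \<le> (\<Sum>l\<in>ln T. m l * w l)"
proof -
  have "(\<Sum>E\<in>K. D - X) \<le> (\<Sum>E\<in>K. \<Sum>l\<in>ln E. w l)"
    by (rule sum_mono) (use w_plane_Y0 in \<open>auto simp: K_def\<close>)
  then show ?thesis unfolding sum_thru_lines by (simp add: t_def)
qed

lemma sum_w_le: "(r + 1) * (\<Sum>l\<in>ln T. w l) \<le> t * D + (r^3 + r^2 + r + 1) * X"
proof -
  have "(r + 1) * (\<Sum>l\<in>ln T. w l) = (\<Sum>E\<in>pl T. \<Sum>l\<in>ln E. w l)"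
    using sum_planes_weight[of w] by (simp add: add.commute)
  also have "\<dots> \<le> (\<Sum>E\<in>pl T. X + (if E \<in> K then D else 0))"
    by (rule sum_mono) (use w_plane w_plane_Y0 in \<open>auto simp: K_def add.commute\<close>)
  also have "\<dots> = gn q 4 * X + t * D"
    using cnt_planes_solid[OF T4] K
    by (simp add: sum.distrib t_def sum.inter_restrict[symmetric] inf.absorb2)
  finally show ?thesis by (simp add: gn_numerals algebra_simps)
qed

lemma sum_m_pairs: "(\<Sum>l\<in>ln T. m l * (m l - 1)) = t * (t - 1)"
  using sum_thru_pairs by (simp add: t_def)

lemma sum_c_pairs: "(\<Sum>l\<in>ln T. c l * (c l - 1)) = g * (g - 1)"
  using C.sum_thru_pairs by (simp add: g_eq)

lemma sum_mc: "(\<Sum>l\<in>ln T. m l * c l) = t * g"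
proof -
  have "(\<Sum>E\<in>K. \<Sum>l\<in>ln E. c l) = (\<Sum>E\<in>K. g)"
    by (rule sum.cong) (use C.sum_thru_plane KD in \<open>auto simp: g_eq\<close>)
  then show ?thesis unfolding sum_thru_lines by (simp add: t_def)
qed

lemma m_le: "l \<in> ln T \<Longrightarrow> c l \<noteq> 0 \<Longrightarrow> m l \<le> r"
proof -
  assume l: "l \<in> ln T" "c l \<noteq> 0"
  obtain n where "c l = real n" using c_nat by blast
  then have "1 \<le> c l" using l by (cases n) auto
  then show ?thesis using mc[OF l(1)] by simp
qed

text \<open>The factor \<open>c l\<close> turns the sum into one over the planes of \<open>T\<close>
  outside \<open>K\<close>, each of \<open>w\<close>-weight at most \<open>X\<close>. On the lines
  of such a plane \<open>m l <= r\<close>, since the plane itself is one of the \<open>r + 1\<close>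
  planes of \<open>T\<close> on the line.\<close>

lemma sum_mcw_le: "(\<Sum>l\<in>ln T. m l * c l * w l) \<le> g * (r * X)"
proof -
  have "(\<Sum>l\<in>ln T. m l * c l * w l) = (\<Sum>l\<in>ln T. c l * (m l * w l))" by (simp add: mult_ac)
  also have "\<dots> = (\<Sum>E\<in>pl T - K. \<Sum>l\<in>ln E. m l * w l)" by (rule C.sum_thru_lines)
  also have "\<dots> \<le> (\<Sum>E\<in>pl T - K. r * X)"
  proof (rule sum_mono)
    fix E assume E: "E \<in> pl T - K"
    then have lv: "E \<in> lv 3" "E \<preceq> T" "E \<notin> Y0" by (auto simp: K_def)
    have "(\<Sum>l\<in>ln E. m l * w l) \<le> (\<Sum>l\<in>ln E. r * w l)"
    proof (rule sum_mono)
      fix l assume l: "l \<in> ln E"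
      have lT: "l \<in> ln T" using l lv lv_trans[of l E T 2 3 4] T4 by blast
      have "E \<in> {E \<in> pl T - K. l \<preceq> E}" using E l by blast
      then have "c l \<noteq> 0" by (auto simp: thru_def)
      then show "m l * w l \<le> r * w l" using m_le[OF lT] by (intro mult_right_mono) auto
    qed
    also have "\<dots> \<le> r * X" using w_plane[OF lv(1,3)] r13 by (simp flip: sum_distrib_left)
    finally show "(\<Sum>l\<in>ln E. m l * w l) \<le> r * X" .
  qed
  also have "\<dots> = g * (r * X)" by (simp add: g_eq)
  finally show ?thesis .
qed

text \<open>The inequality \<open>m - 1 <= m * (m - 1) / 2\<close> again, now with the bound
  \<open>X\<close> on all weights. It is used for \<open>t <= r^2\<close>.\<close>

lemma small_bound: "t * (D - X) - (\<Sum>l\<in>ln T. w l) \<le> X / 2 * (t * (t - 1))"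
proof -
  have "t * (D - X) - (\<Sum>l\<in>ln T. w l) \<le> (\<Sum>l\<in>ln T. m l * w l) - (\<Sum>l\<in>ln T. w l)"
    using sum_mw_ge by simp
  also have "\<dots> = (\<Sum>l\<in>ln T. (m l - 1) * w l)" by (simp add: sum_subtractf left_diff_distrib)
  also have "\<dots> \<le> (\<Sum>l\<in>ln T. X / 2 * (m l * (m l - 1)))"
  proof (rule sum_mono)
    fix l assume l: "l \<in> ln T"
    obtain n where n: "m l = real n" using m_nat by blast
    consider "n = 0" | "n = 1" | "2 \<le> n" by linarith
    then show "(m l - 1) * w l \<le> X / 2 * (m l * (m l - 1))"
    proof cases
      case 3
      have "(m l - 1) * w l \<le> (m l - 1) * X" using n 3 w_le_X l by (intro mult_left_mono) auto
      also have "\<dots> \<le> (m l - 1) * (X * (m l / 2))"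
        using n 3 X_pos mult_left_mono[of 1 "m l / 2" X] by (intro mult_left_mono) auto
      finally show ?thesis by (simp add: algebra_simps)
    qed (use n in auto)
  qed
  also have "\<dots> = X / 2 * (t * (t - 1))" unfolding sum_m_pairs[symmetric] sum_distrib_left ..
  finally show ?thesis .
qed

text \<open>On every line \<open>r = m l + c l - 1\<close>, which splits
  \<open>r * m l * w l\<close> into \<open>w l * m l * (m l - 1)\<close> and
  \<open>m l * c l * w l\<close>. Unlike in \<open>small_bound\<close>, nothing is lost on lines
  with \<open>m l = r + 1\<close> and \<open>w l = X\<close>.\<close>

lemma large_bound: "t * r * (D - X) \<le> X * (t * (t - 1)) + g * (r * X)"
proof -
  have "t * r * (D - X) = r * (t * (D - X))" by simp
  also have "\<dots> \<le> r * (\<Sum>l\<in>ln T. m l * w l)" using sum_mw_ge r13 by (intro mult_left_mono) auto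
  also have "\<dots> = (\<Sum>l\<in>ln T. w l * (m l * (m l - 1)) + m l * c l * w l)"
    unfolding sum_distrib_left
  proof (rule sum.cong, rule refl)
    fix l assume "l \<in> ln T"
    then have e: "r = m l + c l - 1" using mc by simp
    show "r * (m l * w l) = w l * (m l * (m l - 1)) + m l * c l * w l"
      by (subst e) (simp add: algebra_simps)
  qed
  also have "\<dots> = (\<Sum>l\<in>ln T. w l * (m l * (m l - 1))) + (\<Sum>l\<in>ln T. m l * c l * w l)"
    by (rule sum.distrib)
  also have "\<dots> \<le> (\<Sum>l\<in>ln T. X * (m l * (m l - 1))) + g * (r * X)"
    by (intro add_mono sum_mono mult_right_mono sum_mcw_le quad) (use w_le_X in auto)
  also have "\<dots> = X * (t * (t - 1)) + g * (r * X)"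
    unfolding sum_m_pairs[symmetric] sum_distrib_left ..
  finally show ?thesis .
qed

text \<open>Almost all lines of a plane of \<open>K\<close> have weight close to \<open>X\<close>, whereas the lines of the other
  planes have small total weight.  Uses \<open>c \<le> 2 + c * (c - 1) / 5\<close>.\<close>

lemma defect_bound:
  "X * (t * g - g * r) \<le> 2 * (t * ((r^2 + r + 1) * X - D + X)) + r * X / 5 * (g * (g - 1))"
proof -
  have "(\<Sum>l\<in>ln T. m l * c l * (X - w l)) = X * (t * g) - (\<Sum>l\<in>ln T. m l * c l * w l)"
    unfolding sum_mc[symmetric] sum_distrib_left sum_subtractf[symmetric]
    by (rule sum.cong) (auto simp: algebra_simps)
  then have "X * (t * g - g * r) \<le> (\<Sum>l\<in>ln T. m l * c l * (X - w l))"
    using sum_mcw_le by (simp add: algebra_simps)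
  also have "\<dots> \<le> (\<Sum>l\<in>ln T. 2 * (m l * (X - w l)) + r * X / 5 * (c l * (c l - 1)))"
  proof (rule sum_mono)
    fix l assume l: "l \<in> ln T"
    have w: "0 \<le> X - w l" "X - w l \<le> X" using w_le_X l by auto
    show "m l * c l * (X - w l) \<le> 2 * (m l * (X - w l)) + r * X / 5 * (c l * (c l - 1))"
    proof (cases "c l = 0")
      case True then show ?thesis using w by simp
    next
      case False
      have "0 \<le> (c l - 3)^2 + 1" by simp
      then have "c l \<le> 2 + c l * (c l - 1) / 5" by (simp add: power2_eq_square field_simps)
      moreover define A where "A = m l * (X - w l)"
      moreover define Q where "Q = c l * (c l - 1)"
      ultimately have "A * c l \<le> A * (2 + Q / 5)"
        using w by (intro mult_left_mono) auto
      moreover have "A * (Q / 5) \<le> r * X * (Q / 5)"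
        unfolding A_def Q_def using w m_le[OF l False] quad[of "pl T - K" l]
        by (intro mult_right_mono mult_mono) auto
      ultimately have "A * c l \<le> 2 * A + r * X / 5 * Q" by (simp add: distrib_left)
      then show ?thesis by (simp add: A_def Q_def mult_ac)
    qed
  qed
  also have "\<dots> = 2 * (\<Sum>l\<in>ln T. m l * (X - w l)) + r * X / 5 * (g * (g - 1))"
    unfolding sum_c_pairs[symmetric] sum_distrib_left sum.distrib[symmetric] ..
  also have "(\<Sum>l\<in>ln T. m l * (X - w l)) \<le> t * ((r^2 + r + 1) * X - D + X)"
  proof -
    have "(\<Sum>l\<in>ln T. m l * X) = t * (gn q 3 * X)"
      unfolding sum_thru_lines using KD cnt_lines_plane by (simp add: t_def)
    then show ?thesis using sum_mw_ge
      by (simp add: right_diff_distrib sum_subtractf gn_numerals algebra_simps)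
  qed
  finally show ?thesis by simp
qed

end

section \<open>Polynomial inequalities that exclude intermediate numbers of planes\<close>

lemma real_power_chain:
  fixes r :: real
  assumes "13 \<le> r"
  shows "13 * r \<le> r^2" "13 * r^2 \<le> r^3" "13 * r^3 \<le> r^4" "13 * r^4 \<le> r^5" "13 * r^5 \<le> r^6"
    "13 * r^6 \<le> r^7" "13 * r^7 \<le> r^8"
  using assms mult_right_mono[of 13 r "r^k" for k]
  by (simp_all add: eval_nat_numeral mult_right_mono)

text \<open>The right side is linear in \<open>t\<close>, and the convex \<open>t * (t - 1)\<close>
  on the left is replaced by its chord between \<open>2\<close> and \<open>r^2\<close>.\<close>

lemma small_gap:
  fixes r t :: real
  assumes r: "13 \<le> r" and t: "2 \<le> t" "t \<le> r^2"
  defines "X \<equiv> (r + 1) * (r^2 + r + 1)"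
  shows "X / 2 * (t * (t - 1)) < t * (r^3 * (r^2 + 1) - X) - (r^2 + 1) * X"
proof -
  note p = real_power_chain[OF r]
  define L where "L = r^3 * (r^2 + 1) - X"
  have "2 * L - (r^2 + 2) * X = r^5 - 2 * r^4 - 4 * r^3 - 9 * r^2 - 8 * r - 4"
    "2 * L - (r^2 + 1) * X = r^5 - 2 * r^4 - 3 * r^3 - 7 * r^2 - 6 * r - 3"
    unfolding L_def X_def by (simp_all add: eval_nat_numeral algebra_simps)
  then have L: "(r^2 + 2) * X < 2 * L" "(r^2 + 1) * X \<le> 2 * L" using p r by linarith+
  have X: "0 \<le> X" using r unfolding X_def by (intro mult_nonneg_nonneg) auto
  have "0 \<le> (t - 2) * (r^2 - t)" using t by simp
  then have "t * (t - 1) \<le> 2 + (t - 2) * (r^2 + 1)" by (simp add: algebra_simps)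
  then have "X / 2 * (t * (t - 1)) \<le> X / 2 * (2 + (t - 2) * (r^2 + 1))"
    using X by (intro mult_left_mono) auto
  also have "\<dots> = X + (t - 2) * ((r^2 + 1) * X) / 2" by (simp add: field_simps)
  also have "\<dots> \<le> X + (t - 2) * L"
    using mult_left_mono[OF L(2), of "t - 2"] t by simp
  also have "\<dots> < t * L - (r^2 + 1) * X"
    using L(1) by (simp add: algebra_simps)
  finally show ?thesis by (simp add: L_def)
qed

text \<open>The difference \<open>h\<close> of the two sides is quadratic with leading coefficient
  \<open>X\<close>, so it lies below its chord, and it is negative at both ends. The upper end
  \<open>b\<close> corresponds to \<open>2 * r^2 + 2 * r\<close> planes outside
  \<open>K\<close>.\<close>

lemma middle_gap:
  fixes r t :: real
  assumes r: "13 \<le> r" and t: "r^2 \<le> t" "t \<le> r^3 - r^2 - r + 1"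
  defines "X \<equiv> (r + 1) * (r^2 + r + 1)" and "D \<equiv> r^2 * (r + 1) * (r^2 + 1)"
  shows "X * (t * (t - 1)) + (r^3 + r^2 + r + 1 - t) * (r * X) < t * r * (D - X)"
proof -
  note p = real_power_chain[OF r]
  define h where "h t = X * (t * (t - 1)) + (r^3 + r^2 + r + 1 - t) * (r * X) - t * r * (D - X)" for t
  define b where "b = r^3 - r^2 - r + 1"
  have "h (r^2) = - (r^8) + r^7 + 4 * r^6 + 5 * r^5 + 5 * r^4 + 3 * r^3 + 2 * r^2 + r"
    unfolding h_def X_def D_def by (simp add: eval_nat_numeral algebra_simps)
  then have ha: "h (r^2) < 0" using p r by linarith
  have "h b = - (r^7) + r^6 + 8 * r^5 + 10 * r^4 + 5 * r^3 + r^2"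
    unfolding h_def X_def D_def b_def by (simp add: eval_nat_numeral algebra_simps)
  then have hb: "h b < 0" using p r by linarith
  have X: "0 \<le> X" using r unfolding X_def by (intro mult_nonneg_nonneg) auto
  have ab: "r^2 < b" unfolding b_def using p r by linarith
  have "(b - r^2) * h t = (b - t) * h (r^2) + (t - r^2) * h b - (b - r^2) * (X * ((t - r^2) * (b - t)))"
    unfolding h_def by (simp add: algebra_simps)
  moreover have "0 \<le> (b - r^2) * (X * ((t - r^2) * (b - t)))"
    using X ab t by (intro mult_nonneg_nonneg) (auto simp: b_def)
  moreover have "(b - t) * h (r^2) + (t - r^2) * h b < 0"
  proof (cases "t = b")
    case True then show ?thesis using hb ab by (simp add: mult_pos_neg)
  next
    case False
    then show ?thesis using ha hb t
      by (intro add_neg_nonpos mult_pos_neg mult_nonneg_nonpos) (auto simp: b_def)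
  qed
  ultimately have "(b - r^2) * h t < 0" by linarith
  then have "h t < 0" using ab by (simp add: mult_less_0_iff)
  then show ?thesis by (simp add: h_def)
qed

text \<open>Here \<open>h\<close> has leading coefficient \<open>- X * (1 + r / 5)\<close>, lies
  above its chord, and is positive at both ends.\<close>

lemma defect_gap:
  fixes r g :: real
  assumes r: "13 \<le> r" and g: "5 * r < g" "g \<le> 2 * r^2 + 2 * r"
  defines "X \<equiv> (r + 1) * (r^2 + r + 1)" and "D \<equiv> r^2 * (r + 1) * (r^2 + 1)"
    and "t \<equiv> r^3 + r^2 + r + 1 - g"
  shows "2 * (t * ((r^2 + r + 1) * X - D + X)) + r * X / 5 * (g * (g - 1)) < X * (t * g - g * r)"
proof -
  note p = real_power_chain[OF r]
  define h where "h g = X * ((r^3 + r^2 + r + 1 - g) * g - g * r)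
      - 2 * ((r^3 + r^2 + r + 1 - g) * ((r^2 + r + 1) * X - D + X)) - r * X / 5 * (g * (g - 1))" for g
  define b where "b = 2 * r^2 + 2 * r"
  have "5 * h (5 * r) = 5 * (r^7 - 4 * r^6 - 20 * r^5 - 24 * r^4 - 14 * r^3 + 10 * r^2 + 11 * r - 4)"
    unfolding h_def X_def D_def by (simp add: eval_nat_numeral field_simps)
  moreover have "0 < r^7 - 4 * r^6 - 20 * r^5 - 24 * r^4 - 14 * r^3 + 10 * r^2 + 11 * r - 4"
    using p r by linarith
  ultimately have ha: "0 < h (5 * r)" by simp
  have "5 * h b = 6 * r^8 - 16 * r^7 - 66 * r^6 - 72 * r^5 - 38 * r^4 + 12 * r^3 + 22 * r^2 - 20 * r - 20"
    unfolding h_def X_def D_def b_def by (simp add: eval_nat_numeral field_simps)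
  then have hb: "0 < h b" using p r by linarith
  have X: "0 \<le> X" using r unfolding X_def by (intro mult_nonneg_nonneg) auto
  have ab: "5 * r < b" unfolding b_def using p r by linarith
  have "(b - 5 * r) * h g = (b - g) * h (5 * r) + (g - 5 * r) * h b
      + (b - 5 * r) * (X * (1 + r / 5) * ((g - 5 * r) * (b - g)))"
    unfolding h_def by (simp add: field_simps)
  moreover have "0 \<le> (b - 5 * r) * (X * (1 + r / 5) * ((g - 5 * r) * (b - g)))"
    using X ab g r by (intro mult_nonneg_nonneg) (auto simp: b_def)
  moreover have "0 < (b - g) * h (5 * r) + (g - 5 * r) * h b"
    using ha hb g by (intro add_nonneg_pos mult_nonneg_nonneg mult_pos_pos) (auto simp: b_def)
  ultimately have "0 < (b - 5 * r) * h g" by linarith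
  then have "0 < h g" using ab by (simp add: zero_less_mult_iff)
  then show ?thesis by (simp add: h_def t_def)
qed

context solid8
begin

text \<open>The three estimates exclude adjacent ranges: \<open>t\<close> from 2 to
  \<open>r^2\<close>, then on until \<open>g\<close> has dropped to \<open>2 * r^2 + 2 * r\<close>,
  and finally \<open>g\<close> from there down to \<open>5 * r\<close>.\<close>

lemma dichotomy: "t \<le> 1 \<or> g \<le> 5 * r"
proof (rule ccontr)
  assume neg: "\<not> ?thesis"
  then have t: "2 \<le> t" by (auto simp: t_def)
  have "r^2 < t"
  proof (rule ccontr)
    assume "\<not> r^2 < t"
    then have s: "X / 2 * (t * (t - 1)) < t * (r^3 * (r^2 + 1) - X) - (r^2 + 1) * X"
      using small_gap[OF r13 t] by (simp add: X_def)
    have "(r + 1) * (t * (D - X) - (\<Sum>l\<in>ln T. w l)) \<ge> (r + 1) * (t * (r^3 * (r^2 + 1) - X) - (r^2 + 1) * X)"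
      using sum_w_le unfolding D8 by (simp add: eval_nat_numeral algebra_simps)
    then have "t * (r^3 * (r^2 + 1) - X) - (r^2 + 1) * X \<le> t * (D - X) - (\<Sum>l\<in>ln T. w l)"
      using r13 by (simp only: mult_le_cancel_left_pos[of "r + 1"])
    then show False using s small_bound by linarith
  qed
  then have "\<not> t \<le> r^3 - r^2 - r + 1"
    using middle_gap[OF r13, of t] large_bound by (auto simp: X_def D8 g_def)
  then have "g \<le> 2 * r^2 + 2 * r" by (simp add: g_def)
  then show False
    using defect_gap[OF r13, of g] defect_bound neg by (auto simp: X_def D8 g_def)
qed

end

section \<open>Heavy solids on a plane without full line\<close>

context intriguing8
begin

lemma solid8: "T \<in> lv 4 \<Longrightarrow> solid8 car le meet join rk q N Y x T"
  by unfold_locales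

definition K' :: "'a \<Rightarrow> 'a set" where "K' T = {E \<in> Y0. E \<preceq> T}"

text \<open>For \<open>E\<close> in \<open>Y0\<close> one of the two planes is \<open>E\<close>
  itself. By \<open>dichotomy\<close> one further plane already means that all but at most
  \<open>5 * r\<close> planes of the solid are in \<open>Y0\<close>.\<close>

definition heavy :: "'a \<Rightarrow> 'a set" where
  "heavy E = {T \<in> lv 4. E \<preceq> T \<and> 2 \<le> card (K' T)}"

lemma card_K'_le: "T \<in> lv 4 \<Longrightarrow> real (card (K' T)) \<le> r^3 + r^2 + r + 1"
proof -
  assume T: "T \<in> lv 4"
  interpret solid8 car le meet join rk q N Y x T by (rule solid8[OF T])
  show ?thesis using g_nonneg by (simp add: g_def t_def K_def K'_def)
qed

lemma card_K'_ge: "T \<in> lv 4 \<Longrightarrow> 2 \<le> card (K' T) \<Longrightarrow> r^3 + r^2 - 4 * r + 1 \<le> real (card (K' T))"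
proof -
  assume T0: "T \<in> lv 4" "2 \<le> card (K' T)"
  interpret solid8 car le meet join rk q N Y x T by (rule solid8[OF T0(1)])
  have "\<not> t \<le> 1" using T0(2) by (simp add: t_def K_def K'_def)
  then show ?thesis using dichotomy by (simp add: g_def t_def K_def K'_def)
qed

text \<open>Distinct planes lie in a common solid exactly if they meet in a line. So both sides
  count the neighbours of \<open>E\<close> in \<open>Y0\<close>, by solids and by lines; the
  subtracted \<open>gn q 3\<close> are the incidences of \<open>E\<close> with its own
  lines.\<close>

lemma sum_solids:
  assumes E: "E \<in> Y0"
  shows "(\<Sum>T\<in>{T \<in> lv 4. E \<preceq> T}. real (card (K' T)) - 1) = (\<Sum>l\<in>ln E. w l) - gn q 3"
proof -
  have E3: "E \<in> lv 3" using E Y0_lv by blast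
  have cu: "card {T \<in> lv 4. E \<preceq> T} = gn q 5" using cnt_up_all[of E 3] E3 N by (simp add: eval_nat_numeral)
  have "(\<Sum>T\<in>{T \<in> lv 4. E \<preceq> T}. real (card (K' T))) = (\<Sum>T\<in>{T \<in> lv 4. E \<preceq> T}. \<Sum>E'\<in>{E' \<in> Y0. E' \<preceq> T}. 1)"
    by (simp add: K'_def)
  also have "\<dots> = (\<Sum>E'\<in>Y0. real (card {T \<in> {T \<in> lv 4. E \<preceq> T}. E' \<preceq> T}) * 1)"
    by (rule sum_swap_card[where R = "\<lambda>T E'. E' \<preceq> T"]) simp_all
  also have "\<dots> = (\<Sum>E'\<in>Y0. (if rk (meet E E') = 2 then 1 else 0) + (if E' = E then real (gn q 5) else 0))"
  proof (rule sum.cong, rule refl)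
    fix E' assume "E' \<in> Y0"
    then have E': "E' \<in> lv 3" using Y0_lv by blast
    note mj = rk_meet_join[OF E3 E']
    consider "E' = E" | "E' \<noteq> E" "rk (meet E E') = 2" | "E' \<noteq> E" "rk (meet E E') < 2"
      using rk_meet_le[OF E3 E'] by fastforce
    then show "real (card {T \<in> {T \<in> lv 4. E \<preceq> T}. E' \<preceq> T}) * 1
        = (if rk (meet E E') = 2 then 1 else 0) + (if E' = E then real (gn q 5) else 0)"
    proof cases
      case 1
      have "meet E E = E"
        using rk_eqD[OF meet_greatest[of E E E]] rk_mono[OF meet_le1[of E E]] meet_le1[of E E] meet_in[of E E]
          lv_car[OF E3] by (metis le_refl rk_eqD rk_mono meet_greatest)
      then have "rk (meet E E) = 3" using E3 lv_rk by simp
      then show ?thesis using 1 cu by simp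
    next
      case 2
      then have "{T \<in> lv 4. E \<preceq> T \<and> E' \<preceq> T} = {join E E'}"
        by (intro common_join[OF E3 E']) (use mj in simp)
      then show ?thesis using 2 by (simp add: conj_assoc)
    next
      case 3
      have "{T \<in> {T \<in> lv 4. E \<preceq> T}. E' \<preceq> T} = {}"
      proof -
        have False if "T \<in> lv 4" "E \<preceq> T" "E' \<preceq> T" for T
        proof -
          have c: "E \<in> car" "E' \<in> car" "T \<in> car" using E3 E' that by (auto simp: lv_def)
          have "rk (join E E') \<le> rk T" using rk_mono[OF join_least[OF that(2,3) c]] join_in c by simp
          then show False using mj 3 that lv_rk[of T 4] by simp
        qed
        then show ?thesis by blast
      qed
      then have "card {T \<in> {T \<in> lv 4. E \<preceq> T}. E' \<preceq> T} = 0" by (simp only: card.empty)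
      then show ?thesis using 3 by simp
    qed
  qed
  also have "\<dots> = card {E' \<in> Y0. rk (meet E E') = 2} + real (gn q 5)"
    using E by (simp add: sum.distrib sum.inter_filter[symmetric])
  finally have 1: "(\<Sum>T\<in>{T \<in> lv 4. E \<preceq> T}. real (card (K' T))) = card {E' \<in> Y0. rk (meet E E') = 2} + real (gn q 5)" .
  have "{E' \<in> lv 3. rk (meet E E') = 2} \<inter> Y0 = {E' \<in> Y0. rk (meet E E') = 2}" using Y0_lv by blast
  moreover have "(\<Sum>E'\<in>{E' \<in> lv 3. rk (meet E E') = 2}. indicator Y0 E')
      = real (card ({E' \<in> lv 3. rk (meet E E') = 2} \<inter> Y0))"
    by (simp add: indicator_def sum.inter_restrict[symmetric] flip: sum.inter_filter)
  moreover have "lsum (indicator Y0) l = w l" for l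
  proof -
    have "{E \<in> lv 3. l \<preceq> E} \<inter> Y0 = {E \<in> Y0. l \<preceq> E}" using Y0_lv by blast
    then show ?thesis
      unfolding lsum_def thru_def
      by (simp add: indicator_def sum.inter_restrict[symmetric] flip: sum.inter_filter)
  qed
  ultimately have "(\<Sum>l\<in>ln E. w l) = gn q 3 + real (card {E' \<in> Y0. rk (meet E E') = 2})"
    using sum_lsum_plane[OF E3, of "indicator Y0"] E by simp
  then show ?thesis using 1 cu by (simp add: sum_subtractf)
qed

text \<open>The lines of \<open>E\<close> have total weight about \<open>r^5\<close> and a heavy
  solid contains about \<open>r^3\<close> planes of \<open>Y0\<close>, so there are about
  \<open>r^2\<close> heavy solids. The error terms are small enough to stay strictly between the
  numbers of points of a line and of a plane.\<close>

lemma heavy_card: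
  assumes E: "E \<in> Y0"
  shows "r + 1 < card (heavy E)" "card (heavy E) < r^2 + r + 1"
proof -
  let ?A = "{T \<in> lv 4. E \<preceq> T}"
  define h where "h = real (card (heavy E))"
  have one: "1 \<le> card (K' T)" if "T \<in> ?A" for T
  proof -
    have "E \<in> K' T" "finite (K' T)" using E that by (auto simp: K'_def)
    then show ?thesis by (metis One_nat_def Suc_leI card_gt_0_iff empty_iff)
  qed
  have "(\<Sum>T\<in>?A. real (card (K' T)) - 1) = (\<Sum>T\<in>heavy E. real (card (K' T)) - 1)"
  proof (rule sum.mono_neutral_right)
    show "\<forall>T\<in>?A - heavy E. real (card (K' T)) - 1 = 0"
    proof
      fix T assume "T \<in> ?A - heavy E"
      then show "real (card (K' T)) - 1 = 0" using one[of T] by (auto simp: heavy_def)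
    qed
  qed (auto simp: heavy_def)
  then have s: "(\<Sum>T\<in>heavy E. real (card (K' T)) - 1) = (\<Sum>l\<in>ln E. w l) - gn q 3"
    using sum_solids[OF E] by simp
  have "(\<Sum>T\<in>heavy E. real (card (K' T)) - 1) \<le> (\<Sum>T\<in>heavy E. r^3 + r^2 + r)"
    by (rule sum_mono) (use card_K'_le in \<open>force simp: heavy_def\<close>)
  then have up: "D - X - (r^2 + r + 1) \<le> h * (r^3 + r^2 + r)"
    using s w_plane_Y0(1)[OF E] by (simp add: h_def gn_numerals)
  have "(\<Sum>T\<in>heavy E. r^3 + r^2 - 4 * r) \<le> (\<Sum>T\<in>heavy E. real (card (K' T)) - 1)"
    by (rule sum_mono) (use card_K'_ge in \<open>force simp: heavy_def\<close>)
  then have lo: "h * (r^3 + r^2 - 4 * r) \<le> D + X - (r^2 + r + 1)"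
    using s w_plane_Y0(2)[OF E] by (simp add: h_def gn_numerals)
  note p = real_power_chain[OF r13]
  have eqs: "X = r^3 + 2 * r^2 + 2 * r + 1" "D = r^5 + r^4 + r^3 + r^2"
    by (simp_all add: X_def D8 eval_nat_numeral algebra_simps)
  have "r + 1 < h"
  proof (rule ccontr)
    assume "\<not> r + 1 < h"
    then have "h * (r^3 + r^2 + r) \<le> (r + 1) * (r^3 + r^2 + r)" using r13 by (intro mult_right_mono) auto
    also have "\<dots> = r^4 + 2 * r^3 + 2 * r^2 + r" by (simp add: eval_nat_numeral algebra_simps)
    finally show False using up p r13 unfolding eqs by linarith
  qed
  then show "r + 1 < card (heavy E)" by (simp add: h_def)
  have "h < r^2 + r + 1"
  proof (rule ccontr)
    assume "\<not> h < r^2 + r + 1"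
    then have "(r^2 + r + 1) * (r^3 + r^2 - 4 * r) \<le> h * (r^3 + r^2 - 4 * r)"
      using r13 p by (intro mult_right_mono) auto
    moreover have "(r^2 + r + 1) * (r^3 + r^2 - 4 * r) = r^5 + 2 * r^4 - 2 * r^3 - 3 * r^2 - 4 * r"
      by (simp add: eval_nat_numeral algebra_simps)
    ultimately show False using lo p r13 unfolding eqs by linarith
  qed
  then show "card (heavy E) < r^2 + r + 1" by (simp add: h_def)
qed

text \<open>Some line \<open>l\<close> of \<open>E\<close> lies only on planes of \<open>Y0\<close> in \<open>T1\<close> and \<open>T2\<close>. If \<open>T3\<close> is not heavy, it has
  a plane \<open>F\<close> on \<open>l\<close> outside \<open>Y0\<close>. The other solids on \<open>F\<close> in \<open>join T1 T2\<close> meet \<open>T1\<close> and \<open>T2\<close> in planes of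
  \<open>Y0\<close>, hence are heavy, and two of them give the lines of \<open>F\<close> too large a total weight.\<close>

lemma heavy_closed:
  assumes E: "E \<in> Y0" and T12: "T1 \<in> heavy E" "T2 \<in> heavy E" "T1 \<noteq> T2"
    and T3: "T3 \<in> lv 4" "E \<preceq> T3" "T3 \<preceq> join T1 T2"
  shows "T3 \<in> heavy E"
proof (rule ccontr)
  assume nh: "T3 \<notin> heavy E"
  have E3: "E \<in> lv 3" using E Y0_lv by blast
  have lv: "T1 \<in> lv 4" "T2 \<in> lv 4" "E \<preceq> T1" "E \<preceq> T2" using T12 by (auto simp: heavy_def)
  define H where "H = join T1 T2"
  have "rk H = 5" unfolding H_def using cover_rk_join[OF lv(1,2) T12(3) lv(3,4) E3] by simp
  then have H: "H \<in> lv 5" unfolding H_def using lv_join[OF lv(1,2)] by blast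
  have TH: "T1 \<preceq> H" "T2 \<preceq> H" "T3 \<preceq> H"
    unfolding H_def using join_ge1[OF lv_car[OF lv(1)] lv_car[OF lv(2)]]
      join_ge2[OF lv_car[OF lv(1)] lv_car[OF lv(2)]] T3 by simp_all
  have c: "(\<Sum>l\<in>ln E. thru (pl T - K' T) l) \<le> 5 * r" if T: "T \<in> heavy E" for T
  proof -
    have T4: "T \<in> lv 4" "E \<preceq> T" "2 \<le> card (K' T)" using T by (auto simp: heavy_def)
    interpret S: solid8 car le meet join rk q N Y x T by (rule solid8[OF T4(1)])
    have KK: "S.K = K' T" by (simp add: S.K_def K'_def)
    have "(\<Sum>l\<in>ln E. thru (pl T - K' T) l) = S.g"
      using S.C.sum_thru_plane[of E] E E3 T4 by (simp add: KK S.g_eq K'_def)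
    also have "\<dots> \<le> 5 * r" using card_K'_ge[OF T4(1,3)] by (simp add: S.g_def S.t_def KK)
    finally show ?thesis .
  qed
  \<comment> \<open>\<open>T1\<close> and \<open>T2\<close> each have at most \<open>5 * r\<close>
    planes outside \<open>Y0\<close>, and each of these planes meets \<open>E\<close> in one line.
    This spoils at most \<open>10 * r\<close> of the \<open>r^2 + r + 1\<close> lines of
    \<open>E\<close>.\<close>
  obtain l where l: "l \<in> ln E" "thru (pl T1 - K' T1) l + thru (pl T2 - K' T2) l < 1"
  proof -
    have "\<not> (\<forall>l\<in>ln E. 1 \<le> thru (pl T1 - K' T1) l + thru (pl T2 - K' T2) l)"
    proof
      assume a: "\<forall>l\<in>ln E. 1 \<le> thru (pl T1 - K' T1) l + thru (pl T2 - K' T2) l"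
      have "(\<Sum>l\<in>ln E. 1 :: real) \<le> (\<Sum>l\<in>ln E. thru (pl T1 - K' T1) l + thru (pl T2 - K' T2) l)"
        by (rule sum_mono) (use a in blast)
      also have "\<dots> \<le> 10 * r" using c[OF T12(1)] c[OF T12(2)] by (simp add: sum.distrib)
      finally show False
        using cnt_lines_plane[OF E3] real_power_chain(1)[OF r13] r13 by (simp add: gn_numerals)
    qed
    then obtain l where "l \<in> ln E" "\<not> 1 \<le> thru (pl T1 - K' T1) l + thru (pl T2 - K' T2) l" by blast
    then show ?thesis using that[of l] by simp
  qed
  have l2: "l \<in> lv 2" "l \<preceq> E" using l by auto
  have good: "F \<in> Y0" if "F \<in> lv 3" "l \<preceq> F" "F \<preceq> T" "T = T1 \<or> T = T2" for F T
  proof (rule ccontr)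
    assume "F \<notin> Y0"
    then have "F \<in> {F \<in> pl T - K' T. l \<preceq> F}" using that by (auto simp: K'_def)
    moreover have "finite {F \<in> pl T - K' T. l \<preceq> F}" by simp
    ultimately have "1 \<le> card {F \<in> pl T - K' T. l \<preceq> F}" by (metis One_nat_def Suc_leI card_gt_0_iff empty_iff)
    then have "1 \<le> thru (pl T - K' T) l" by (simp add: thru_def)
    moreover have "thru (pl T - K' T) l \<le> thru (pl T1 - K' T1) l + thru (pl T2 - K' T2) l"
      using that(4) by (elim disjE) simp_all
    ultimately show False using l(2) by linarith
  qed
  have "l \<preceq> T3" using lv_trans[OF l2(2) T3(2) l2(1) E3 T3(1)] .
  then have "card {F \<in> pl T3. l \<preceq> F} = q + 1" using cnt_planes_flag[OF l2(1) T3(1)] by simp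
  moreover have "E \<in> {F \<in> pl T3. l \<preceq> F}" using l2 E3 T3 by blast
  ultimately have "card ({F \<in> pl T3. l \<preceq> F} - {E}) = q" by (simp add: card_Diff_singleton)
  then have "{F \<in> pl T3. l \<preceq> F} - {E} \<noteq> {}" using q13 by (metis card.empty not_numeral_le_zero)
  then obtain F where F: "F \<in> lv 3" "F \<preceq> T3" "l \<preceq> F" "F \<noteq> E" by blast
  have FY: "F \<notin> Y0"
  proof
    assume "F \<in> Y0"
    then have "{E, F} \<subseteq> K' T3" using E F T3 by (auto simp: K'_def)
    moreover have "finite (K' T3)" by (simp add: K'_def)
    ultimately have "2 \<le> card (K' T3)" using F(4) card_mono[of "K' T3" "{E, F}"] by simp
    then show False using nh T3 by (simp add: heavy_def)
  qed
  have FH: "F \<preceq> H" using lv_trans[OF F(2) TH(3) F(1) T3(1) H] .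
  define Q where "Q = {S \<in> lv 4. F \<preceq> S \<and> S \<preceq> H}"
  have "card Q = q + 1" unfolding Q_def using cnt_up[OF FH F(1) H] by (simp add: eval_nat_numeral gn_Suc)
  then have "q \<le> card (Q - {T3})" using card_Diff1_le[of Q T3] by (simp add: card_Diff_singleton_if)
  then have "1 < card (Q - {T3})" using q13 by simp
  then obtain S1 S2 where S: "S1 \<in> Q - {T3}" "S2 \<in> Q - {T3}" "S1 \<noteq> S2"
    by (metis card_le_Suc0_iff_eq not_less One_nat_def card.infinite less_nat_zero_code)
  have many: "r^3 + r^2 - 4 * r + 1 \<le> real (card (K' S))" if S: "S \<in> Q - {T3}" for S
  proof -
    have S4: "S \<in> lv 4" "F \<preceq> S" "S \<preceq> H" "S \<noteq> T3" using S by (auto simp: Q_def)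
    have nE: "\<not> E \<preceq> S"
    proof
      assume "E \<preceq> S"
      then have "join E F = S" using cover_join[OF E3 F(1) F(4)[symmetric] _ S4(2)] S4(1) by simp
      moreover have "join E F = T3" using cover_join[OF E3 F(1) F(4)[symmetric] T3(2) F(2)] T3(1) by simp
      ultimately show False using S4(4) by simp
    qed
    have lS: "l \<preceq> S" using lv_trans[OF F(3) S4(2) l2(1) F(1) S4(1)] .
    have M: "meet S T \<in> Y0 \<and> meet S T \<preceq> S \<and> meet S T \<preceq> T \<and> meet S T \<in> lv 3"
      if T: "T = T1 \<or> T = T2" for T
    proof -
      have T4: "T \<in> lv 4" "E \<preceq> T" "T \<preceq> H" "S \<noteq> T" using T lv TH nE by auto
      have c: "S \<in> car" "T \<in> car" using S4 T4 lv_car by auto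
      have "Suc (rk (meet S T)) = 4" using cover_rk_meet[OF S4(1) T4(1,4) S4(3) T4(3)] H by simp
      then have m3: "meet S T \<in> lv 3" using lv_meet[OF S4(1) T4(1)] by simp
      have "l \<preceq> T" using lv_trans[OF l2(2) T4(2) l2(1) E3 T4(1)] .
      then have "l \<preceq> meet S T" using meet_greatest[OF lS _ c lv_car[OF l2(1)]] by simp
      then show ?thesis using good[OF m3 _ meet_le2[OF c] T] meet_le1[OF c] meet_le2[OF c] m3 by blast
    qed
    note M1 = M[of T1, simplified] and M2 = M[of T2, simplified]
    have ne: "meet S T1 \<noteq> meet S T2"
    proof
      assume eq: "meet S T1 = meet S T2"
      have "meet T1 T2 = E" using cover_meet[OF lv(1,2) T12(3) lv(3,4) E3] by simp
      moreover have "meet S T1 \<preceq> meet T1 T2"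
      proof (rule meet_greatest)
        show "meet S T1 \<in> car" by (rule lv_car[of _ 3]) (use M1 in blast)
      qed (use M1 M2 eq lv_car[OF lv(1)] lv_car[OF lv(2)] in auto)
      ultimately have "meet S T1 = E" using lv_eqI M1 E3 by metis
      then show False using M1 nE by simp
    qed
    have "{meet S T1, meet S T2} \<subseteq> K' S" using M1 M2 by (auto simp: K'_def)
    moreover have "finite (K' S)" by (simp add: K'_def)
    ultimately have "2 \<le> card (K' S)" using ne card_mono[of "K' S" "{meet S T1, meet S T2}"] by simp
    then show ?thesis by (rule card_K'_ge[OF S4(1)])
  qed
  have sumF: "(\<Sum>l\<in>ln F. thru (K' S) l) = real (card (K' S))" if S: "S \<in> Q - {T3}" for S
  proof -
    have S4: "S \<in> lv 4" "F \<preceq> S" using S by (auto simp: Q_def)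
    interpret A: solid8 car le meet join rk q N Y x S by (rule solid8[OF S4(1)])
    show ?thesis using A.sum_thru_plane[of F] F S4 FY by (simp add: A.K_def K'_def)
  qed
  have disj: "K' S1 \<inter> K' S2 = {}"
  proof (rule ccontr)
    assume "K' S1 \<inter> K' S2 \<noteq> {}"
    then obtain G where G: "G \<in> Y0" "G \<preceq> S1" "G \<preceq> S2" by (auto simp: K'_def)
    have "F \<noteq> G" using G FY by auto
    then have "join F G = S1" "join F G = S2"
      using cover_join[OF F(1) Y0_lv[OF G(1)]] G S by (auto simp: Q_def)
    then show False using S(3) by simp
  qed
  have "thru (K' S1) l + thru (K' S2) l \<le> w l" for l
  proof -
    have "card {E \<in> K' S1. l \<preceq> E} + card {E \<in> K' S2. l \<preceq> E}
        = card ({E \<in> K' S1. l \<preceq> E} \<union> {E \<in> K' S2. l \<preceq> E})"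
      by (rule card_Un_disjoint[symmetric]) (use disj in \<open>auto simp: K'_def\<close>)
    also have "\<dots> \<le> card {E \<in> Y0. l \<preceq> E}"
      by (rule card_mono) (auto simp: K'_def)
    finally show ?thesis by (simp add: thru_def flip: of_nat_add)
  qed
  then have "(\<Sum>l\<in>ln F. thru (K' S1) l + thru (K' S2) l) \<le> (\<Sum>l\<in>ln F. w l)"
    by (rule sum_mono)
  then have "real (card (K' S1)) + real (card (K' S2)) \<le> X"
    using w_plane[OF F(1) FY] sumF[OF S(1)] sumF[OF S(2)] by (simp add: sum.distrib)
  moreover have "X = r^3 + 2 * r^2 + 2 * r + 1"
    by (simp add: X_def eval_nat_numeral algebra_simps)
  ultimately show False
    using many[OF S(1)] many[OF S(2)] real_power_chain(1,2)[OF r13] r13 by linarith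
qed

text \<open>In the quotient by \<open>E\<close> the heavy solids are points, and the line through
  any two of them consists of heavy solids. A heavy \<open>R\<close> off the line of
  \<open>T1\<close> and \<open>T2\<close> exists by the lower bound of \<open>heavy_card\<close>.
  Its joins with the \<open>q + 1\<close> points of that line share only \<open>R\<close>, which
  gives \<open>(q + 1) * q + 1\<close> heavy solids, too many for the upper bound.\<close>

lemma Y0_empty: "Y0 = {}"
proof (rule ccontr)
  assume "Y0 \<noteq> {}"
  then obtain E where E: "E \<in> Y0" by blast
  have E3: "E \<in> lv 3" using E Y0_lv by blast
  have fin: "finite (heavy E)" by (simp add: heavy_def)
  have big: "q + 1 < card (heavy E)" using heavy_card(1)[OF E] by linarith
  then have "1 < card (heavy E)" by simp
  then obtain T1 T2 where T: "T1 \<in> heavy E" "T2 \<in> heavy E" "T1 \<noteq> T2"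
    by (metis card_le_Suc0_iff_eq fin not_less One_nat_def)
  define line where "line S T = {U \<in> lv 4. E \<preceq> U \<and> U \<preceq> join S T}" for S T
  have basic: "S \<in> lv 4 \<and> E \<preceq> S" if "S \<in> heavy E" for S using that by (simp add: heavy_def)
  have J: "join S T \<in> lv 5 \<and> S \<in> line S T \<and> T \<in> line S T" if "S \<in> heavy E" "T \<in> heavy E" "S \<noteq> T" for S T
  proof -
    have b: "S \<in> lv 4" "T \<in> lv 4" "E \<preceq> S" "E \<preceq> T"
      using basic[OF that(1)] basic[OF that(2)] by blast+
    have "rk (join S T) = 5"
      using cover_rk_join[OF b(1,2) that(3) b(3,4) E3] by simp
    moreover have "S \<in> car" "T \<in> car" using basic[OF that(1)] basic[OF that(2)] by (auto simp: lv_def)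
    ultimately show ?thesis
      using lv_join[of S 4 T 4] join_ge1[of S T] join_ge2[of S T] basic[OF that(1)] basic[OF that(2)]
      by (simp add: line_def)
  qed
  have cl: "card (line S T) = q + 1" if "S \<in> heavy E" "T \<in> heavy E" "S \<noteq> T" for S T
  proof -
    have "join S T \<in> lv 5" "E \<preceq> join S T"
      using J[OF that] basic[OF that(1)] lv_trans[of E S "join S T" 3 4 5] E3 by (auto simp: line_def)
    then show ?thesis unfolding line_def using cnt_up[of E "join S T" 3 5] E3
      by (simp add: eval_nat_numeral gn_Suc)
  qed
  have sub: "line S T \<subseteq> heavy E" if "S \<in> heavy E" "T \<in> heavy E" "S \<noteq> T" for S T
    using heavy_closed[OF E that] by (auto simp: line_def)
  have "\<not> heavy E \<subseteq> line T1 T2"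
  proof
    assume "heavy E \<subseteq> line T1 T2"
    then have "card (heavy E) \<le> card (line T1 T2)" by (rule card_mono[rotated]) (simp add: line_def)
    then show False using cl[OF T] big by simp
  qed
  then obtain R where R: "R \<in> heavy E" "R \<notin> line T1 T2" by blast
  have on: "T \<in> heavy E \<and> T \<noteq> R" if "T \<in> line T1 T2" for T using that sub[OF T] R by blast
  have join_eq: "join S T = H" if "S \<in> line A B" "T \<in> line A B" "S \<noteq> T" "A \<in> heavy E" "B \<in> heavy E" "A \<noteq> B"
    "H = join A B" for A B S T H
    using cover_join[of S 4 T H] J[OF that(4-6)] that by (auto simp: line_def)
  define U where "U = (\<Union>T\<in>line T1 T2. line R T - {R})"
  have fl: "finite (line S T)" for S T by (simp add: line_def)
  have "card U = (\<Sum>T\<in>line T1 T2. card (line R T - {R}))"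
    unfolding U_def
  proof (rule card_UN_disjoint)
    show "\<forall>S\<in>line T1 T2. \<forall>T\<in>line T1 T2. S \<noteq> T \<longrightarrow> (line R S - {R}) \<inter> (line R T - {R}) = {}"
    proof (intro ballI impI, rule ccontr)
      fix S S' assume SS: "S \<in> line T1 T2" "S' \<in> line T1 T2" "S \<noteq> S'"
        "(line R S - {R}) \<inter> (line R S' - {R}) \<noteq> {}"
      then obtain V where V: "V \<in> line R S" "V \<in> line R S'" "V \<noteq> R" by blast
      have h: "S \<in> heavy E" "S' \<in> heavy E" "R \<noteq> S" "R \<noteq> S'" using on SS by metis+
      have "join R V = join R S" "join R V = join R S'"
        using join_eq[OF _ V(1) V(3)[symmetric] R(1) h(1,3) refl] J[OF R(1) h(1,3)]
          join_eq[OF _ V(2) V(3)[symmetric] R(1) h(2,4) refl] J[OF R(1) h(2,4)] by blast+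
      then have eq: "join R S = join R S'" by simp
      have "S \<in> line R S" "S' \<in> line R S" "R \<in> line R S"
        using J[OF R(1) h(1,3)] J[OF R(1) h(2,4)] eq by (auto simp: line_def)
      moreover have "join S S' = join T1 T2" using join_eq[OF SS(1-3) T refl] .
      moreover have "join S S' = join R S"
        using join_eq[OF calculation(1,2) SS(3) R(1) h(1,3) refl] .
      ultimately have "R \<in> line T1 T2" by (simp add: line_def)
      then show False using R(2) by simp
    qed
  qed (use fl in auto)
  also have "\<dots> = (\<Sum>T\<in>line T1 T2. q)"
  proof (rule sum.cong, rule refl)
    fix S assume "S \<in> line T1 T2"
    then have h: "S \<in> heavy E" "R \<noteq> S" using on by metis+
    show "card (line R S - {R}) = q" using cl[OF R(1) h] J[OF R(1) h] fl by (simp add: card_Diff_singleton)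
  qed
  also have "\<dots> = (q + 1) * q" using cl[OF T] by simp
  finally have cU: "card U = (q + 1) * q" .
  have "insert R U \<subseteq> heavy E" using R sub on unfolding U_def by blast
  then have "card (insert R U) \<le> card (heavy E)" using fin by (intro card_mono) auto
  moreover have "card (insert R U) = (q + 1) * q + 1"
    using cU fl by (subst card_insert_disjoint) (auto simp: U_def)
  ultimately have "real ((q + 1) * q + 1) \<le> card (heavy E)" by (simp only: of_nat_le_iff)
  then show False using heavy_card(2)[OF E] by (simp add: power2_eq_square algebra_simps)
qed

lemma full_line_N8: "E \<in> Y \<Longrightarrow> \<exists>l\<in>full. l \<preceq> E"
  using Y0_empty by (auto simp: Y0_def)

end

section \<open>Subspaces of a vector space over a finite field\<close>

lemma card_span_insert:
  fixes v :: "'k::{finite,field} ^ 'm::finite"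
  assumes "v \<notin> vec.span S"
  shows "card (vec.span (insert v S)) = CARD('k) * card (vec.span S)"
proof -
  have "bij_betw (\<lambda>(c, w). c *s v + w) (UNIV \<times> vec.span S) (vec.span (insert v S))"
  proof (rule bij_betwI')
    fix a b :: "'k \<times> ('k ^ 'm)" assume a: "a \<in> UNIV \<times> vec.span S" and b: "b \<in> UNIV \<times> vec.span S"
    obtain c w where aw: "a = (c, w)" by (cases a)
    obtain d u where bu: "b = (d, u)" by (cases b)
    have "c = d" if "c *s v + w = d *s v + u"
    proof (rule ccontr)
      assume "c \<noteq> d"
      have "(c - d) *s v = u - w" using that by (simp add: vec.scale_left_diff_distrib algebra_simps)
      then have "(c - d) *s v \<in> vec.span S" using a b aw bu by (auto intro: vec.span_diff)
      then have "inverse (c - d) *s ((c - d) *s v) \<in> vec.span S" by (rule vec.span_scale)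
      moreover have "inverse (c - d) *s ((c - d) *s v) = v"
        unfolding vector_smult_assoc using \<open>c \<noteq> d\<close> by (subst left_inverse) auto
      ultimately show False using assms by simp
    qed
    then show "((case a of (c, w) \<Rightarrow> c *s v + w) = (case b of (c, w) \<Rightarrow> c *s v + w)) = (a = b)"
      using aw bu by auto
  next
    fix a :: "'k \<times> ('k ^ 'm)" assume a: "a \<in> UNIV \<times> vec.span S"
    obtain c w where aw: "a = (c, w)" by (cases a)
    show "(case a of (c, w) \<Rightarrow> c *s v + w) \<in> vec.span (insert v S)"
      using a unfolding aw by (auto simp: vec.span_breakdown_eq intro!: exI[of _ c])
  next
    fix y assume "y \<in> vec.span (insert v S)"
    then obtain c where "y - c *s v \<in> vec.span S" by (auto simp: vec.span_breakdown_eq)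
    then show "\<exists>a\<in>UNIV \<times> vec.span S. y = (case a of (c, w) \<Rightarrow> c *s v + w)"
      by (intro bexI[of _ "(c, y - c *s v)"]) auto
  qed
  then have "card (UNIV \<times> vec.span S :: ('k \<times> _) set) = card (vec.span (insert v S))"
    by (rule bij_betw_same_card)
  then show ?thesis by (simp add: card_cartesian_product)
qed

lemma card_subspace:
  fixes U :: "('k::{finite,field} ^ 'm::finite) set"
  assumes "vec.subspace U"
  shows "card U = CARD('k) ^ vec.dim U"
proof -
  obtain B where B: "B \<subseteq> U" "vec.independent B" "U \<subseteq> vec.span B" "card B = vec.dim U"
    using vec.basis_exists by blast
  have "finite B" by simp
  then have "card (vec.span B) = CARD('k) ^ card B"
    using B(2)
  proof (induction B rule: finite_induct)
    case (insert v F)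
    then have "v \<notin> vec.span F" "vec.independent F" by (auto simp: vec.independent_insert)
    then show ?case using insert card_span_insert[of v F] by simp
  qed simp
  moreover have "vec.span B = U" using B assms by (metis vec.span_subspace)
  ultimately show ?thesis using B by simp
qed

lemma mult_gn: "(q - 1) * gn q m = q ^ m - 1" if "2 \<le> q"
proof (induction m)
  case (Suc m)
  have "1 \<le> q ^ m" using that by simp
  moreover have "q = Suc (q - 1)" using that by simp
  ultimately show ?case using Suc by (simp add: gn_Suc' distrib_left) (metis (no_types, lifting)
    add.commute add_diff_assoc mult_Suc)
qed simp

text \<open>The sets \<open>U - X\<close> partition \<open>Z - X\<close>, because a vector outside
  \<open>X\<close> spans exactly one such \<open>U\<close> with \<open>X\<close>. All of them have
  the same size, and the powers of \<open>CARD('k)\<close> cancel.\<close>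

lemma count_covers:
  fixes X Z :: "('k::{finite,field} ^ 'm::finite) set"
  assumes X: "vec.subspace X" and Z: "vec.subspace Z" and XZ: "X \<subseteq> Z"
  shows "card {U. vec.subspace U \<and> X \<subseteq> U \<and> U \<subseteq> Z \<and> vec.dim U = Suc (vec.dim X)}
    = gn CARD('k) (vec.dim Z - vec.dim X)"
proof -
  let ?C = "{U. vec.subspace U \<and> X \<subseteq> U \<and> U \<subseteq> Z \<and> vec.dim U = Suc (vec.dim X)}"
  let ?q = "CARD('k)" and ?d = "vec.dim X" and ?e = "vec.dim Z"
  have "card {0, 1 :: 'k} \<le> card (UNIV :: 'k set)" by (intro card_mono) auto
  then have q2: "2 \<le> ?q" by simp
  have de: "?d \<le> ?e" using XZ by (rule vec.dim_subset)
  have cov: "(\<Union>U\<in>?C. U - X) = Z - X"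
  proof
    show "(\<Union>U\<in>?C. U - X) \<subseteq> Z - X" by blast
    show "Z - X \<subseteq> (\<Union>U\<in>?C. U - X)"
    proof
      fix v assume v: "v \<in> Z - X"
      have "vec.span X = X" using X by (simp add: vec.span_eq_iff)
      then have "vec.dim (vec.span (insert v X)) = Suc ?d"
        using v by (simp add: vec.dim_insert del: vec.span_eq_iff)
      moreover have "vec.span (insert v X) \<subseteq> Z" using v Z XZ by (intro vec.span_minimal) auto
      ultimately have "vec.span (insert v X) \<in> ?C" using vec.span_superset[of "insert v X"] by auto
      then show "v \<in> (\<Union>U\<in>?C. U - X)" using v vec.span_superset[of "insert v X"] by blast
    qed
  qed
  have disj: "(U - X) \<inter> (W - X) = {}" if "U \<in> ?C" "W \<in> ?C" "U \<noteq> W" for U W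
  proof (rule ccontr)
    assume "(U - X) \<inter> (W - X) \<noteq> {}"
    then obtain v where v: "v \<in> U" "v \<in> W" "v \<notin> X" by blast
    have "vec.span X = X" using X by (simp add: vec.span_eq_iff)
    then have d: "vec.dim (vec.span (insert v X)) = Suc ?d"
      using v by (simp add: vec.dim_insert del: vec.span_eq_iff)
    have eq: "vec.span (insert v X) = T" if "T \<in> ?C" "v \<in> T" for T
    proof (rule vec.subspace_dim_equal)
      show "vec.span (insert v X) \<subseteq> T" using that by (intro vec.span_minimal) auto
    qed (use that d in auto)
    show False using eq[OF that(1) v(1)] eq[OF that(2) v(2)] that(3) by simp
  qed
  have "card (\<Union>U\<in>?C. U - X) = (\<Sum>U\<in>?C. card (U - X))"
    by (rule card_UN_disjoint) (use disj in simp_all)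
  also have "\<dots> = (\<Sum>U\<in>?C. ?q ^ Suc ?d - ?q ^ ?d)"
  proof (rule sum.cong)
    fix U assume "U \<in> ?C"
    then show "card (U - X) = ?q ^ Suc ?d - ?q ^ ?d"
      using card_subspace[of U] card_subspace[OF X] card_Diff_subset[of X U] by auto
  qed simp
  also have "\<dots> = card ?C * ((?q - 1) * ?q ^ ?d)" by (simp only: sum_constant of_nat_id diff_mult_distrib power_Suc mult_1)
  finally have "card ?C * ((?q - 1) * ?q ^ ?d) = card (Z - X)" using cov by simp
  also have "\<dots> = ?q ^ ?e - ?q ^ ?d"
    using card_subspace[OF Z] card_subspace[OF X] XZ card_Diff_subset[of X Z] by simp
  also have "\<dots> = (?q ^ (?e - ?d) - 1) * ?q ^ ?d"
    using de by (simp add: diff_mult_distrib flip: power_add)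
  also have "\<dots> = gn ?q (?e - ?d) * ((?q - 1) * ?q ^ ?d)"
    by (simp only: mult_gn[OF q2, symmetric] mult_ac)
  finally show ?thesis using q2 by simp
qed

lemma proj_geom_subspaces:
  "proj_geom {U :: ('k::{finite,field} ^ 'm::finite) set. vec.subspace U} (\<subseteq>) (\<inter>)
    (\<lambda>U W. vec.span (U \<union> W)) vec.dim CARD('k) CARD('m)"
proof (rule rank_geom.proj_geom, unfold_locales)
  have "card {0, 1 :: 'k} \<le> card (UNIV :: 'k set)" by (intro card_mono) auto
  then show "2 \<le> CARD('k)" by simp
next
  fix X Y :: "('k ^ 'm) set" assume XY: "X \<in> {U. vec.subspace U}" "Y \<in> {U. vec.subspace U}"
  then have "vec.span X = X" "vec.span Y = Y" by (simp_all add: vec.span_eq_iff)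
  then have "vec.span (X \<union> Y) = {x + y |x y. x \<in> X \<and> y \<in> Y}" by (simp add: vec.span_Un del: vec.span_eq_iff)
  then show "vec.dim (X \<inter> Y) + vec.dim (vec.span (X \<union> Y)) = vec.dim X + vec.dim Y"
    using vec.dim_sums_Int[of X Y] XY by (simp del: vec.dim_span)
next
  fix X Y :: "('k ^ 'm) set"
  assume "X \<subseteq> Y" "X \<noteq> Y" "X \<in> {U. vec.subspace U}" "Y \<in> {U. vec.subspace U}"
  then show "vec.dim X < vec.dim Y"
    using vec.subspace_dim_equal[of X Y] vec.dim_subset[of X Y] by (metis (full_types) linorder_le_less_linear mem_Collect_eq)
next
  fix X :: "('k ^ 'm) set"
  show "vec.dim X \<le> CARD('m)" by (rule dim_subset_UNIV_cart_gen)
next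
  show "\<exists>b\<in>{U :: ('k ^ 'm) set. vec.subspace U}. vec.dim b = 0"
    by (intro bexI[of _ "{0}"]) auto
  show "\<exists>b\<in>{U :: ('k ^ 'm) set. vec.subspace U}. vec.dim b = CARD('m)"
    by (intro bexI[of _ UNIV]) (auto simp: vec_dim_card simp del: vec.dim_UNIV)
next
  fix X Z :: "('k ^ 'm) set"
  assume "X \<subseteq> Z" "X \<in> {U. vec.subspace U}" "Z \<in> {U. vec.subspace U}"
  then show "card {U \<in> {U. vec.subspace U}. X \<subseteq> U \<and> U \<subseteq> Z \<and> vec.dim U = Suc (vec.dim X)}
    = gn CARD('k) (vec.dim Z - vec.dim X)"
    using count_covers[of X Z] by simp
next
  fix X Y Z :: "('k ^ 'm) set"
  assume "X \<subseteq> Z" "Y \<subseteq> Z" "Z \<in> {U. vec.subspace U}"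
  then show "vec.span (X \<union> Y) \<subseteq> Z" by (intro vec.span_minimal) auto
next
  fix X Y :: "('k ^ 'm) set"
  show "X \<subseteq> vec.span (X \<union> Y)" "Y \<subseteq> vec.span (X \<union> Y)"
    using vec.span_superset[of "X \<union> Y"] by auto
qed (auto intro: vec.subspace_inter)

section \<open>Intriguing sets that are not tight\<close>

locale plane_graph = proj_geom +
  fixes adj :: "'a \<Rightarrow> 'a \<Rightarrow> bool"
  assumes adj_iff: "\<lbrakk>E \<in> lv 3; E' \<in> lv 3\<rbrakk> \<Longrightarrow> adj E E' \<longleftrightarrow> rk (meet E E') = 2"
begin

text \<open>The three values are written in the form in which \<open>spectrum_cases\<close> produces
  them.\<close>

definition \<theta>\<^sub>1 :: real where "\<theta>\<^sub>1 = real (gn q (N - 2)) - (q + 1) - gn q 3 - 1 + gn q (N - 1)"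
definition \<theta>\<^sub>2 :: real where "\<theta>\<^sub>2 = real (gn q (N - 2)) - (q + 1) - gn q 3"
definition \<theta>\<^sub>3 :: real where "\<theta>\<^sub>3 = - real (gn q 3)"
definition valency :: nat where "valency = gn q 3 * (gn q (N - 2) - 1)"

lemma nbrs_planes: "E \<in> lv 3 \<Longrightarrow> nbrs (lv 3) adj E = {E' \<in> lv 3. rk (meet E E') = 2}"
  using adj_iff by (auto simp: nbrs_def)

lemma real_valency: "6 \<le> N \<Longrightarrow> real valency = gn q 3 * (real (gn q (N - 2)) - 1)"
  using gn_pos[of "N - 2" q] unfolding valency_def by (simp add: of_nat_diff)

lemma theta_order:
  assumes "6 \<le> N"
  shows "\<theta>\<^sub>3 < \<theta>\<^sub>2" "\<theta>\<^sub>2 < \<theta>\<^sub>1" "\<theta>\<^sub>1 < valency"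
proof -
  have g4: "gn q 4 \<le> gn q (N - 2)" and "gn q 4 \<le> gn q (N - 1)" by (rule gn_mono, use assms in simp)+
  have "q + 1 < gn q 4" "1 < gn q 4" using q2 by (simp_all add: gn_numerals)
  then show "\<theta>\<^sub>3 < \<theta>\<^sub>2" "\<theta>\<^sub>2 < \<theta>\<^sub>1" using g4 \<open>gn q 4 \<le> gn q (N - 1)\<close>
    by (simp_all add: \<theta>\<^sub>1_def \<theta>\<^sub>2_def \<theta>\<^sub>3_def)
  have "N - 1 = Suc (N - 2)" using assms by simp
  then have "gn q (N - 1) = 1 + q * gn q (N - 2)" by (simp add: gn_Suc)
  then have g1: "real (gn q (N - 1)) = 1 + q * gn q (N - 2)" by simp
  have "0 \<le> real q ^ 2 * gn q (N - 2)" by simp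
  then show "\<theta>\<^sub>1 < valency"
    unfolding real_valency[OF assms] \<theta>\<^sub>1_def g1
    by (simp only: gn_numerals of_nat_add of_nat_power of_nat_mult of_nat_1 algebra_simps)
qed

lemma card_nbrs:
  assumes "6 \<le> N" "E \<in> lv 3"
  shows "card (nbrs (lv 3) adj E) = valency"
proof -
  have "lsum (\<lambda>_. 1) l = gn q (N - 2)" if "l \<in> lv 2" for l
    using cnt_planes_line[OF that] by (simp add: lsum_def)
  then have "real (gn q 3) * gn q (N - 2) = gn q 3 + card (nbrs (lv 3) adj E)"
    using sum_lsum_plane[OF assms(2), of "\<lambda>_. 1"] cnt_lines_plane[OF assms(2)] nbrs_planes[OF assms(2)]
    by simp
  then have "real (card (nbrs (lv 3) adj E)) = valency"
    using real_valency[OF assms(1)] by (simp add: algebra_simps)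
  then show ?thesis by simp
qed

lemma planes_nonempty: "3 \<le> N \<Longrightarrow> lv 3 \<noteq> {}"
proof -
  assume N: "3 \<le> N"
  have ex: "S \<noteq> {}" if "card S = gn q m" "0 < m" for S :: "'a set" and m
    using that gn_pos[of m q] by (metis card.empty less_irrefl)
  have "lv 1 \<noteq> {}" using ex[OF card_lv1] N by simp
  then obtain P where P: "P \<in> lv 1" by blast
  have "{l \<in> lv 2. P \<preceq> l} \<noteq> {}" using ex[OF cnt_lines_point[OF P]] N by simp
  then obtain l where l: "l \<in> lv 2" by blast
  have "{E \<in> lv 3. l \<preceq> E} \<noteq> {}" using ex[OF cnt_planes_line[OF l]] N by simp
  then show ?thesis by blast
qed

lemma has_valency_iff: "6 \<le> N \<Longrightarrow> has_valency (lv 3) adj k \<longleftrightarrow> k = valency"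
  using card_nbrs planes_nonempty unfolding has_valency_def by auto

lemma nontrivial_eigenvalue_iff:
  "6 \<le> N \<Longrightarrow> nontrivial_eigenvalue (lv 3) adj \<theta> \<longleftrightarrow> graph_eigenvalue (lv 3) adj \<theta> \<and> \<theta> \<noteq> valency"
  by (auto simp: nontrivial_eigenvalue_def has_valency_iff)

lemma nontrivial_eigenvalue_cases:
  assumes N: "6 \<le> N" and \<theta>: "nontrivial_eigenvalue (lv 3) adj \<theta>"
  shows "\<theta> = \<theta>\<^sub>1 \<or> \<theta> = \<theta>\<^sub>2 \<or> \<theta> = \<theta>\<^sub>3"
proof (rule ccontr)
  assume *: "\<not> ?thesis"
  obtain f where f: "\<exists>E\<in>lv 3. f E \<noteq> 0"
      and eig: "\<And>E. E \<in> lv 3 \<Longrightarrow> (\<Sum>E'\<in>nbrs (lv 3) adj E. f E') = \<theta> * f E"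
    using \<theta> N by (auto simp: nontrivial_eigenvalue_iff graph_eigenvalue_def)
  have "\<exists>b. \<forall>E\<in>lv 3. f E = b"
    using spectrum_cases[of f \<theta> 0] eig nbrs_planes N * unfolding \<theta>\<^sub>1_def \<theta>\<^sub>2_def \<theta>\<^sub>3_def by auto
  then obtain b where b: "\<And>E. E \<in> lv 3 \<Longrightarrow> f E = b" by blast
  obtain E where E: "E \<in> lv 3" "f E \<noteq> 0" using f by blast
  have "(\<Sum>E'\<in>nbrs (lv 3) adj E. f E') = valency * b"
    using card_nbrs[OF N E(1)] b by (simp add: nbrs_def)
  then show False using eig[OF E(1)] b[OF E(1)] E \<theta> N by (simp add: nontrivial_eigenvalue_iff)
qed

text \<open>The indicator function minus the constant \<open>c = x / (valency - \<theta>)\<close> is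
  an eigenvector. The division needs \<open>\<theta> < valency\<close>; this follows from
  \<open>spectrum_cases\<close> for the indicator function itself, before \<open>\<theta>\<close> is
  known to be an eigenvalue.\<close>

lemma intriguing_eigenvalue:
  assumes N: "6 \<le> N" and Y: "Y \<subseteq> lv 3" "Y \<noteq> {}" "Y \<noteq> lv 3"
    and p: "intriguing_params (lv 3) adj Y x x'"
  shows "nontrivial_eigenvalue (lv 3) adj (real_of_int (x' - x))"
proof -
  let ?\<theta> = "real_of_int (x' - x)" and ?\<chi> = "\<lambda>E. if E \<in> Y then 1 else 0 :: real"
  obtain E\<^sub>1 E\<^sub>0 where E: "E\<^sub>1 \<in> Y" "E\<^sub>0 \<in> lv 3" "E\<^sub>0 \<notin> Y" using Y by blast
  have nonconst: "\<not> (\<forall>E\<in>lv 3. ?\<chi> E = b)" for b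
  proof
    assume "\<forall>E\<in>lv 3. ?\<chi> E = b"
    then have "?\<chi> E\<^sub>1 = b" "?\<chi> E\<^sub>0 = b" using E Y(1) by blast+
    then show False using E by simp
  qed
  have chi: "(\<Sum>E'\<in>nbrs (lv 3) adj E. ?\<chi> E') = ?\<theta> * ?\<chi> E + x" if "E \<in> lv 3" for E
  proof -
    have "finite (nbrs (lv 3) adj E)" by (simp add: nbrs_def)
    then have sum: "(\<Sum>E'\<in>nbrs (lv 3) adj E. ?\<chi> E') = card (nbrs (lv 3) adj E \<inter> Y)"
      by (simp add: sum.If_cases)
    have "int (card (nbrs (lv 3) adj E \<inter> Y)) = (if E \<in> Y then x' else x)"
      using p that by (simp add: intriguing_params_def)
    from arg_cong[OF this, of real_of_int]
    have "real (card (nbrs (lv 3) adj E \<inter> Y)) = (if E \<in> Y then x' else x)" by simp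
    then show ?thesis by (simp add: sum)
  qed
  have "?\<theta> = \<theta>\<^sub>1 \<or> ?\<theta> = \<theta>\<^sub>2 \<or> ?\<theta> = \<theta>\<^sub>3"
    using spectrum_cases[of ?\<chi> ?\<theta> x] chi nbrs_planes N nonconst
    unfolding \<theta>\<^sub>1_def \<theta>\<^sub>2_def \<theta>\<^sub>3_def by auto
  then have less: "?\<theta> < valency" using theta_order[OF N] by linarith
  define c where "c = x / (valency - ?\<theta>)"
  have c: "x - valency * c = - ?\<theta> * c" using less by (simp add: c_def field_simps)
  have "(\<Sum>E'\<in>nbrs (lv 3) adj E. ?\<chi> E' - c) = ?\<theta> * (?\<chi> E - c)" if "E \<in> lv 3" for E
  proof -
    have "(\<Sum>E'\<in>nbrs (lv 3) adj E. ?\<chi> E' - c) = ?\<theta> * ?\<chi> E + (x - valency * c)"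
      by (simp only: sum_subtractf chi[OF that] sum_constant card_nbrs[OF N that])
    then show ?thesis by (simp only: c) (simp add: algebra_simps)
  qed
  moreover have "\<exists>E\<in>lv 3. ?\<chi> E - c \<noteq> 0" using nonconst[of c] by auto
  ultimately have "graph_eigenvalue (lv 3) adj ?\<theta>" unfolding graph_eigenvalue_def by (intro exI[of _ "\<lambda>E. ?\<chi> E - c"]) blast
  then show ?thesis using less N by (simp add: nontrivial_eigenvalue_iff)
qed

text \<open>All non-trivial eigenvalues are among the three candidates, so a difference equal to the
  largest or the smallest candidate would be extreme and \<open>Y\<close> tight. Only the middle one
  remains.\<close>

lemma not_tight_params:
  assumes N: "6 \<le> N" and Y: "nontrivial_intriguing (lv 3) adj Y" and nt: "\<not> tight (lv 3) adj Y"
  obtains x where "intriguing_geom car le meet join rk q N Y x"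
proof -
  obtain x x' where Y': "Y \<subseteq> lv 3" "Y \<noteq> {}" "Y \<noteq> lv 3" and p: "intriguing_params (lv 3) adj Y x x'"
    using Y unfolding nontrivial_intriguing_def intriguing_def by blast
  note ev = intriguing_eigenvalue[OF N Y' p]
  have "real_of_int (x' - x) \<noteq> \<theta>\<^sub>1" "real_of_int (x' - x) \<noteq> \<theta>\<^sub>3"
    using nt ev p Y nontrivial_eigenvalue_cases[OF N] theta_order(1,2)[OF N]
    unfolding tight_def by fastforce+
  then have \<theta>: "real_of_int x' = x + \<theta>\<^sub>2" using nontrivial_eigenvalue_cases[OF N ev] by simp
  have "intriguing_geom car le meet join rk q N Y x"
  proof unfold_locales
    fix E assume E: "E \<in> lv 3"
    have "nbrs (lv 3) adj E \<inter> Y = {E' \<in> Y. rk (meet E E') = 2}"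
      using nbrs_planes[OF E] Y'(1) by blast
    moreover have "int (card (nbrs (lv 3) adj E \<inter> Y)) = (if E \<in> Y then x' else x)"
      using p E by (simp add: intriguing_params_def)
    ultimately have "int (card {E' \<in> Y. rk (meet E E') = 2}) = (if E \<in> Y then x' else x)"
      by simp
    from arg_cong[OF this, of real_of_int]
    have "real (card {E' \<in> Y. rk (meet E E') = 2}) = (if E \<in> Y then x' else x)" by simp
    then show "real (card {E' \<in> Y. rk (meet E E') = 2}) =
      real_of_int x + (if E \<in> Y then real (gn q (N - 2)) - (q + 1) - gn q 3 else 0)"
      using \<theta> by (simp add: \<theta>\<^sub>2_def)
  qed (use Y' N in auto)
  then show ?thesis by (rule that)
qed

text \<open>If \<open>x\<close> is at most the spread value \<open>?x0\<close>, the full lines form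
  a spread and \<open>x = ?x0\<close>. Hence \<open>x\<close> is never smaller, and since
  \<open>card_Y\<close> makes the size proportional to \<open>x\<close>, equality of sizes leads
  back to the spread.\<close>

lemma spread_threshold:
  assumes N: "10 \<le> N \<or> N = 8 \<and> 13 \<le> q"
    and Y: "nontrivial_intriguing (lv 3) adj Y" "\<not> tight (lv 3) adj Y"
  shows "real (gn q N * gn q (N - 2)) \<le> (q + 1) * real (card Y)"
    and "(q + 1) * real (card Y) = gn q N * gn q (N - 2) \<Longrightarrow>
      \<exists>S\<subseteq>lv 2. (\<forall>P\<in>lv 1. \<exists>!l. l \<in> S \<and> P \<preceq> l) \<and> Y = {E \<in> lv 3. \<exists>l\<in>S. l \<preceq> E}"
proof -
  have N6: "6 \<le> N" using N by auto
  obtain x where "intriguing_geom car le meet join rk q N Y x"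
    using not_tight_params[OF N6 Y] .
  then interpret I: intriguing_geom car le meet join rk q N Y x .
  let ?x0 = "real ((q + 1) * gn q 3)"
  have ne: "Y \<noteq> {}" using Y(1) by (simp add: nontrivial_intriguing_def)
  have full: "\<exists>l\<in>I.full. l \<preceq> E" if x: "x \<le> ?x0" and "E \<in> Y" for E
  proof (cases "10 \<le> N")
    case True
    then show ?thesis by (rule I.full_line_large_N) (use x \<open>E \<in> Y\<close> in simp_all)
  next
    case False
    then interpret J: intriguing8 car le meet join rk q N Y x
      using N x by unfold_locales auto
    show ?thesis using J.full_line_N8 that by simp
  qed
  have "gn q 6 \<le> gn q (N - 2)" using N by (intro gn_mono) auto
  then have D: "real (gn q 6) - (q + 1) \<le> I.D" by (simp add: I.D_def)
  have "real q ^ 2 \<le> real q ^ 4" using q2 by (intro power_increasing) auto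
  moreover have "0 < real q ^ 5" using q2 by simp
  ultimately have "?x0 < real (gn q 6) - (q + 1) + 2 * (q + 1)"
    by (simp add: gn_numerals algebra_simps power_numeral_reduce)
  with D have x0: "?x0 < I.D + 2 * (q + 1)" by linarith
  have spread: "(\<forall>P\<in>lv 1. \<exists>!l. l \<in> I.full \<and> P \<preceq> l) \<and> Y = {E \<in> lv 3. \<exists>l\<in>I.full. l \<preceq> E} \<and> x = ?x0"
    if "x \<le> ?x0"
    using I.spread_of_full[OF _ full[OF that] ne] that x0 by auto
  then have ge: "?x0 \<le> x" by linarith
  define A G Q where "A = real (gn q N * gn q (N - 2))" and "G = real (gn q 3)" and "Q = real (q + 1)"
  have pos: "0 < G" "0 < Q" "0 < A"
    using gn_pos[of 3 q] gn_pos[of N q] gn_pos[of "N - 2" q] N6 by (simp_all add: A_def G_def Q_def)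
  have x0': "?x0 = Q * G" by (simp only: Q_def G_def of_nat_mult)
  have card: "(G * Q) * (Q * card Y) = A * x"
    using I.card_Y by (simp add: A_def G_def Q_def power2_eq_square algebra_simps)
  have "A * (Q * G) \<le> A * x" using ge pos(3) unfolding x0' by (intro mult_left_mono) auto
  then have "(G * Q) * A \<le> (G * Q) * (Q * card Y)" unfolding card by (simp only: mult_ac)
  then have "A \<le> Q * card Y" by (rule mult_left_le_imp_le) (simp add: pos)
  then show "real (gn q N * gn q (N - 2)) \<le> (q + 1) * real (card Y)"
    by (simp only: A_def Q_def)
  assume "(q + 1) * real (card Y) = gn q N * gn q (N - 2)"
  then have "Q * card Y = A" by (simp only: A_def Q_def)
  then have "A * x = A * (Q * G)" using card by (simp only: mult_ac)
  then have "x = ?x0" using pos(3) x0' by simp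
  then show "\<exists>S\<subseteq>lv 2. (\<forall>P\<in>lv 1. \<exists>!l. l \<in> S \<and> P \<preceq> l) \<and> Y = {E \<in> lv 3. \<exists>l\<in>S. l \<preceq> E}"
    using spread I.full_lv by (intro exI[of _ I.full]) auto
qed

lemma polar_threshold:
  assumes N: "N = 6" and q: "25 \<le> q"
    and Y: "nontrivial_intriguing (lv 3) adj Y" "\<not> tight (lv 3) adj Y"
  shows "(q + 1) * (q ^ 2 + 1) * (q ^ 3 + 1) \<le> card Y"
proof -
  have N6: "6 \<le> N" using N by auto
  obtain x where "intriguing_geom car le meet join rk q N Y x"
    using not_tight_params[OF N6 Y] .
  then interpret I: intriguing_geom car le meet join rk q N Y x .
  have x: "(real q + 1)^2 \<le> x"
    using I.five_bound N q Y(1) by (auto simp: nontrivial_intriguing_def add.commute)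
  have pos: "0 < real (gn q 3) * (real q + 1)^2" using gn_pos[of 3 q] by simp
  have "real (gn q 6) * gn q 4 * (real q + 1)^2 \<le> real (gn q 6) * gn q 4 * x"
    using x by (intro mult_left_mono) auto
  also have "\<dots> = (real (gn q 3) * (real q + 1)^2) * card Y"
    using I.card_Y N by (simp add: add.commute)
  also have "real (gn q 6) * gn q 4 = gn q 3 * real ((q + 1) * (q ^ 2 + 1) * (q ^ 3 + 1))"
    by (simp add: gn_numerals algebra_simps power_numeral_reduce)
  finally have "(real (gn q 3) * (real q + 1)^2) * real ((q + 1) * (q ^ 2 + 1) * (q ^ 3 + 1))
      \<le> (real (gn q 3) * (real q + 1)^2) * real (card Y)"
    by (simp only: mult_ac)
  then have "real ((q + 1) * (q ^ 2 + 1) * (q ^ 3 + 1)) \<le> real (card Y)"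
    by (rule mult_left_le_imp_le) (rule pos)
  then show ?thesis by (simp only: of_nat_le_iff)
qed

end

text \<open>Gaussian elimination: an equation without non-zero coefficient is dropped, any other is
  solved for one unknown, which is substituted into the remaining equations. Both ways there stay
  more unknowns than equations.\<close>

lemma homogeneous_system_solvable:
  fixes M :: "'b \<Rightarrow> 'a \<Rightarrow> real"
  assumes "finite B" "finite A" "card B < card A"
  shows "\<exists>f. (\<exists>a\<in>A. f a \<noteq> 0) \<and> (\<forall>b\<in>B. (\<Sum>a\<in>A. M b a * f a) = 0)"
  using assms
proof (induction B arbitrary: A M rule: finite_induct)
  case empty
  then have "A \<noteq> {}" by auto
  then show ?case by (intro exI[of _ "\<lambda>_. 1"]) auto
next
  case (insert b B)
  show ?case
  proof (cases "\<forall>a\<in>A. M b a = 0")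
    case True
    have "card B < card A" using insert by simp
    from insert.IH[OF insert.prems(1) this, of M] show ?thesis using True by auto
  next
    case False
    then obtain a\<^sub>0 where a0: "a\<^sub>0 \<in> A" "M b a\<^sub>0 \<noteq> 0" by blast
    let ?A = "A - {a\<^sub>0}" and ?M = "\<lambda>b' a. M b' a - M b' a\<^sub>0 * M b a / M b a\<^sub>0"
    have "finite ?A" "card B < card ?A" using insert a0 by auto
    from insert.IH[OF this, of ?M] obtain f where f: "\<exists>a\<in>?A. f a \<noteq> 0"
      and eq: "\<And>b'. b' \<in> B \<Longrightarrow> (\<Sum>a\<in>?A. ?M b' a * f a) = 0" by blast
    let ?s = "- (\<Sum>a\<in>?A. M b a * f a) / M b a\<^sub>0"
    let ?g = "f(a\<^sub>0 := ?s)"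
    have split: "(\<Sum>a\<in>A. M b' a * ?g a) = M b' a\<^sub>0 * ?s + (\<Sum>a\<in>?A. M b' a * f a)" for b'
      using sum.remove[OF insert.prems(1) a0(1), of "\<lambda>a. M b' a * ?g a"] by simp
    have "(\<Sum>a\<in>A. M b' a * ?g a) = 0" if "b' \<in> insert b B" for b'
    proof (cases "b' = b")
      case True
      then show ?thesis using split[of b] a0(2) by simp
    next
      case False
      then have "(\<Sum>a\<in>?A. ?M b' a * f a) = 0" using eq that by blast
      then have "(\<Sum>a\<in>?A. M b' a * f a) - M b' a\<^sub>0 / M b a\<^sub>0 * (\<Sum>a\<in>?A. M b a * f a) = 0"
        by (simp add: left_diff_distrib sum_subtractf sum_distrib_left mult.assoc)
      then show ?thesis unfolding split by simp
    qed
    moreover have "\<exists>a\<in>A. ?g a \<noteq> 0" using f by auto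
    ultimately show ?thesis by (intro exI[of _ ?g]) blast
  qed
qed

section \<open>The extreme eigenvalues occur\<close>

context plane_graph
begin

text \<open>To find the parameters of a set of planes it suffices to count its planes on each line;
  used for the planes on a point and for the totally isotropic planes.\<close>

lemma card_nbrs_via_lines:
  assumes "E \<in> lv 3" "Y \<subseteq> lv 3"
  shows "(\<Sum>l\<in>{l \<in> lv 2. l \<preceq> E}. real (card {E' \<in> Y. l \<preceq> E'})) =
    real (gn q 3) * (if E \<in> Y then 1 else 0) + card (nbrs (lv 3) adj E \<inter> Y)"
proof -
  let ?f = "\<lambda>E. if E \<in> Y then 1 else 0 :: real"
  have "lsum ?f l = card {E' \<in> Y. l \<preceq> E'}" for l
  proof -
    have "{E \<in> lv 3. l \<preceq> E} \<inter> {E. E \<in> Y} = {E' \<in> Y. l \<preceq> E'}" using assms(2) by blast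
    then show ?thesis by (simp add: lsum_def sum.If_cases)
  qed
  moreover have "(\<Sum>E'\<in>nbrs (lv 3) adj E. ?f E') = card (nbrs (lv 3) adj E \<inter> Y)"
    by (simp add: nbrs_def sum.If_cases)
  ultimately show ?thesis
    using sum_lsum_plane[OF assms(1), of ?f] nbrs_planes[OF assms(1)] by simp
qed

text \<open>A line on \<open>P\<close> lies on \<open>?g\<close> planes of \<open>?Y\<close>, any
  other line only on its join with \<open>P\<close>. The resulting difference of parameters is in
  fact \<open>\<theta>\<^sub>1\<close>, but exceeding \<open>\<theta>\<^sub>2\<close> is enough to
  show that \<open>\<theta>\<^sub>2\<close> is not the largest.\<close>

lemma eigenvalue_above:
  assumes N: "6 \<le> N"
  shows "\<exists>\<theta>. nontrivial_eigenvalue (lv 3) adj \<theta> \<and> \<theta>\<^sub>2 < \<theta>"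
proof -
  have "0 < card (lv (Suc 0))" using gn_pos[of N q] N card_lv1 by simp
  then obtain P where P: "P \<in> lv 1" by (auto simp: card_gt_0_iff)
  let ?Y = "{E \<in> lv 3. P \<preceq> E}"
  let ?g = "gn q (N - 2)"
  have g: "gn q 4 \<le> ?g" using N by (intro gn_mono) simp
  have up: "card {E' \<in> ?Y. l \<preceq> E'} = (if P \<preceq> l then ?g else 1)" if l: "l \<in> lv 2" for l
  proof (cases "P \<preceq> l")
    case True
    then have "{E' \<in> ?Y. l \<preceq> E'} = {E' \<in> lv 3. l \<preceq> E'}" using lv_trans[OF _ _ P l] by blast
    then show ?thesis using True cnt_planes_line[OF l] by simp
  next
    case False
    have "{E' \<in> lv 3. P \<preceq> E' \<and> l \<preceq> E'} = {join P l}"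
      using common_join[of P 1 l 2 3] point_join_rk[of P l 2] False P l by simp
    moreover have "{E' \<in> ?Y. l \<preceq> E'} = {E' \<in> lv 3. P \<preceq> E' \<and> l \<preceq> E'}" by blast
    ultimately show ?thesis using False by simp
  qed
  have deg: "int (card (nbrs (lv 3) adj E \<inter> ?Y)) = (if E \<in> ?Y then (q + 1) * (int ?g - 1) else gn q 3)"
    if E: "E \<in> lv 3" for E
  proof -
    let ?L = "{l \<in> lv 2. l \<preceq> E}"
    have "(\<Sum>l\<in>?L. real (card {E' \<in> ?Y. l \<preceq> E'})) = (\<Sum>l\<in>?L. 1 + (if P \<preceq> l then real ?g - 1 else 0))"
      by (rule sum.cong) (use up in auto)
    also have "\<dots> = gn q 3 + card {l \<in> ?L. P \<preceq> l} * (real ?g - 1)"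
      using cnt_lines_plane[OF E] by (simp add: sum.distrib sum.If_cases Int_def)
    finally have *: "real (gn q 3) * (if E \<in> ?Y then 1 else 0) + card (nbrs (lv 3) adj E \<inter> ?Y)
      = gn q 3 + card {l \<in> ?L. P \<preceq> l} * (real ?g - 1)"
      using card_nbrs_via_lines[OF E, of ?Y] by auto
    show ?thesis
    proof (cases "P \<preceq> E")
      case True
      have "{l \<in> ?L. P \<preceq> l} = {l \<in> lv 2. P \<preceq> l \<and> l \<preceq> E}" by blast
      then have "card {l \<in> ?L. P \<preceq> l} = q + 1" using cnt_lines_flag[OF P E True] by simp
      then have "real_of_int (int (card (nbrs (lv 3) adj E \<inter> ?Y))) = real_of_int ((q + 1) * (int ?g - 1))"
        using * True E by simp
      then show ?thesis using True E by (simp only: of_int_eq_iff) simp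
    next
      case False
      then have "{l \<in> ?L. P \<preceq> l} = {}" using lv_trans[OF _ _ P _ E] by blast
      then have "real (card (nbrs (lv 3) adj E \<inter> ?Y)) = real (gn q 3)"
        using * False by simp
      then show ?thesis using False by (simp only: of_nat_eq_iff) simp
    qed
  qed
  have params: "intriguing_params (lv 3) adj ?Y (gn q 3) ((q + 1) * (int ?g - 1))"
    using deg by (simp add: intriguing_params_def)
  have "q + 1 < gn q 4" "2 < gn q 4" using q2 by (simp_all add: gn_numerals)
  then have g1: "1 < real ?g" using g by simp
  have lt: "\<theta>\<^sub>2 < real_of_int ((q + 1) * (int ?g - 1) - gn q 3)"
  proof -
    have "0 < real q * real ?g" using q2 g1 by simp
    then show ?thesis by (simp add: \<theta>\<^sub>2_def algebra_simps)
  qed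
  obtain l where l: "l \<in> lv 2" "P \<preceq> l"
  proof -
    have "0 < card {l \<in> lv 2. P \<preceq> l}" using gn_pos[of "N - 1" q] N cnt_lines_point[OF P] by simp
    then show ?thesis using that by (auto simp: card_gt_0_iff)
  qed
  have "0 < card {E \<in> lv 3. l \<preceq> E}" using gn_pos[of "N - 2" q] N cnt_planes_line[OF l(1)] by simp
  then obtain E where "E \<in> lv 3" "l \<preceq> E" by (auto simp: card_gt_0_iff)
  then have ne: "?Y \<noteq> {}" using lv_trans[OF l(2) _ P l(1)] by blast
  have "?Y \<noteq> lv 3"
  proof
    assume eq: "?Y = lv 3"
    have "card (nbrs (lv 3) adj E) = valency" using card_nbrs[OF N] \<open>E \<in> lv 3\<close> by simp
    moreover have "nbrs (lv 3) adj E \<inter> ?Y = nbrs (lv 3) adj E" unfolding eq by (auto simp: nbrs_def)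
    ultimately have "int valency = (q + 1) * (int ?g - 1)" using deg[OF \<open>E \<in> lv 3\<close>] eq \<open>E \<in> lv 3\<close> by auto
    then have "real_of_int (int valency) = real_of_int ((q + 1) * (int ?g - 1))" by (simp only:)
    then have "real (gn q 3) * (real ?g - 1) = (real q + 1) * (real ?g - 1)"
      using real_valency[OF N] by (simp add: add.commute)
    then have "real (gn q 3) = real q + 1" using g1 by simp
    then show False using q2 by (simp add: gn_numerals)
  qed
  from intriguing_eigenvalue[OF N _ ne this params] lt show ?thesis by blast
qed

lemma eigenvalue_below:
  assumes N: "6 \<le> N"
  shows "nontrivial_eigenvalue (lv 3) adj \<theta>\<^sub>3"
proof -
  have "(\<Sum>l\<in>lv 2. \<Sum>E\<in>{E \<in> lv 3. l \<preceq> E}. 1 :: real) = (\<Sum>E\<in>lv 3. real (card {l \<in> lv 2. l \<preceq> E}) * 1)"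
    by (rule sum_swap_card) simp_all
  then have "real (card (lv 2) * gn q (N - 2)) = real (card (lv 3) * gn q 3)"
    using cnt_lines_plane cnt_planes_line by simp
  then have eq: "card (lv 2) * gn q (N - 2) = card (lv 3) * gn q 3" by (simp only: of_nat_eq_iff)
  have "gn q 4 \<le> gn q (N - 2)" using N by (intro gn_mono) simp
  moreover have "gn q 3 < gn q 4" using q2 by (simp add: gn_numerals)
  ultimately have "gn q 3 < gn q (N - 2)" by simp
  moreover have "0 < card (lv 3)" using planes_nonempty N by (simp add: card_gt_0_iff)
  ultimately have "card (lv 2) * gn q (N - 2) < card (lv 3) * gn q (N - 2)" unfolding eq by simp
  then have "card (lv 2) < card (lv 3)" by simp
  from homogeneous_system_solvable[OF finite_lv finite_lv this, of "\<lambda>l E. if l \<preceq> E then 1 else 0"]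
  obtain f where f: "\<exists>E\<in>lv 3. f E \<noteq> 0"
      and z: "\<And>l. l \<in> lv 2 \<Longrightarrow> (\<Sum>E\<in>lv 3. (if l \<preceq> E then 1 else 0) * f E) = (0 :: real)" by blast
  have "lsum f l = 0" if "l \<in> lv 2" for l
    using z[OF that] by (simp add: lsum_def if_distrib[of "\<lambda>c. c * _"] sum.inter_filter cong: if_cong)
  then have "(\<Sum>E'\<in>nbrs (lv 3) adj E. f E') = \<theta>\<^sub>3 * f E" if "E \<in> lv 3" for E
    using sum_lsum_plane[OF that, of f] nbrs_planes[OF that] by (simp add: \<theta>\<^sub>3_def)
  then have "graph_eigenvalue (lv 3) adj \<theta>\<^sub>3" unfolding graph_eigenvalue_def using f by blast
  then show ?thesis using theta_order[OF N] N by (simp add: nontrivial_eigenvalue_iff)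
qed

lemma not_tightI:
  assumes N: "6 \<le> N" and Y: "Y \<subseteq> lv 3" "Y \<noteq> {}" "Y \<noteq> lv 3"
    and p: "intriguing_params (lv 3) adj Y x x'" and \<theta>: "real_of_int (x' - x) = \<theta>\<^sub>2"
  shows "\<not> tight (lv 3) adj Y"
proof
  assume "tight (lv 3) adj Y"
  then obtain y y' where p': "intriguing_params (lv 3) adj Y y y'"
    and ext: "(\<forall>\<theta>. nontrivial_eigenvalue (lv 3) adj \<theta> \<longrightarrow> \<theta> \<le> real_of_int (y' - y)) \<or>
         (\<forall>\<theta>. nontrivial_eigenvalue (lv 3) adj \<theta> \<longrightarrow> real_of_int (y' - y) \<le> \<theta>)"
    unfolding tight_def by blast
  obtain E\<^sub>1 E\<^sub>0 where "E\<^sub>1 \<in> Y" "E\<^sub>0 \<in> lv 3 - Y" using Y by blast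
  then have "y = x" "y' = x'" using p p' unfolding intriguing_params_def by metis+
  then have "(\<forall>\<theta>. nontrivial_eigenvalue (lv 3) adj \<theta> \<longrightarrow> \<theta> \<le> \<theta>\<^sub>2) \<or>
         (\<forall>\<theta>. nontrivial_eigenvalue (lv 3) adj \<theta> \<longrightarrow> \<theta>\<^sub>2 \<le> \<theta>)"
    using ext \<theta> by simp
  then show False using eigenvalue_above[OF N] eigenvalue_below[OF N] theta_order[OF N] by force
qed

end

section \<open>Symplectic polarities of a five-dimensional space\<close>

text \<open>A symplectic polarity in lattice terms, without a form: \<open>perp\<close> reverses the
  order, complements the rank, and every point lies in its own image.\<close>

locale symplectic_geom = plane_graph +
  fixes perp :: "'a \<Rightarrow> 'a"
  assumes N6: "N = 6"
    and perp_in: "u \<in> car \<Longrightarrow> perp u \<in> car"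
    and perp_galois: "\<lbrakk>u \<in> car; v \<in> car\<rbrakk> \<Longrightarrow> u \<preceq> perp v \<longleftrightarrow> v \<preceq> perp u"
    and rk_perp: "u \<in> car \<Longrightarrow> rk (perp u) = N - rk u"
    and point_isotropic: "P \<in> lv 1 \<Longrightarrow> P \<preceq> perp P"
begin

definition isotropic_planes :: "'a set" where
  "isotropic_planes = {E \<in> lv 3. E \<preceq> perp E}"

lemma perp_antimono: "\<lbrakk>u \<preceq> v; u \<in> car; v \<in> car\<rbrakk> \<Longrightarrow> perp v \<preceq> perp u"
  using perp_galois[of "perp v" u] perp_galois[of v "perp v"] perp_in le_trans[of u v "perp (perp v)"]
  by simp

lemma perp_join_iff:
  assumes "u \<in> car" "v \<in> car" "w \<in> car"
  shows "w \<preceq> perp (join u v) \<longleftrightarrow> w \<preceq> perp u \<and> w \<preceq> perp v"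
proof -
  have "join u v \<preceq> perp w \<longleftrightarrow> u \<preceq> perp w \<and> v \<preceq> perp w"
    using assms join_ge1[of u v] join_ge2[of u v] join_least[of u "perp w" v]
      le_trans[of u "join u v" "perp w"] le_trans[of v "join u v" "perp w"] join_in perp_in by blast
  then show ?thesis using assms perp_galois join_in by simp
qed

lemma join_isotropic:
  assumes "P \<in> lv 1" "u \<in> car" "u \<preceq> perp u" "P \<preceq> perp u"
  shows "join P u \<preceq> perp (join P u)"
proof -
  have c: "P \<in> car" by (rule lv_car[OF assms(1)])
  have "u \<preceq> perp P" using perp_galois[OF c assms(2)] assms(4) by simp
  then have "P \<preceq> perp (join P u)" "u \<preceq> perp (join P u)"
    using perp_join_iff[OF c assms(2) c] perp_join_iff[OF c assms(2) assms(2)]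
      point_isotropic[OF assms(1)] assms(3,4) by simp_all
  then show ?thesis by (rule join_least[OF _ _ c assms(2)]) (use c assms(2) join_in perp_in in simp)
qed

lemma isotropic_below:
  assumes "u \<preceq> v" "v \<preceq> perp v" "u \<in> car" "v \<in> car"
  shows "u \<preceq> perp u"
  using le_trans[of u v "perp v"] le_trans[of u "perp v" "perp u"] perp_antimono[of u v] perp_in assms
  by blast

text \<open>The isotropic planes on an isotropic line \<open>l\<close> are the planes between
  \<open>l\<close> and the solid \<open>perp l\<close>: such a plane is the join of \<open>l\<close>
  with a point perpendicular to \<open>l\<close>.\<close>

lemma card_isotropic_planes_on_line:
  assumes l: "l \<in> lv 2"
  shows "card {E \<in> isotropic_planes. l \<preceq> E} = (if l \<preceq> perp l then q + 1 else 0)"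
proof -
  have cl: "l \<in> car" by (rule lv_car[OF l])
  have pl: "perp l \<in> lv 4" using rk_perp[OF cl] perp_in[OF cl] lv_rk[OF l] N6 by (simp add: lv_def)
  show ?thesis
  proof (cases "l \<preceq> perp l")
    case True
    have "E \<preceq> perp E \<longleftrightarrow> E \<preceq> perp l" if E: "E \<in> lv 3" "l \<preceq> E" for E
    proof
      have cE: "E \<in> car" by (rule lv_car[OF E(1)])
      show "E \<preceq> perp l" if "E \<preceq> perp E"
        using le_trans[OF that perp_antimono[OF E(2) cl cE]] cE cl perp_in by simp
      assume *: "E \<preceq> perp l"
      have "\<not> {P \<in> lv 1. P \<preceq> E} \<subseteq> {P \<in> lv 1. P \<preceq> l}"
      proof
        assume "{P \<in> lv 1. P \<preceq> E} \<subseteq> {P \<in> lv 1. P \<preceq> l}"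
        then have "card {P \<in> lv 1. P \<preceq> E} \<le> card {P \<in> lv 1. P \<preceq> l}" by (intro card_mono) auto
        then show False using cnt_points[OF E(1)] cnt_points[OF l] q2 by (simp add: gn_numerals)
      qed
      then obtain P where P: "P \<in> lv 1" "P \<preceq> E" "\<not> P \<preceq> l" by blast
      have cP: "P \<in> car" by (rule lv_car[OF P(1)])
      have "join P l \<in> lv 3"
        by (rule lv_join[OF P(1) l]) (use point_join_rk[of P l 2] P l in simp)
      then have "join P l = E"
        using lv_eqI[of "join P l" E 3] join_least[OF P(2) E(2) cP cl cE] E(1) by simp
      moreover have "P \<preceq> perp l" using le_trans[OF P(2) * cP cE] perp_in[OF cl] by simp
      ultimately show "E \<preceq> perp E" using join_isotropic[OF P(1) cl True] by simp
    qed
    then have "{E \<in> isotropic_planes. l \<preceq> E} = {E \<in> lv (Suc 2). l \<preceq> E \<and> E \<preceq> perp l}"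
      by (auto simp: isotropic_planes_def)
    then show ?thesis using cnt_up[OF True l pl] True by (simp add: gn_numerals)
  next
    case False
    then have "{E \<in> isotropic_planes. l \<preceq> E} = {}"
      using isotropic_below[OF _ _ cl] lv_car by (force simp: isotropic_planes_def)
    then show ?thesis using False by (simp only: card.empty) simp
  qed
qed

lemma line_isotropic_iff:
  assumes "P \<in> lv 1" "l \<in> lv 2" "P \<preceq> l"
  shows "l \<preceq> perp l \<longleftrightarrow> l \<preceq> perp P"
proof
  have c: "P \<in> car" "l \<in> car" using assms lv_car by blast+
  show "l \<preceq> perp P" if "l \<preceq> perp l"
    using le_trans[OF that perp_antimono[OF assms(3) c]] c perp_in by simp
  assume *: "l \<preceq> perp P"
  have "\<not> {Q \<in> lv 1. Q \<preceq> l} \<subseteq> {P}"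
  proof
    assume "{Q \<in> lv 1. Q \<preceq> l} \<subseteq> {P}"
    then have "card {Q \<in> lv 1. Q \<preceq> l} \<le> card {P}" by (intro card_mono) auto
    then show False using cnt_points_line[OF assms(2)] q2 by simp
  qed
  then obtain Q where Q: "Q \<in> lv 1" "Q \<preceq> l" "Q \<noteq> P" by blast
  have cQ: "Q \<in> car" by (rule lv_car[OF Q(1)])
  have "\<not> Q \<preceq> P" using lv_eqI[OF _ Q(1) assms(1)] Q(3) by blast
  then have "join Q P \<in> lv 2"
    by (intro lv_join[OF Q(1) assms(1)]) (use point_join_rk[of Q P 1] Q assms in simp)
  then have "join Q P = l"
    using lv_eqI[of "join Q P" l 2] join_least[OF Q(2) assms(3) cQ c(1) c(2)] assms(2) by simp
  moreover have "Q \<preceq> perp P" using le_trans[OF Q(2) * cQ c(2)] perp_in[OF c(1)] by simp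
  ultimately show "l \<preceq> perp l"
    using join_isotropic[OF Q(1) c(1) point_isotropic[OF assms(1)]] by simp
qed

text \<open>A line on \<open>P\<close> is isotropic exactly if it lies in the hyperplane
  \<open>perp P\<close>. Either this contains \<open>E\<close>, or it meets \<open>E\<close> in a
  single line, which passes through \<open>P\<close>.\<close>

lemma card_isotropic_lines_flag:
  assumes P: "P \<in> lv 1" and E: "E \<in> lv 3" and PE: "P \<preceq> E"
  shows "card {l \<in> lv 2. P \<preceq> l \<and> l \<preceq> E \<and> l \<preceq> perp l} = (if P \<preceq> perp E then q + 1 else 1)"
proof -
  have c: "P \<in> car" "E \<in> car" using P E lv_car by blast+
  have H: "perp P \<in> lv 5" using rk_perp[OF c(1)] perp_in[OF c(1)] lv_rk[OF P] N6 by (simp add: lv_def)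
  have eq: "{l \<in> lv 2. P \<preceq> l \<and> l \<preceq> E \<and> l \<preceq> perp l} = {l \<in> lv 2. P \<preceq> l \<and> l \<preceq> E \<and> l \<preceq> perp P}"
    using line_isotropic_iff[OF P] by blast
  show ?thesis
  proof (cases "P \<preceq> perp E")
    case True
    then have "E \<preceq> perp P" using perp_galois c by simp
    then have "{l \<in> lv 2. P \<preceq> l \<and> l \<preceq> E \<and> l \<preceq> perp P} = {l \<in> lv 2. P \<preceq> l \<and> l \<preceq> E}"
      using lv_trans[OF _ _ _ E H] by blast
    then show ?thesis unfolding eq using cnt_lines_flag[OF P E PE] True by simp
  next
    case False
    then have nE: "\<not> E \<preceq> perp P" using perp_galois c by simp
    obtain t where t: "t \<in> lv 6" using top_ex N6 by (auto simp: lv_def)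
    have "E \<preceq> t" "perp P \<preceq> t" using le_top[of t] t N6 c perp_in by auto
    then have "rk (meet E (perp P)) = 2"
      using coatom_rk_meet[of E 3 "perp P" 5 t] E H t nE by simp
    then have m: "{l \<in> lv 2. l \<preceq> E \<and> l \<preceq> perp P} = {meet E (perp P)}"
      by (rule common_meet[OF E H])
    have "P \<preceq> meet E (perp P)"
      using meet_greatest[OF PE point_isotropic[OF P] c(2) perp_in[OF c(1)] c(1)] .
    then have "{l \<in> lv 2. P \<preceq> l \<and> l \<preceq> E \<and> l \<preceq> perp P} = {meet E (perp P)}" using m by blast
    then show ?thesis unfolding eq using False by simp
  qed
qed

text \<open>If \<open>E\<close> is not totally isotropic, then counting incident pairs of points and totally isotropic
  lines of \<open>E\<close> and reducing modulo \<open>q + 1\<close> shows that the radical of \<open>E\<close> is a point.\<close>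

lemma card_isotropic_lines_plane:
  assumes E: "E \<in> lv 3"
  shows "card {l \<in> lv 2. l \<preceq> E \<and> l \<preceq> perp l} = (if E \<preceq> perp E then gn q 3 else q + 1)"
proof -
  have c: "E \<in> car" by (rule lv_car[OF E])
  have pE: "perp E \<in> lv 3" using rk_perp[OF c] perp_in[OF c] lv_rk[OF E] N6 by (simp add: lv_def)
  show ?thesis
  proof (cases "E \<preceq> perp E")
    case True
    have "l \<preceq> perp l" if "l \<in> lv 2" "l \<preceq> E" for l
      using isotropic_below[OF that(2) True lv_car[OF that(1)] c] .
    then have "{l \<in> lv 2. l \<preceq> E \<and> l \<preceq> perp l} = {l \<in> lv 2. l \<preceq> E}" by blast
    then show ?thesis using cnt_lines_plane[OF E] True by simp
  next
    case False
    let ?L = "{l \<in> lv 2. l \<preceq> E \<and> l \<preceq> perp l}" and ?T = "{P \<in> lv 1. P \<preceq> E}"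
    let ?m = "rk (meet E (perp E))" and ?R = "{P \<in> ?T. P \<preceq> perp E}"
    have "(\<Sum>P\<in>?T. card {l \<in> ?L. P \<preceq> l}) = (\<Sum>l\<in>?L. card {P \<in> ?T. P \<preceq> l})"
      by (rule sum_multicount_gen) auto
    also have "\<dots> = (\<Sum>l\<in>?L. q + 1)"
    proof (rule sum.cong)
      fix l assume l: "l \<in> ?L"
      then have "{P \<in> ?T. P \<preceq> l} = {P \<in> lv 1. P \<preceq> l}" using lv_trans[OF _ _ _ _ E, of _ l] by blast
      then show "card {P \<in> ?T. P \<preceq> l} = q + 1" using cnt_points_line l by simp
    qed simp
    also have "\<dots> = (q + 1) * card ?L" by simp
    also have "(\<Sum>P\<in>?T. card {l \<in> ?L. P \<preceq> l}) = (\<Sum>P\<in>?T. 1 + (if P \<preceq> perp E then q else 0))"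
    proof (rule sum.cong)
      fix P assume P: "P \<in> ?T"
      have "{l \<in> ?L. P \<preceq> l} = {l \<in> lv 2. P \<preceq> l \<and> l \<preceq> E \<and> l \<preceq> perp l}" by blast
      then show "card {l \<in> ?L. P \<preceq> l} = 1 + (if P \<preceq> perp E then q else 0)"
        using card_isotropic_lines_flag[OF _ E] P by simp
    qed simp
    also have "\<dots> = gn q 3 + q * card ?R"
      using cnt_points[OF E] unfolding sum.distrib by (simp add: sum.If_cases Int_def conj_assoc)
    finally have count: "gn q 3 + q * card ?R = (q + 1) * card ?L" .
    have "?R = {P \<in> lv 1. P \<preceq> meet E (perp E)}"
    proof -
      have "P \<preceq> meet E (perp E) \<longleftrightarrow> P \<preceq> E \<and> P \<preceq> perp E" if "P \<in> lv 1" for P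
      proof -
        have cP: "P \<in> car" and cp: "perp E \<in> car" using that lv_car c perp_in by blast+
        show ?thesis
          using meet_greatest[OF _ _ c cp cP] le_trans[OF _ meet_le1[OF c cp] cP meet_in[OF c cp] c]
            le_trans[OF _ meet_le2[OF c cp] cP meet_in[OF c cp] cp] by blast
      qed
      then show ?thesis by blast
    qed
    then have R: "card ?R = gn q ?m"
      using cnt_points[of "meet E (perp E)" ?m] lv_meet[OF E pE refl] by simp
    then have count': "(q + 1) * card ?L = gn q 3 + q * gn q ?m" using count by (simp only:)
    have "?m < 3"
      using rk_meet_le[OF E pE] False c by force
    then consider "?m = 0" | "?m = 1" | "?m = 2" by linarith
    then have "?m = 1"
    proof cases
      case 1
      then have "(q + 1) * card ?L = (q + 1) * q + 1"
        using count' by (simp add: gn_numerals power2_eq_square)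
      then have "(q + 1) dvd (q + 1) * q + 1" by (metis dvd_triv_left)
      then have "q + 1 dvd 1" by (metis dvd_add_right_iff dvd_triv_left)
      then show ?thesis using q2 by simp
    next
      case 3
      then have "(q + 1) * card ?L = (q + 1) * (2 * q) + 1"
        using count' by (simp add: gn_numerals power2_eq_square algebra_simps)
      then have "(q + 1) dvd (q + 1) * (2 * q) + 1" by (metis dvd_triv_left)
      then have "q + 1 dvd 1" by (metis dvd_add_right_iff dvd_triv_left)
      then show ?thesis using q2 by simp
    qed
    then have "(q + 1) * card ?L = (q + 1) * (q + 1)"
      using count' by (simp add: gn_numerals power2_eq_square algebra_simps)
    then have "card ?L = q + 1" by (simp only: mult_cancel1) simp
    then show ?thesis using False by simp
  qed
qed

text \<open>Every isotropic line of \<open>E\<close> lies on \<open>q + 1\<close> isotropic planes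
  and no other line lies on any. With \<open>gn q 3\<close> or \<open>q + 1\<close> isotropic lines
  in \<open>E\<close>, only the contribution of \<open>E\<close> itself has to be
  subtracted.\<close>

lemma card_nbrs_isotropic:
  assumes E: "E \<in> lv 3"
  shows "card (nbrs (lv 3) adj E \<inter> isotropic_planes) = (if E \<in> isotropic_planes then q * gn q 3 else (q + 1)^2)"
proof -
  let ?Y = isotropic_planes
  have "(\<Sum>l\<in>{l \<in> lv 2. l \<preceq> E}. real (card {E' \<in> ?Y. l \<preceq> E'}))
      = (\<Sum>l\<in>{l \<in> lv 2. l \<preceq> E}. if l \<preceq> perp l then real (q + 1) else 0)"
    by (rule sum.cong) (auto simp: card_isotropic_planes_on_line)
  also have "\<dots> = (q + 1) * card {l \<in> lv 2. l \<preceq> E \<and> l \<preceq> perp l}"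
    by (simp add: sum.If_cases Int_def conj_assoc algebra_simps)
  finally have "real ((q + 1) * card {l \<in> lv 2. l \<preceq> E \<and> l \<preceq> perp l})
    = real (gn q 3 * (if E \<in> ?Y then 1 else 0) + card (nbrs (lv 3) adj E \<inter> ?Y))"
    using card_nbrs_via_lines[OF E, of ?Y] by (simp add: isotropic_planes_def)
  then have "(q + 1) * card {l \<in> lv 2. l \<preceq> E \<and> l \<preceq> perp l}
    = gn q 3 * (if E \<in> ?Y then 1 else 0) + card (nbrs (lv 3) adj E \<inter> ?Y)" by (simp only: of_nat_eq_iff)
  then show ?thesis
    using E by (simp add: card_isotropic_lines_plane isotropic_planes_def power2_eq_square split: if_splits)
qed

lemma isotropic_params:
  "intriguing_params (lv 3) adj isotropic_planes (int ((q + 1)^2)) (int (q * gn q 3))"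
  using card_nbrs_isotropic unfolding intriguing_params_def isotropic_planes_def by auto

lemma theta2_eq: "real_of_int (int (q * gn q 3) - int ((q + 1)^2)) = \<theta>\<^sub>2"
  unfolding \<theta>\<^sub>2_def unfolding N6 by (simp add: gn_numerals power2_eq_square power_numeral_reduce algebra_simps)

lemma isotropic_planes_sub: "isotropic_planes \<subseteq> lv 3"
  by (auto simp: isotropic_planes_def)

text \<open>The set satisfies \<open>intriguing_geom\<close> with \<open>x = (q + 1)^2\<close>, so
  its size is read off from \<open>card_Y\<close> instead of being counted.\<close>

lemma card_isotropic_planes: "card isotropic_planes = (q + 1) * (q ^ 2 + 1) * (q ^ 3 + 1)"
proof -
  interpret I: intriguing_geom car le meet join rk q N isotropic_planes "real ((q + 1)^2)"
  proof unfold_locales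
    fix E assume E: "E \<in> lv 3"
    have "nbrs (lv 3) adj E \<inter> isotropic_planes = {E' \<in> isotropic_planes. rk (meet E E') = 2}"
      using nbrs_planes[OF E] isotropic_planes_sub by blast
    then have "card {E' \<in> isotropic_planes. rk (meet E E') = 2}
        = (if E \<in> isotropic_planes then q * gn q 3 else (q + 1)^2)"
      using card_nbrs_isotropic[OF E] by simp
    then show "real (card {E' \<in> isotropic_planes. rk (meet E E') = 2}) = real ((q + 1)^2) +
        (if E \<in> isotropic_planes then real (gn q (N - 2)) - (q + 1) - gn q 3 else 0)"
      using theta2_eq by (simp add: \<theta>\<^sub>2_def)
  qed (use N6 isotropic_planes_sub in auto)
  have pos: "0 < real (gn q 3 * (q + 1)^2)" using gn_pos[of 3 q] by simp
  have eq: "gn q 6 * gn q 4 = gn q 3 * ((q + 1) * (q ^ 2 + 1) * (q ^ 3 + 1))"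
    by (simp add: gn_numerals algebra_simps power_numeral_reduce)
  have "real (gn q 3 * (q + 1)^2 * card isotropic_planes) = real (gn q 6 * gn q 4 * (q + 1)^2)"
    using I.card_Y N6 by (simp add: algebra_simps)
  then have "gn q 3 * (q + 1)^2 * card isotropic_planes = gn q 6 * gn q 4 * (q + 1)^2"
    by (simp only: of_nat_eq_iff)
  then have "(gn q 3 * (q + 1)^2) * card isotropic_planes
      = (gn q 3 * (q + 1)^2) * ((q + 1) * (q ^ 2 + 1) * (q ^ 3 + 1))"
    unfolding eq by (simp only: mult_ac)
  moreover have "gn q 3 * (q + 1)^2 \<noteq> 0" using gn_pos[of 3 q] by simp
  ultimately show ?thesis by (simp only: mult_cancel1) simp
qed

lemma isotropic_planes_proper: "isotropic_planes \<noteq> {}" "isotropic_planes \<noteq> lv 3"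
proof -
  have "0 < card isotropic_planes" unfolding card_isotropic_planes by simp
  then show "isotropic_planes \<noteq> {}" by auto
  show "isotropic_planes \<noteq> lv 3"
  proof
    assume eq: "isotropic_planes = lv 3"
    obtain E where E: "E \<in> lv 3" using planes_nonempty N6 by auto
    have "nbrs (lv 3) adj E \<inter> isotropic_planes = nbrs (lv 3) adj E" unfolding eq by (auto simp: nbrs_def)
    then have "valency = q * gn q 3"
      using card_nbrs[OF _ E] card_nbrs_isotropic[OF E] eq E eq_imp_le[OF N6[symmetric]] by simp
    then have "gn q 3 * (gn q 4 - 1) = gn q 3 * q" unfolding valency_def unfolding N6 by (simp add: mult.commute)
    then have "gn q 4 - 1 = q" using gn_pos[of 3 q] by simp
    then show False using q2 by (simp add: gn_numerals)
  qed
qed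

lemma isotropic_planes_intriguing:
  "nontrivial_intriguing (lv 3) adj isotropic_planes" "\<not> tight (lv 3) adj isotropic_planes"
  using isotropic_params isotropic_planes_sub isotropic_planes_proper
  by (auto simp: nontrivial_intriguing_def intriguing_def)
    (use not_tightI[OF _ isotropic_planes_sub isotropic_planes_proper isotropic_params theta2_eq] N6 in simp)

end

section \<open>The subspaces of a finite vector space and symplectic forms on it\<close>

interpretation PG: proj_geom "{U :: ('k::{finite,field} ^ 'm::finite) set. vec.subspace U}" "(\<subseteq>)" "(\<inter>)"
  "\<lambda>U W. vec.span (U \<union> W)" vec.dim "CARD('k)" "CARD('m)"
  by (rule proj_geom_subspaces)

lemma proj_subspaces_eq_lv: "proj_subspaces d = PG.lv (Suc d)"
  by (simp add: proj_subspaces_def PG.lv_def)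

lemma pg_lv: "pg_points = PG.lv 1" "pg_lines = PG.lv 2" "pg_planes = PG.lv 3"
  by (simp_all add: proj_subspaces_eq_lv eval_nat_numeral)

interpretation PG: plane_graph "{U :: ('k::{finite,field} ^ 'm::finite) set. vec.subspace U}" "(\<subseteq>)" "(\<inter>)"
  "\<lambda>U W. vec.span (U \<union> W)" vec.dim "CARD('k)" "CARD('m)" meet_in_line
  by unfold_locales (auto simp: meet_in_line_def PG.lv_def proj_subspaces_def intro: vec.subspace_inter)

text \<open>Defined for arbitrary sets, so that it can be computed from a basis of a
  subspace.\<close>

definition orth :: "('v \<Rightarrow> 'v \<Rightarrow> 'k::zero) \<Rightarrow> 'v set \<Rightarrow> 'v set" where
  "orth B U = {v. \<forall>u\<in>U. B u v = 0}"

context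
  fixes B :: "'k::{finite,field} ^ 'm::finite \<Rightarrow> 'k ^ 'm \<Rightarrow> 'k"
  assumes B: "symplectic_form B"
begin

lemma form_add: "B u (v + w) = B u v + B u w" "B (v + w) u = B v u + B w u"
  and form_scale: "B u (c *s v) = c * B u v" "B (c *s v) u = c * B v u"
  using B by (simp_all add: symplectic_form_def Vector_Spaces.linear_iff)

lemma form_alt: "B v v = 0"
  using B by (simp add: symplectic_form_def)

lemma form_simps:
  "B u (v + w) = B u v + B u w" "B u (c *s v) = c * B u v" "B u 0 = 0"
  "B (v + w) u = B v u + B w u" "B (c *s v) u = c * B v u" "B 0 u = 0" "B v v = 0"
  "B u (v - w) = B u v - B u w"
proof -
  have "B u (v - w) + B u w = B u v" unfolding form_add(1)[symmetric] by simp
  then show "B u (v - w) = B u v - B u w" by (simp add: eq_diff_eq)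
  show "B u 0 = 0" "B 0 u = 0" using form_scale(1)[of u 0 0] form_scale(2)[of 0 0 u] by simp_all
qed (rule form_add form_scale form_alt)+

lemma form_swap: "B u v = 0 \<longleftrightarrow> B v u = 0"
proof -
  have "B (u + v) (u + v) = B u u + B v u + (B u v + B v v)" by (simp only: form_add)
  then have "B v u + B u v = 0" by (simp add: form_alt)
  then show ?thesis by (metis add.left_neutral add.right_neutral)
qed

lemma subspace_orth: "vec.subspace (orth B U)"
  by (auto simp: vec.subspace_def orth_def form_simps)

lemma orth_span: "orth B (vec.span U) = orth B U"
proof
  show "orth B (vec.span U) \<subseteq> orth B U" using vec.span_superset[of U] by (auto simp: orth_def)
  show "orth B U \<subseteq> orth B (vec.span U)"
  proof
    fix v assume v: "v \<in> orth B U"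
    have "vec.subspace {u. B u v = 0}" by (auto simp: vec.subspace_def form_simps)
    then have "vec.span U \<subseteq> {u. B u v = 0}" using v by (intro vec.span_minimal) (auto simp: orth_def)
    then show "v \<in> orth B (vec.span U)" by (auto simp: orth_def)
  qed
qed

text \<open>If some \<open>w\<close> orthogonal to \<open>U\<close> is not orthogonal to
  \<open>u\<close>, then subtracting a suitable multiple of \<open>w\<close> makes any vector
  orthogonal to \<open>u\<close>; so the larger space is spanned by the smaller one and
  \<open>w\<close>.\<close>

lemma dim_orth_insert: "vec.dim (orth B U) \<le> Suc (vec.dim (orth B (insert u U)))"
proof (cases "\<exists>w\<in>orth B U. B u w \<noteq> 0")
  case True
  then obtain w where w: "w \<in> orth B U" "B u w \<noteq> 0" by blast
  have "orth B U \<subseteq> vec.span (insert w (orth B (insert u U)))"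
  proof
    fix v assume v: "v \<in> orth B U"
    have "v - (B u v / B u w) *s w \<in> orth B (insert u U)"
      using v w by (auto simp: orth_def form_simps)
    then show "v \<in> vec.span (insert w (orth B (insert u U)))"
      unfolding vec.span_breakdown_eq by (intro exI[of _ "B u v / B u w"] vec.span_base)
  qed
  then have "vec.dim (orth B U) \<le> vec.dim (insert w (orth B (insert u U)))"
    by (metis vec.dim_mono)
  then show ?thesis by (simp add: vec.dim_insert split: if_splits)
next
  case False
  then have "orth B U = orth B (insert u U)" by (auto simp: orth_def)
  then show ?thesis by simp
qed

lemma dim_orth_union: "finite C \<Longrightarrow> vec.dim (orth B U) \<le> vec.dim (orth B (U \<union> C)) + card C"
proof (induction C rule: finite_induct)
  case (insert c C)
  then show ?case using dim_orth_insert[of "U \<union> C" c] by simp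
qed simp

text \<open>Each new vector lowers the dimension of the orthogonal space by at most one. Going from
  the empty set to a basis of \<open>U\<close> gives the lower bound. Extending it to a basis of the
  whole space, where non-degeneracy leaves only zero, gives the upper bound.\<close>

lemma dim_orth:
  assumes U: "vec.subspace U"
  shows "vec.dim (orth B U) = CARD('m) - vec.dim U"
proof (rule antisym)
  obtain C where C: "C \<subseteq> U" "vec.independent C" "U \<subseteq> vec.span C" "card C = vec.dim U"
    using vec.basis_exists by blast
  have "vec.span C = U" using C U by (metis vec.span_subspace)
  then have "orth B U = orth B C" using orth_span by metis
  moreover have "orth B {} = UNIV" by (simp add: orth_def)
  moreover have "vec.dim (UNIV :: ('k ^ 'm) set) = CARD('m)" by (rule vec_dim_card)
  ultimately show "CARD('m) - vec.dim U \<le> vec.dim (orth B U)"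
    using dim_orth_union[of C "{}"] C(4) by simp
  obtain C' where C': "C \<subseteq> C'" "C' \<subseteq> UNIV" "vec.independent C'" "UNIV \<subseteq> vec.span C'"
    using vec.maximal_independent_subset_extend[OF subset_UNIV C(2)] .
  have span: "vec.span C' = UNIV" using C'(4) by blast
  have "card C' = CARD('m)"
  proof -
    have "vec.dim (UNIV :: ('k ^ 'm) set) = card C'"
      using vec.dim_span_eq_card_independent[OF C'(3)] unfolding span .
    then show ?thesis using vec_dim_card by metis
  qed
  then have card: "card (C' - C) = CARD('m) - vec.dim U" using C'(1) C(4) by (simp add: card_Diff_subset)
  have "orth B (C \<union> (C' - C)) = orth B C'" using C'(1) by (simp add: Un_absorb1)
  also have "\<dots> = orth B UNIV" using orth_span[of C'] unfolding span by simp
  also have "\<dots> = {0}"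
    using B form_swap form_simps(3) by (auto simp: orth_def symplectic_form_def)
  finally show "vec.dim (orth B U) \<le> CARD('m) - vec.dim U"
    using dim_orth_union[of "C' - C" C] card \<open>orth B U = orth B C\<close> by simp
qed

lemma symplectic_geom_orth:
  assumes "CARD('m) = 6"
  shows "symplectic_geom {U :: ('k ^ 'm) set. vec.subspace U} (\<subseteq>) (\<inter>)
    (\<lambda>U W. vec.span (U \<union> W)) vec.dim CARD('k) CARD('m) meet_in_line (orth B)"
proof unfold_locales
  show "CARD('m) = 6" by (rule assms)
next
  fix U :: "('k ^ 'm) set" assume "U \<in> {U. vec.subspace U}"
  then show "orth B U \<in> {U. vec.subspace U}" "vec.dim (orth B U) = CARD('m) - vec.dim U"
    using subspace_orth dim_orth by simp_all
next
  fix U W :: "('k ^ 'm) set"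
  show "U \<subseteq> orth B W \<longleftrightarrow> W \<subseteq> orth B U" using form_swap by (auto simp: orth_def subset_eq)
next
  fix P :: "('k ^ 'm) set" assume "P \<in> PG.lv 1"
  then have P: "vec.subspace P" "vec.dim P = 1" by (simp_all add: PG.lv_def)
  obtain C where C: "C \<subseteq> P" "vec.independent C" "P \<subseteq> vec.span C" "card C = vec.dim P"
    using vec.basis_exists by blast
  obtain w where w: "C = {w}" using C(4) P(2) by (metis card_1_singletonE One_nat_def)
  show "P \<subseteq> orth B P"
  proof -
    have "P \<subseteq> range (\<lambda>k. k *s w)" using C(3) unfolding w vec.span_singleton by blast
    have "B u v = 0" if uv: "u \<in> P" "v \<in> P" for u v
    proof -
      obtain a b where "u = a *s w" "v = b *s w"
        using \<open>P \<subseteq> range (\<lambda>k. k *s w)\<close> uv by blast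
      then show ?thesis by (simp add: form_simps)
    qed
    then show ?thesis by (auto simp: orth_def)
  qed
qed

end

text \<open>The form is the sum of three hyperbolic planes on consecutive pairs of coordinates.
  Pairing with an \<open>axis\<close> vector reads off the partner coordinate up to sign, so the
  form is non-degenerate.\<close>

lemma symplectic_form_exists:
  assumes "CARD('m::finite) = 6"
  shows "\<exists>B :: 'k::{finite,field} ^ 'm \<Rightarrow> 'k ^ 'm \<Rightarrow> 'k. symplectic_form B"
proof -
  obtain g where g: "bij_betw g {0..<6::nat} (UNIV :: 'm set)"
    using ex_bij_betw_nat_finite[of "UNIV :: 'm set"] assms by auto
  define B where "B u v = (\<Sum>i<3. u $ g (2 * i) * v $ g (2 * i + 1) - u $ g (2 * i + 1) * v $ g (2 * i))"
    for u v :: "'k ^ 'm"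
  have "Vector_Spaces.linear (*s) (*) (B u)" "Vector_Spaces.linear (*s) (*) (\<lambda>u. B u v)" for u v
    unfolding Vector_Spaces.linear_iff
    by (auto simp: vec.vector_space_axioms vector_space_over_itself.vector_space_axioms B_def
        eval_nat_numeral algebra_simps)
  moreover have "B v v = 0" for v by (simp add: B_def mult.commute)
  moreover have "u = 0" if u: "\<And>v. B u v = 0" for u
  proof -
    have inj: "g a = g b \<longleftrightarrow> a = b" if "a < 6" "b < 6" for a b
      using g that by (auto simp: bij_betw_def inj_on_def)
    have expand: "B u v = u $ g 0 * v $ g 1 - u $ g 1 * v $ g 0 + (u $ g 2 * v $ g 3 - u $ g 3 * v $ g 2)
        + (u $ g 4 * v $ g 5 - u $ g 5 * v $ g 4)" for v
      unfolding B_def by (simp add: lessThan_nat_numeral lessThan_Suc)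
    note z = u[unfolded expand]
    have "u $ g 0 = 0" "u $ g 1 = 0" "u $ g 2 = 0" "u $ g 3 = 0" "u $ g 4 = 0" "u $ g 5 = 0"
      using z[of "axis (g 1) 1"] z[of "axis (g 0) 1"] z[of "axis (g 3) 1"]
        z[of "axis (g 2) 1"] z[of "axis (g 5) 1"] z[of "axis (g 4) 1"]
      by (simp_all add: axis_def inj)
    moreover have "j = 0 \<or> j = 1 \<or> j = 2 \<or> j = 3 \<or> j = 4 \<or> j = 5" if "j < 6" for j :: nat
      using that by linarith
    ultimately have "u $ g j = 0" if "j < 6" for j using that by blast
    moreover have "UNIV = g ` {0..<6}" using g by (simp add: bij_betw_def)
    ultimately have "u $ i = 0" for i by (metis UNIV_I atLeastLessThan_iff imageE)
    then show "u = 0" by (simp add: vec_eq_iff)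
  qed
  ultimately show ?thesis unfolding symplectic_form_def by blast
qed

text \<open>\<open>symplectic_polarity\<close> fixes \<open>\<pi>\<close> on subspaces only, which
  is enough here because planes are subspaces.\<close>

lemma totally_isotropic_planes_eq:
  assumes "\<And>U. vec.subspace U \<Longrightarrow> \<pi> U = orth B U"
  shows "totally_isotropic_planes \<pi> = {E \<in> PG.lv 3. E \<subseteq> orth B E}"
  using assms by (auto simp: totally_isotropic_planes_def pg_lv PG.lv_def)

lemma spread_bound_eq:
  assumes "2 \<le> q" "5 \<le> n"
  shows "(real q ^ (n + 1) - 1) * (real q ^ (n - 1) - 1) / ((real q - 1) * (real q ^ 2 - 1))
    = real (gn q (n + 1) * gn q (n - 1)) / (q + 1)"
proof -
  have gn: "real q ^ m - 1 = (real q - 1) * gn q m" for m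
  proof -
    have "real ((q - 1) * gn q m) = real (q ^ m - 1)" using mult_gn[OF assms(1)] by simp
    moreover have "1 \<le> q ^ m" using assms by simp
    ultimately show ?thesis using assms by (simp add: of_nat_diff)
  qed
  have "real q ^ 2 - 1 = (real q - 1) * (real q + 1)" by (simp add: power2_eq_square algebra_simps)
  then have "(real q - 1) * (real q ^ 2 - 1) = ((real q - 1) * (real q - 1)) * (real q + 1)"
    by (simp only: mult.assoc)
  moreover have "(real q ^ (n + 1) - 1) * (real q ^ (n - 1) - 1)
      = ((real q - 1) * (real q - 1)) * real (gn q (n + 1) * gn q (n - 1))"
    by (simp only: gn of_nat_mult mult_ac)
  moreover have "(real q - 1) * (real q - 1) \<noteq> 0" using assms by simp
  note mult_divide_mult_cancel_left[OF this]
  ultimately show ?thesis by (simp only: of_nat_add of_nat_1)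
qed

theorem theorem1p1:
  fixes q n :: nat
  assumes "q = CARD('k::{finite, field})"
    and "CARD('m::finite) = n + 1"
    and "n \<ge> 5"
  shows
    "((odd n \<and> n \<ge> 9) \<or> (n = 7 \<and> q \<ge> 13) \<longrightarrow>
       (\<forall>\<L> :: ('k ^ 'm) set set.
          nontrivial_intriguing pg_planes meet_in_line \<L> \<and>
          \<not> tight pg_planes meet_in_line \<L> \<longrightarrow>
            real (card \<L>) \<ge> (real q ^ (n + 1) - 1) * (real q ^ (n - 1) - 1)
                              / ((real q - 1) * (real q ^ 2 - 1)) \<and>
            (real (card \<L>) = (real q ^ (n + 1) - 1) * (real q ^ (n - 1) - 1)
                              / ((real q - 1) * (real q ^ 2 - 1)) \<longleftrightarrow>
             (\<exists>S. line_spread S \<and> \<L> = {E \<in> pg_planes. \<exists>l\<in>S. l \<subseteq> E})))) \<and>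
     (n = 5 \<and> q \<ge> 25 \<longrightarrow>
       (\<forall>\<L> :: ('k ^ 'm) set set.
          nontrivial_intriguing pg_planes meet_in_line \<L> \<and>
          \<not> tight pg_planes meet_in_line \<L> \<longrightarrow>
            card \<L> \<ge> (q + 1) * (q ^ 2 + 1) * (q ^ 3 + 1)) \<and>
       (\<exists>\<pi> :: ('k ^ 'm) set \<Rightarrow> ('k ^ 'm) set. symplectic_polarity \<pi>) \<and>
       (\<forall>\<pi> :: ('k ^ 'm) set \<Rightarrow> ('k ^ 'm) set. symplectic_polarity \<pi> \<longrightarrow>
          nontrivial_intriguing pg_planes meet_in_line (totally_isotropic_planes \<pi>) \<and>
          \<not> tight pg_planes meet_in_line (totally_isotropic_planes \<pi>) \<and>
          card (totally_isotropic_planes \<pi>) = (q + 1) * (q ^ 2 + 1) * (q ^ 3 + 1)))"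
proof -
  have q: "CARD('k) = q" and N: "CARD('m) = n + 1" and n: "5 \<le> n" using assms by simp_all
  have q2: "2 \<le> q" using PG.q2[where ?'k = 'k] q by simp
  have bound: "(real q ^ (n + 1) - 1) * (real q ^ (n - 1) - 1) / ((real q - 1) * (real q ^ 2 - 1))
      = real (gn q (n + 1) * gn q (n - 1)) / (q + 1)"
    by (rule spread_bound_eq[OF q2 n])
  have partA: "real (card \<L>) \<ge> real (gn q (n + 1) * gn q (n - 1)) / (q + 1) \<and>
      (real (card \<L>) = real (gn q (n + 1) * gn q (n - 1)) / (q + 1) \<longleftrightarrow>
        (\<exists>S. line_spread S \<and> \<L> = {E \<in> pg_planes. \<exists>l\<in>S. l \<subseteq> E}))"
    if c: "(odd n \<and> n \<ge> 9) \<or> (n = 7 \<and> q \<ge> 13)"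
      and L: "nontrivial_intriguing pg_planes meet_in_line \<L>" "\<not> tight pg_planes meet_in_line \<L>"
    for \<L> :: "('k ^ 'm) set set"
  proof -
    have N': "10 \<le> CARD('m) \<or> CARD('m) = 8 \<and> 13 \<le> CARD('k)" using c N q by auto
    note T = PG.spread_threshold[OF N', of \<L>, folded pg_lv, OF L, unfolded N q]
    have Q: "0 < real (q + 1)" by simp
    have "real (gn q (n + 1) * gn q (n - 1)) \<le> (q + 1) * real (card \<L>)" using T(1) by simp
    then have ge: "real (gn q (n + 1) * gn q (n - 1)) / (q + 1) \<le> real (card \<L>)"
      using Q by (simp only: pos_divide_le_eq mult.commute)
    have eq_iff: "real (card \<L>) = real (gn q (n + 1) * gn q (n - 1)) / (q + 1)
        \<longleftrightarrow> (q + 1) * real (card \<L>) = real (gn q (n + 1) * gn q (n - 1))"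
      using Q by (simp only: eq_divide_eq mult.commute) simp
    have "(q + 1) * real (card \<L>) = real (gn q (n + 1) * gn q (n - 1))
        \<longleftrightarrow> (\<exists>S. line_spread S \<and> \<L> = {E \<in> pg_planes. \<exists>l\<in>S. l \<subseteq> E})"
    proof
      assume "(q + 1) * real (card \<L>) = real (gn q (n + 1) * gn q (n - 1))"
      then have "(q + 1) * real (card \<L>) = gn q (n + 1) * gn q (n + 1 - 2)" by simp
      from T(2)[OF this]
      show "\<exists>S. line_spread S \<and> \<L> = {E \<in> pg_planes. \<exists>l\<in>S. l \<subseteq> E}"
      proof (elim exE conjE)
        fix S assume "S \<subseteq> pg_lines" "\<forall>P\<in>pg_points. \<exists>!l. l \<in> S \<and> P \<subseteq> l"
          and eq: "\<L> = {E \<in> pg_planes. \<exists>l\<in>S. l \<subseteq> E}"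
        then have "line_spread S" by (simp only: line_spread_def simp_thms)
        then show ?thesis using eq by (intro exI conjI)
      qed
    next
      assume "\<exists>S. line_spread S \<and> \<L> = {E \<in> pg_planes. \<exists>l\<in>S. l \<subseteq> E}"
      then obtain S where S: "line_spread S" and eq: "\<L> = {E \<in> pg_planes. \<exists>l\<in>S. l \<subseteq> E}"
        by (elim exE conjE)
      have "S \<subseteq> pg_lines" using S by (simp add: line_spread_def)
      moreover have "\<exists>!l. l \<in> S \<and> P \<subseteq> l" if "P \<in> pg_points" for P
        using S that unfolding line_spread_def by (elim conjE) (rule bspec)
      ultimately have "(CARD('k) + 1) * real (card \<L>) = gn CARD('k) CARD('m) * gn CARD('k) (CARD('m) - 2)"
        using eq by (rule PG.card_spread_planes[folded pg_lv])
      from this[unfolded N q]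
      show "(q + 1) * real (card \<L>) = real (gn q (n + 1) * gn q (n - 1))" by simp
    qed
    then show ?thesis using ge eq_iff by blast
  qed
  have partB: "(q + 1) * (q ^ 2 + 1) * (q ^ 3 + 1) \<le> card \<L>"
    if "n = 5" "q \<ge> 25"
      and L: "nontrivial_intriguing pg_planes meet_in_line \<L>" "\<not> tight pg_planes meet_in_line \<L>"
    for \<L> :: "('k ^ 'm) set set"
    using PG.polar_threshold[of \<L>, folded pg_lv, OF _ _ L] that N q by simp
  have exists: "\<exists>\<pi> :: ('k ^ 'm) set \<Rightarrow> ('k ^ 'm) set. symplectic_polarity \<pi>" if "n = 5"
  proof -
    have "CARD('m) = 6" using N that by simp
    then obtain B :: "'k ^ 'm \<Rightarrow> 'k ^ 'm \<Rightarrow> 'k" where "symplectic_form B"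
      using symplectic_form_exists by blast
    then have "symplectic_polarity (orth B)" unfolding symplectic_polarity_def orth_def by blast
    then show ?thesis by blast
  qed
  have example: "nontrivial_intriguing pg_planes meet_in_line (totally_isotropic_planes \<pi>) \<and>
      \<not> tight pg_planes meet_in_line (totally_isotropic_planes \<pi>) \<and>
      card (totally_isotropic_planes \<pi>) = (q + 1) * (q ^ 2 + 1) * (q ^ 3 + 1)"
    if "n = 5" and \<pi>: "symplectic_polarity \<pi>" for \<pi> :: "('k ^ 'm) set \<Rightarrow> ('k ^ 'm) set"
  proof -
    obtain B where B: "symplectic_form B" and eq: "\<And>U. vec.subspace U \<Longrightarrow> \<pi> U = orth B U"
      using \<pi> unfolding symplectic_polarity_def orth_def by blast
    have "CARD('m) = 6" using N that(1) by simp
    from symplectic_geom_orth[OF B this]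
    interpret S: symplectic_geom "{U :: ('k ^ 'm) set. vec.subspace U}" "(\<subseteq>)" "(\<inter>)"
      "\<lambda>U W. vec.span (U \<union> W)" vec.dim "CARD('k)" "CARD('m)" meet_in_line "orth B" .
    have "totally_isotropic_planes \<pi> = S.isotropic_planes"
      unfolding S.isotropic_planes_def by (rule totally_isotropic_planes_eq[OF eq])
    then show ?thesis
      using S.isotropic_planes_intriguing S.card_isotropic_planes q unfolding pg_lv by simp
  qed
  show ?thesis unfolding bound
    by (intro conjI impI allI)
      (use partA partB exists example in \<open>simp_all only: simp_thms\<close>)
qed

end
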